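(* Let $A_{\mathrm{RowCol}}=\{0001,0011,0111,00001,00011,00111,01111,000111\}$ and $\mathcal F_{\mathrm{RowCol}}=\bigcup_{k\geq3}\{M_I(k)^*,\overline{M_I(k)^*}\}\cup\{a\odot M_I(|a|)^*: a\in A_{\mathrm{RowCol}}\}\cup\{M_V^*,\overline{M_V^*}\}$, where $|a|$ is the length of $a$, and let $\mathcal F_{\mathrm{RowCol}}^{T}$ be the set of transposes of the matrices in $\mathcal F_{\mathrm{RowCol}}$. A binary matrix $M$ has the circular-ones property for rows and columns if and only if $M$ contains no matrix of $\mathcal F_{\mathrm{RowCol}}\cup\mathcal F_{\mathrm{RowCol}}^{T}$ as a configuration. Moreover, $\mathcal F_{\mathrm{RowCol}}\cup\mathcal F_{\mathrm{RowCol}}^{T}$ is a minimal set having this property, and every matrix in it is a minimal forbidden submatrix for the circular-ones property for rows and columns.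
   Context: A binary matrix has the circular-ones property for rows if its columns can be circularly arranged so that the $1$'s of each row are consecutive; for columns, the same with the roles of rows and columns exchanged; it has the property for rows and columns if it has both. $M$ contains $M'$ as a configuration if a submatrix of $M$ equals $M'$ up to permutations of rows and columns. A minimal forbidden submatrix for the circular-ones property for rows and columns is a matrix lacking that property all of whose other submatrices have it. $\overline M$ exchanges $0$'s and $1$'s; $M^*$ appends a last all-zero column; for $a=a_1\dots a_k$, $a\odot M$ complements each row $i$ of a $k$-row matrix $M$ with $a_i=1$. For $k\ge3$, $M_I(k)$ is the $k\times k$ matrix whose row $i<k$ has ones exactly in columns $i,i+1$ and row $k$ in columns $1,k$. $M_V$ is the $4\times5$ matrix with rows $(1,1,0,0,0),(1,1,1,1,0),(0,0,1,1,0),(1,0,0,1,1)$. *)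

theory Defs
  imports "Jordan_Normal_Form.Matrix" "Jordan_Normal_Form.DL_Submatrix"
    "HOL-Combinatorics.Permutations"
begin

text \<open>
  A binary matrix is a \<^typ>\<open>bool mat\<close>, \<^const>\<open>True\<close> being the entry 1.  Rows and columns are
  indexed from 0.
\<close>

text \<open>The positions \<open>0, \<dots>, n - 1\<close> are placed on a circle; an arc has first position \<open>s\<close>
  and \<open>l\<close> positions (the empty set and the full circle are arcs).\<close>

definition circularly_consecutive :: "nat \<Rightarrow> nat set \<Rightarrow> bool" where
  "circularly_consecutive n S \<longleftrightarrow> (\<exists>s l. l \<le> n \<and> S = (\<lambda>t. (s + t) mod n) ` {..<l})"

text \<open>\<open>\<tau> p\<close> is the column of \<open>M\<close> that is put at position \<open>p\<close>.\<close>

definition circular_ones_rows :: "bool mat \<Rightarrow> bool" where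
  "circular_ones_rows M \<longleftrightarrow>
     (\<exists>\<tau>. \<tau> permutes {..<dim_col M} \<and>
       (\<forall>i<dim_row M. circularly_consecutive (dim_col M) {p. p < dim_col M \<and> M $$ (i, \<tau> p)}))"

definition circular_ones_cols :: "bool mat \<Rightarrow> bool" where
  "circular_ones_cols M \<longleftrightarrow> circular_ones_rows (transpose_mat M)"

definition circular_ones_rows_cols :: "bool mat \<Rightarrow> bool" where
  "circular_ones_rows_cols M \<longleftrightarrow> circular_ones_rows M \<and> circular_ones_cols M"

definition eq_up_to_perm :: "'a mat \<Rightarrow> 'a mat \<Rightarrow> bool" where
  "eq_up_to_perm M N \<longleftrightarrow>
     (\<exists>\<sigma> \<tau>. \<sigma> permutes {..<dim_row M} \<and> \<tau> permutes {..<dim_col M} \<and>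
       N = mat (dim_row M) (dim_col M) (\<lambda>(i, j). M $$ (\<sigma> i, \<tau> j)))"

definition contains_configuration :: "'a mat \<Rightarrow> 'a mat \<Rightarrow> bool" where
  "contains_configuration M N \<longleftrightarrow> (\<exists>I J. eq_up_to_perm (submatrix M I J) N)"

definition minimal_forbidden_submatrix :: "(bool mat \<Rightarrow> bool) \<Rightarrow> bool mat \<Rightarrow> bool" where
  "minimal_forbidden_submatrix P M \<longleftrightarrow>
     \<not> P M \<and> (\<forall>I J. submatrix M I J \<noteq> M \<longrightarrow> P (submatrix M I J))"

definition characterized_by_forbidden :: "(bool mat \<Rightarrow> bool) \<Rightarrow> bool mat set \<Rightarrow> bool" where
  "characterized_by_forbidden P \<F> \<longleftrightarrow>
     (\<forall>M. P M \<longleftrightarrow> \<not> (\<exists>N\<in>\<F>. contains_configuration M N))"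

definition complement_mat :: "bool mat \<Rightarrow> bool mat" where
  "complement_mat M = map_mat Not M"

definition star_mat :: "bool mat \<Rightarrow> bool mat" where
  "star_mat M = mat (dim_row M) (dim_col M + 1) (\<lambda>(i, j). j < dim_col M \<and> M $$ (i, j))"

text \<open>Used only with \<open>length a = dim_row M\<close>.\<close>

definition complement_rows :: "nat list \<Rightarrow> bool mat \<Rightarrow> bool mat"  (infixr \<open>\<odot>\<close> 75) where
  "a \<odot> M = mat (dim_row M) (dim_col M)
     (\<lambda>(i, j). if a ! i = 1 then \<not> M $$ (i, j) else M $$ (i, j))"

definition M_I :: "nat \<Rightarrow> bool mat" where
  "M_I k = mat k k (\<lambda>(i, j).
     if i < k - 1 then j = i \<or> j = i + 1 else j = 0 \<or> j = k - 1)"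

definition M_V :: "bool mat" where
  "M_V = map_mat (\<lambda>x. x = (1::nat)) (mat_of_rows_list 5
     [[1, 1, 0, 0, 0],
      [1, 1, 1, 1, 0],
      [0, 0, 1, 1, 0],
      [1, 0, 0, 1, 1]])"

definition A_RowCol :: "nat list set" where
  "A_RowCol =
     {[0,0,0,1], [0,0,1,1], [0,1,1,1],
      [0,0,0,0,1], [0,0,0,1,1], [0,0,1,1,1], [0,1,1,1,1],
      [0,0,0,1,1,1]}"

definition F_RowCol :: "bool mat set" where
  "F_RowCol =
     (\<Union>k\<in>{3..}. {star_mat (M_I k), complement_mat (star_mat (M_I k))}) \<union>
     {a \<odot> star_mat (M_I (length a)) | a. a \<in> A_RowCol} \<union>
     {star_mat M_V, complement_mat (star_mat M_V)}"

end

theory Submission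
  imports Defs
begin

text \<open>
  Only the split of the columns into the two sides of a row matters, so rows may be complemented freely, and
  a base column turns circular arrangements into linear ones, in which the sets of columns that differ
  from the base column are convex. Two rows cross if both their sides meet pairwise. In a minimal
  non-circular matrix the crossing graph of the rows is connected, since a column set that no row crosses
  would allow the arrangements of its two sides to be glued. Consecutive arrangements of a connected family
  are unique up to reversal and permutations inside classes of equal columns, so two rows that can be
  added to such a family separately, but not together, conflict inside one class, and the conflict
  persists for every connected subfamily that both rows cross. With at least five rows this forces the
  crossing graph to be an induced cycle, and after complementing rows any two non-adjacent rows are
  disjoint: the matrix contains \<open>a \<odot> M_I(n)\<^sup>*\<close>. Up to symmetry of the cycle, a non-constant word \<open>a\<close> outside
  \<open>A_RowCol\<close> produces three columns that on four rows form the transpose of \<open>M_I(3)\<^sup>*\<close> or its complement.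
  With at most four rows, the obstructions come from a finite propositional check.
\<close>

section \<open>Circular and linear arrangements\<close>

text \<open>Only the row property is analysed. The column property is the row property of the
  transpose, and the forbidden family is closed under transposition. The row analysis may therefore
  return a transposed matrix, and this is what leaves finitely many non-constant words
  \<open>a\<close>: for rows alone, every word on every cycle is an obstruction
  (\<open>cyc_noncirc\<close>).

  The threshold of five rows has two sources. A row that crosses both removed rows \<open>r\<close>
  and \<open>s\<close> carries the conflict already together with one neighbour, which leaves four
  rows in all. And the proof that one side of a row serves for all its non-adjacent rows passes from
  one of these to the next, so it starts from two neighbouring ones. Below the threshold, the
  columns of every matrix searched for are pairwise distinct, so only the set of occurring columns
  matters: at most 16 truth values.

  The family is a minimal set because each member is a minimal forbidden submatrix and no two
  members agree up to permutations.\<close>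

text \<open>The injective map \<open>f\<close> cuts the circle open and lists the columns along a line. A row is an arc
  of the circle iff no four columns in this order carry alternating values.\<close>
definition alt_free :: "('c \<Rightarrow> int) \<Rightarrow> 'c set \<Rightarrow> ('c \<Rightarrow> bool) \<Rightarrow> bool" where
  "alt_free f X B \<longleftrightarrow> (\<forall>x\<in>X. \<forall>y\<in>X. \<forall>z\<in>X. \<forall>w\<in>X. f x < f y \<longrightarrow> f y < f z \<longrightarrow> f z < f w \<longrightarrow>
     B x = B z \<longrightarrow> B y = B w \<longrightarrow> B x = B y)"

definition circ :: "'r set \<Rightarrow> 'c set \<Rightarrow> ('r \<Rightarrow> 'c \<Rightarrow> bool) \<Rightarrow> bool" where
  "circ R X A \<longleftrightarrow> (\<exists>f. inj_on f X \<and> (\<forall>i\<in>R. alt_free f X (A i)))"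

lemma circ_mono: "circ R X A \<Longrightarrow> R' \<subseteq> R \<Longrightarrow> X' \<subseteq> X \<Longrightarrow> circ R' X' A"
  unfolding circ_def alt_free_def by (meson inj_on_subset subsetD)

definition convex_in :: "('c \<Rightarrow> int) \<Rightarrow> 'c set \<Rightarrow> 'c set \<Rightarrow> bool" where
  "convex_in f X T \<longleftrightarrow> (\<forall>x\<in>T. \<forall>z\<in>T. \<forall>y\<in>X. f x < f y \<longrightarrow> f y < f z \<longrightarrow> y \<in> T)"

definition lin :: "('r \<Rightarrow> 'c set) \<Rightarrow> 'r set \<Rightarrow> 'c set \<Rightarrow> ('c \<Rightarrow> int) \<Rightarrow> bool" where
  "lin S R X f \<longleftrightarrow> inj_on f X \<and> (\<forall>i\<in>R. convex_in f X (S i))"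

text \<open>The row, complemented if necessary so that the base column \<open>b\<close> has value 0.
  This makes the set independent of complementing rows.\<close>

definition differ_set :: "'c set \<Rightarrow> ('r \<Rightarrow> 'c \<Rightarrow> bool) \<Rightarrow> 'c \<Rightarrow> 'r \<Rightarrow> 'c set" where
  "differ_set X A b i = {x\<in>X. A i x \<noteq> A i b}"

lemma convex_inD: "convex_in f X T \<Longrightarrow> x \<in> T \<Longrightarrow> z \<in> T \<Longrightarrow> y \<in> X \<Longrightarrow> f x < f y \<Longrightarrow> f y < f z \<Longrightarrow> y \<in> T"
  unfolding convex_in_def by blast

lemma convex_in_neg: "convex_in (\<lambda>x. - f x) X T = convex_in f X T"
  unfolding convex_in_def by auto

lemma lin_neg: "lin S R X f \<Longrightarrow> lin S R X (\<lambda>x. - f x)"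
  unfolding lin_def convex_in_neg by (auto simp: inj_on_def)

lemma lin_mono: "lin S R X f \<Longrightarrow> R' \<subseteq> R \<Longrightarrow> lin S R' X f"
  unfolding lin_def by blast

text \<open>The circle is cut at \<open>b\<close>, which becomes the first column. A column that
  agrees with \<open>b\<close> and lies between two columns that differ from \<open>b\<close> would
  alternate with \<open>b\<close> on the original circle.\<close>

lemma circ_imp_lin:
  assumes "circ R X A" "finite X" "b \<in> X"
  shows "\<exists>f. lin (differ_set X A b) R X f"
proof -
  obtain f where inj: "inj_on f X" and alt: "\<And>i. i \<in> R \<Longrightarrow> alt_free f X (A i)"
    using assms(1) unfolding circ_def by blast
  \<comment> \<open>The shift by \<open>2 * K\<close> moves all columns before \<open>b\<close>
    behind all others and keeps the order inside both groups.\<close>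
  define K where "K = Max ((\<lambda>x. \<bar>f x\<bar>) ` X) + 1"
  have bd: "\<bar>f x\<bar> < K" if "x \<in> X" for x
    unfolding K_def using that assms(2) by (simp add: Max_ge le_imp_less_Suc zle_add1_eq_le)
  define g where "g x = (if f x \<ge> f b then f x else f x + 2 * K)" for x
  have injg: "inj_on g X"
  proof (rule inj_onI)
    fix x y assume xy: "x \<in> X" "y \<in> X" "g x = g y"
    have "f x = f y" using xy(3) bd[OF xy(1)] bd[OF xy(2)] unfolding g_def by (auto split: if_splits)
    then show "x = y" using inj xy by (auto dest: inj_onD)
  qed
  have "convex_in g X (differ_set X A b i)" if i: "i \<in> R" for i
    unfolding convex_in_def
  proof (intro ballI impI)
    fix x z y assume h: "x \<in> differ_set X A b i" "z \<in> differ_set X A b i" "y \<in> X" "g x < g y" "g y < g z"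
    have X: "x \<in> X" "z \<in> X" and A: "A i x \<noteq> A i b" "A i z \<noteq> A i b"
      using h by (auto simp: differ_set_def)
    note a = alt[OF i, unfolded alt_free_def, rule_format]
    note B = bd[OF X(1)] bd[OF X(2)] bd[OF h(3)] bd[OF assms(3)]
    show "y \<in> differ_set X A b i"
    proof (rule ccontr)
      assume n: "y \<notin> differ_set X A b i"
      then have y: "A i y = A i b" using h(3) by (auto simp: differ_set_def)
      have ne: "f x \<noteq> f b" "f z \<noteq> f b" using A inj X assms(3) by (auto dest: inj_onD)
      have ne3: "f y \<noteq> f b"
      proof
        assume "f y = f b"
        then show False using h(4) ne B unfolding g_def by (auto split: if_splits)
      qed
      \<comment> \<open>The \<open>g\<close>-order \<open>b\<close>, \<open>x\<close>,
        \<open>y\<close>, \<open>z\<close> comes from one of its four rotations in the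
        \<open>f\<close>-order.\<close>
      consider "f b < f x" "f x < f y" "f y < f z" | "f z < f b" "f b < f x" "f x < f y"
        | "f y < f z" "f z < f b" "f b < f x" | "f x < f y" "f y < f z" "f z < f b"
        using h(4,5) ne ne3 B unfolding g_def by (auto split: if_splits)
      then show False
      proof cases
        case 1 then show False using a[of b x y z] X assms(3) h(3) y A by auto
      next
        case 2 then show False using a[of z b x y] X assms(3) h(3) y A by auto
      next
        case 3 then show False using a[of y z b x] X assms(3) h(3) y A by auto
      next
        case 4 then show False using a[of x y z b] X assms(3) h(3) y A by auto
      qed
    qed
  qed
  then show ?thesis using injg unfolding lin_def by blast
qed

text \<open>Of two alternating pairs exactly one differs from \<open>b\<close>, and convexity
  excludes the column of the other pair that lies between its members.\<close>

lemma lin_imp_alt_free: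
  assumes "lin (differ_set X A b) R X f" "i \<in> R"
  shows "alt_free f X (A i)"
  unfolding alt_free_def
proof (intro ballI impI, rule ccontr)
  fix x y z w assume h: "x \<in> X" "y \<in> X" "z \<in> X" "w \<in> X" "f x < f y" "f y < f z" "f z < f w"
    "A i x = A i z" "A i y = A i w" "A i x \<noteq> A i y"
  have c: "convex_in f X (differ_set X A b i)" using assms unfolding lin_def by blast
  show False
    using convex_inD[OF c, of x z y] convex_inD[OF c, of y w z] h by (auto simp: differ_set_def)
qed

lemma lin_imp_circ: "lin (differ_set X A b) R X f \<Longrightarrow> circ R X A"
  using lin_imp_alt_free unfolding circ_def by (metis lin_def)

text \<open>The base column lies in none of the sets, so it can be moved to the first position.\<close>
lemma circ_imp_alt_free_first:
  assumes "circ R X A" "finite X" "b \<in> X"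
  shows "\<exists>f. inj_on f X \<and> (\<forall>i\<in>R. alt_free f X (A i)) \<and> (\<forall>x\<in>X. x \<noteq> b \<longrightarrow> f b < f x)"
proof -
  obtain f where f: "lin (differ_set X A b) R X f" using circ_imp_lin[OF assms] by blast
  define g where "g x = (if x = b then Min (f ` X) - 1 else f x)" for x
  have lt: "Min (f ` X) \<le> f x" if "x \<in> X" for x using that assms(2) by simp
  have first: "\<forall>x\<in>X. x \<noteq> b \<longrightarrow> g b < g x" using lt unfolding g_def by fastforce
  have inj: "inj_on g X"
  proof (rule inj_onI)
    fix x y assume "x \<in> X" "y \<in> X" "g x = g y"
    then show "x = y" using first f unfolding lin_def g_def by (metis inj_onD less_irrefl)
  qed
  have "convex_in g X (differ_set X A b i)" if "i \<in> R" for i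
    unfolding convex_in_def
  proof (intro ballI impI)
    fix x z y assume h: "x \<in> differ_set X A b i" "z \<in> differ_set X A b i" "y \<in> X" "g x < g y" "g y < g z"
    have c: "convex_in f X (differ_set X A b i)" using f that unfolding lin_def by blast
    have nb: "x \<noteq> b" "z \<noteq> b" "x \<in> X" using h by (auto simp: differ_set_def)
    have "y \<noteq> b" using first nb h(4) by force
    then show "y \<in> differ_set X A b i"
      using convex_inD[OF c h(1,2,3)] h(4,5) nb unfolding g_def by simp
  qed
  then have "lin (differ_set X A b) R X g" using inj unfolding lin_def by blast
  then show ?thesis using inj first lin_imp_alt_free by metis
qed

lemma alt_free_neg: "alt_free (\<lambda>x. - f x) X B \<longleftrightarrow> alt_free f X B"
proof -
  have "alt_free f X B \<Longrightarrow> alt_free (\<lambda>x. - f x) X B" for f :: "'a \<Rightarrow> int"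
    unfolding alt_free_def
  proof (intro ballI impI)
    fix f :: "'a \<Rightarrow> int" and x y z w
    assume h: "\<forall>x\<in>X. \<forall>y\<in>X. \<forall>z\<in>X. \<forall>w\<in>X. f x < f y \<longrightarrow> f y < f z \<longrightarrow> f z < f w \<longrightarrow>
      B x = B z \<longrightarrow> B y = B w \<longrightarrow> B x = B y"
      and m: "x \<in> X" "y \<in> X" "z \<in> X" "w \<in> X" and l: "- f x < - f y" "- f y < - f z" "- f z < - f w"
        "B x = B z" "B y = B w"
    show "B x = B y" using h[rule_format, OF m(4,3,2,1)] l by auto
  qed
  from this[of f] this[of "\<lambda>x. - f x"] show ?thesis by auto
qed

lemma circ_imp_alt_free_last:
  assumes "circ R X A" "finite X" "b \<in> X"
  shows "\<exists>f. inj_on f X \<and> (\<forall>i\<in>R. alt_free f X (A i)) \<and> (\<forall>x\<in>X. x \<noteq> b \<longrightarrow> f x < f b)"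
proof -
  obtain f where f: "inj_on f X" "\<forall>i\<in>R. alt_free f X (A i)" "\<forall>x\<in>X. x \<noteq> b \<longrightarrow> f b < f x"
    using circ_imp_alt_free_first[OF assms] by blast
  show ?thesis
    by (rule exI[of _ "\<lambda>x. - f x"]) (use f in \<open>auto simp: alt_free_neg inj_on_def\<close>)
qed

text \<open>Columns that are equal on all rows may share a position. Ties are broken by an
  enumeration \<open>e\<close>, and neighbours in an alternation never have the same key.\<close>

lemma circ_by_key:
  fixes key :: "'c \<Rightarrow> int"
  assumes fin: "finite X"
    and eq: "\<And>x y i. x \<in> X \<Longrightarrow> y \<in> X \<Longrightarrow> key x = key y \<Longrightarrow> i \<in> R \<Longrightarrow> A i x = A i y"
    and alt: "\<And>i. i \<in> R \<Longrightarrow> alt_free key X (A i)"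
  shows "circ R X A"
proof -
  obtain e :: "'c \<Rightarrow> nat" and n where e: "inj_on e X" "e ` X = {i. i < n}"
    using finite_imp_inj_to_nat_seg[OF fin] by blast
  define f where "f x = key x * int n + int (e x)" for x
  have en: "e x < n" if "x \<in> X" for x using e that by auto
  have le: "key x \<le> key y" if "x \<in> X" "y \<in> X" "f x \<le> f y" for x y
  proof (rule ccontr)
    assume "\<not> key x \<le> key y"
    then have "(key y + 1) * int n \<le> key x * int n" by (intro mult_right_mono) auto
    then show False using that en unfolding f_def by (simp add: algebra_simps) (use en[OF that(2)] in linarith)
  qed
  have inj: "inj_on f X"
  proof (rule inj_onI)
    fix x y assume h: "x \<in> X" "y \<in> X" "f x = f y"
    then have "key x = key y" using le[of x y] le[of y x] by simp
    then show "x = y" using h e(1) unfolding f_def by (auto dest: inj_onD)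
  qed
  have "alt_free f X (A i)" if i: "i \<in> R" for i
    unfolding alt_free_def
  proof (intro ballI impI, rule ccontr)
    fix x y z w assume h: "x \<in> X" "y \<in> X" "z \<in> X" "w \<in> X" "f x < f y" "f y < f z" "f z < f w"
      "A i x = A i z" "A i y = A i w" "A i x \<noteq> A i y"
    have "key x < key y" "key y < key z" "key z < key w"
      using le[of x y] le[of y z] le[of z w] eq[of x y i] eq[of y z i] eq[of z w i] h i by fastforce+
    then show False using alt[OF i] h unfolding alt_free_def by blast
  qed
  then show ?thesis using inj unfolding circ_def by blast
qed

lemma alt_free_interval:
  assumes "\<And>x. x \<in> X \<Longrightarrow> B x \<longleftrightarrow> l \<le> f x \<and> f x \<le> u"
  shows "alt_free f X B"
  unfolding alt_free_def
proof (intro ballI impI, rule ccontr)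
  fix x y z w assume h: "x \<in> X" "y \<in> X" "z \<in> X" "w \<in> X" "f x < f y" "f y < f z" "f z < f w"
    "B x = B z" "B y = B w" "B x \<noteq> B y"
  then show False
    using assms[of x] assms[of y] assms[of z] assms[of w] by (cases "B x") auto
qed

lemma alt_free_Not: "alt_free f X (\<lambda>x. \<not> B x) = alt_free f X B"
  unfolding alt_free_def by auto

lemma alt_free_cong: "(\<And>x. x \<in> X \<Longrightarrow> B x = C x) \<Longrightarrow> alt_free f X B = alt_free f X C"
  unfolding alt_free_def by auto

text \<open>A column set that no row crosses splits the problem in two: each side is arranged together with
  one column representing the other side, and the two arrangements are concatenated.\<close>
lemma circ_glue:
  assumes fin: "finite X" and P: "P \<subseteq> X" "p \<in> P" "q \<in> X - P"
    and const: "\<And>i. i \<in> R \<Longrightarrow> (\<forall>x\<in>P. A i x = A i p) \<or> (\<forall>x\<in>X - P. A i x = A i q)"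
    and c1: "circ R (insert q P) A" and c2: "circ R (insert p (X - P)) A"
  shows "circ R X A"
proof -
  have finP: "finite P" using fin P finite_subset by blast
  obtain f where f: "inj_on f (insert q P)" "\<forall>i\<in>R. alt_free f (insert q P) (A i)"
      "\<forall>x\<in>insert q P. x \<noteq> q \<longrightarrow> f q < f x"
    using circ_imp_alt_free_first[OF c1, of q] finP by blast
  obtain g where g: "inj_on g (insert p (X - P))" "\<forall>i\<in>R. alt_free g (insert p (X - P)) (A i)"
      "\<forall>x\<in>insert p (X - P). x \<noteq> p \<longrightarrow> g x < g p"
    using circ_imp_alt_free_last[OF c2, of p] fin by blast
  \<comment> \<open>\<open>f\<close> puts \<open>q\<close> before all of \<open>P\<close>, and
    \<open>g\<close> puts \<open>p\<close> after all of the rest. Identifying the positions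
    \<open>f q\<close> and \<open>g p\<close> places \<open>P\<close> behind the rest.\<close>
  define h where "h x = (if x \<in> P then f x - f q + g p else g x)" for x
  have fq: "f q < f x" if "x \<in> P" for x using f(3) that P by auto
  have gp: "g x < g p" if "x \<in> X" "x \<notin> P" for x using g(3) that P by auto
  have sep: "h x < h y" if "x \<in> X" "x \<notin> P" "y \<in> P" for x y
    using fq[OF that(3)] gp[OF that(1,2)] that unfolding h_def by simp
  have inj: "inj_on h X"
  proof (rule inj_onI)
    fix x y assume xy: "x \<in> X" "y \<in> X" "h x = h y"
    show "x = y"
    proof (cases "x \<in> P"; cases "y \<in> P")
      assume "x \<in> P" "y \<in> P" then show ?thesis using xy f(1) unfolding h_def by (auto dest: inj_onD)
    next
      assume "x \<notin> P" "y \<notin> P" then show ?thesis using xy g(1) unfolding h_def by (auto dest: inj_onD)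
    next
      assume "x \<notin> P" "y \<in> P" then show ?thesis using sep xy by fastforce
    next
      assume "x \<in> P" "y \<notin> P" then show ?thesis using sep xy by fastforce
    qed
  qed
  have "alt_free h X (A i)" if i: "i \<in> R" for i
    unfolding alt_free_def
  proof (intro ballI impI, rule ccontr)
    fix x y z w assume k: "x \<in> X" "y \<in> X" "z \<in> X" "w \<in> X" "h x < h y" "h y < h z" "h z < h w"
      "A i x = A i z" "A i y = A i w" "A i x \<noteq> A i y"
    have up: "v \<in> P" if "u \<in> P" "h u < h v" "v \<in> X" for u v using sep that by fastforce
    have hf: "h u < h v \<longleftrightarrow> f u < f v" if "u \<in> P" "v \<in> P" for u v using that unfolding h_def by simp
    have hg: "h u < h v \<longleftrightarrow> g u < g v" if "u \<notin> P" "v \<notin> P" for u v using that unfolding h_def by simp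
    note af = f(2)[rule_format, OF i, unfolded alt_free_def, rule_format]
    note ag = g(2)[rule_format, OF i, unfolded alt_free_def, rule_format]
    from const[OF i] show False
    proof
      assume c: "\<forall>x\<in>P. A i x = A i p"
      have z: "z \<notin> P" using c up[of z w] k by metis
      then have y: "y \<notin> P" and x: "x \<notin> P" using up k by blast+
      \<comment> \<open>On a row constant on \<open>P\<close>, at most the last column of an
        alternation lies in \<open>P\<close>, and \<open>p\<close>, the last column of
        \<open>g\<close>, can stand for it. In the other case \<open>q\<close> stands for the first
        column.\<close>
      define w' where "w' = (if w \<in> P then p else w)"
      have w': "w' \<in> insert p (X - P)" "A i w' = A i w" "g z < g w'"
        using k(3,4,7) c z gp hg[OF z] unfolding w'_def by (auto split: if_splits)
      have "g x < g y" "g y < g z" using hg x y z k by blast+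
      then show False using ag[of x y z w'] w' x y z k(1-3,8-10) by simp
    next
      assume c: "\<forall>x\<in>X - P. A i x = A i q"
      have y: "y \<in> P" using c up[of x y] k by (metis DiffI)
      then have z: "z \<in> P" and w: "w \<in> P" using up k by blast+
      define x' where "x' = (if x \<in> P then x else q)"
      have x': "x' \<in> insert q P" "A i x' = A i x" "f x' < f y"
        using k(1,2,5) c y fq hf[OF _ y] unfolding x'_def by (auto split: if_splits)
      have "f y < f z" "f z < f w" using hf w y z k by blast+
      then show False using af[of x' y z w] x' w y z k(8-10) by simp
    qed
  qed
  then show ?thesis using inj unfolding circ_def by blast
qed

section \<open>Connected families of overlapping sets\<close>

text \<open>Connectedness is expressed by cuts, which suits induction; paths appear only where a
  shortest one is needed.\<close>

definition conn :: "('r \<Rightarrow> 'r \<Rightarrow> bool) \<Rightarrow> 'r set \<Rightarrow> bool" where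
  "conn E Q \<longleftrightarrow> (\<forall>T\<subseteq>Q. T \<noteq> {} \<longrightarrow> T \<noteq> Q \<longrightarrow> (\<exists>a\<in>T. \<exists>b\<in>Q - T. E a b))"

lemma connD: "conn E Q \<Longrightarrow> T \<subseteq> Q \<Longrightarrow> T \<noteq> {} \<Longrightarrow> T \<noteq> Q \<Longrightarrow> \<exists>a\<in>T. \<exists>b\<in>Q - T. E a b"
  unfolding conn_def by blast

lemma conn_singleton: "conn E {a}"
  unfolding conn_def by blast

lemma conn_insert:
  assumes Q: "conn E Q" and sym: "symp E" and b: "q \<in> Q" "E q b"
  shows "conn E (insert b Q)"
  unfolding conn_def
proof (intro allI impI)
  fix T assume T: "T \<subseteq> insert b Q" "T \<noteq> {}" "T \<noteq> insert b Q"
  show "\<exists>x\<in>T. \<exists>y\<in>insert b Q - T. E x y"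
  proof (cases "T \<inter> Q = {} \<or> Q \<subseteq> T")
    case True
    then show ?thesis
    proof
      assume e: "T \<inter> Q = {}"
      then have "b \<in> T" using T by blast
      then show ?thesis using e b sym by (metis Diff_iff disjoint_iff insertCI sympD)
    next
      assume e: "Q \<subseteq> T"
      then have "b \<notin> T" using T by blast
      then show ?thesis using e b by blast
    qed
  next
    case False
    then obtain x y where "x \<in> T \<inter> Q" "y \<in> Q - T \<inter> Q" "E x y"
      using connD[OF Q, of "T \<inter> Q"] by blast
    then show ?thesis by blast
  qed
qed

text \<open>A maximal connected subset with the property is everything, since an edge leaving it
  would allow an enlargement.\<close>

lemma conn_induct [consumes 4, case_names single insert]:
  assumes fin: "finite Q" and Q: "conn E Q" and sym: "symp E" and a: "a \<in> Q"
    and base: "P {a}"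
    and step: "\<And>T q b. a \<in> T \<Longrightarrow> T \<subseteq> Q \<Longrightarrow> conn E T \<Longrightarrow> P T \<Longrightarrow> q \<in> T \<Longrightarrow> b \<in> Q - T \<Longrightarrow> E q b \<Longrightarrow> P (insert b T)"
  shows "P Q"
proof -
  define F where "F = {T. a \<in> T \<and> T \<subseteq> Q \<and> conn E T \<and> P T}"
  have finF: "finite F" unfolding F_def using fin by (auto intro: finite_subset[of _ "Pow Q"])
  have "{a} \<in> F" unfolding F_def using a base by (auto simp: conn_singleton)
  then obtain T where T: "T \<in> F" "\<And>T'. T' \<in> F \<Longrightarrow> T \<subseteq> T' \<Longrightarrow> T = T'"
    using finite_has_maximal[OF finF] by blast
  have "T = Q"
  proof (rule ccontr)
    assume "T \<noteq> Q"
    then obtain q b where qb: "q \<in> T" "b \<in> Q - T" "E q b"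
      using connD[OF Q, of T] T(1) unfolding F_def by blast
    then have "insert b T \<in> F"
      using T(1) step[of T q b] conn_insert[OF _ sym, of T q b] unfolding F_def by blast
    then show False using T(2)[of "insert b T"] qb by blast
  qed
  then show ?thesis using T(1) unfolding F_def by blast
qed

text \<open>When the set is grown from \<open>a\<close>, the vertex added last can be
  removed.\<close>

lemma conn_remove:
  assumes fin: "finite Q" and Q: "conn E Q" and sym: "symp E" and a: "a \<in> Q" and ne: "Q \<noteq> {a}"
  shows "\<exists>s\<in>Q. s \<noteq> a \<and> conn E (Q - {s})"
proof -
  have "Q = {a} \<or> (\<exists>s\<in>Q. s \<noteq> a \<and> conn E (Q - {s}))"
    using fin Q sym a
  proof (induction rule: conn_induct)
    case single show ?case by blast
  next
    case (insert T q b)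
    have "insert b T - {b} = T" "b \<noteq> a" using insert by auto
    then show ?case using insert by (metis insertI1)
  qed
  then show ?thesis using ne by blast
qed

lemma conn_neighbour:
  assumes "conn E Q" "a \<in> Q" "b \<in> Q" "a \<noteq> b"
  shows "\<exists>c\<in>Q. c \<noteq> a \<and> E a c"
  using connD[OF assms(1), of "{a}"] assms by blast

lemma conn_pair: "E a b \<Longrightarrow> symp E \<Longrightarrow> conn E {a, b}"
  using conn_insert[OF conn_singleton, of E a a b] by (simp add: insert_commute)

section \<open>Arrangements of overlapping sets and their uniqueness\<close>

definition overlap :: "'c set \<Rightarrow> 'c set \<Rightarrow> bool" where
  "overlap T U \<longleftrightarrow> T \<inter> U \<noteq> {} \<and> T - U \<noteq> {} \<and> U - T \<noteq> {}"

lemma symp_overlap: "symp (\<lambda>i j. overlap (S i) (S j))"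
  unfolding overlap_def symp_def by blast

definition same_class :: "('r \<Rightarrow> 'c set) \<Rightarrow> 'r set \<Rightarrow> 'c \<Rightarrow> 'c \<Rightarrow> bool" where
  "same_class S Q x y \<longleftrightarrow> (\<forall>q\<in>Q. x \<in> S q \<longleftrightarrow> y \<in> S q)"

lemma same_class_refl [simp]: "same_class S Q x x"
  unfolding same_class_def by simp

lemma same_class_sym: "same_class S Q x y \<Longrightarrow> same_class S Q y x"
  unfolding same_class_def by simp

lemma same_class_trans: "same_class S Q x y \<Longrightarrow> same_class S Q y z \<Longrightarrow> same_class S Q x z"
  unfolding same_class_def by simp

lemma same_class_mono: "same_class S Q x y \<Longrightarrow> Q' \<subseteq> Q \<Longrightarrow> same_class S Q' x y"
  unfolding same_class_def by blast

text \<open>Comparing arbitrary representatives \<open>x'\<close>, \<open>y'\<close> of the classes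
  also says that distinct classes do not interleave. For this reason even
  \<open>aligned S Q f f\<close> has content.\<close>

definition aligned :: "('r \<Rightarrow> 'c set) \<Rightarrow> 'r set \<Rightarrow> ('c \<Rightarrow> int) \<Rightarrow> ('c \<Rightarrow> int) \<Rightarrow> bool" where
  "aligned S Q f g \<longleftrightarrow> (\<forall>x\<in>\<Union>(S ` Q). \<forall>y\<in>\<Union>(S ` Q). \<forall>x'\<in>\<Union>(S ` Q). \<forall>y'\<in>\<Union>(S ` Q).
     \<not> same_class S Q x y \<longrightarrow> same_class S Q x x' \<longrightarrow> same_class S Q y y' \<longrightarrow> (f x < f y \<longleftrightarrow> g x' < g y'))"

lemma alignedD:
  "aligned S Q f g \<Longrightarrow> x \<in> \<Union>(S ` Q) \<Longrightarrow> y \<in> \<Union>(S ` Q) \<Longrightarrow> x' \<in> \<Union>(S ` Q) \<Longrightarrow> y' \<in> \<Union>(S ` Q) \<Longrightarrow>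
    \<not> same_class S Q x y \<Longrightarrow> same_class S Q x x' \<Longrightarrow> same_class S Q y y' \<Longrightarrow> f x < f y \<longleftrightarrow> g x' < g y'"
  unfolding aligned_def by blast

lemma aligned_neg:
  assumes "aligned S Q f g"
  shows "aligned S Q (\<lambda>x. - f x) (\<lambda>x. - g x)"
  unfolding aligned_def
proof (intro ballI impI)
  fix x y x' y'
  assume m: "x \<in> \<Union>(S ` Q)" "y \<in> \<Union>(S ` Q)" "x' \<in> \<Union>(S ` Q)" "y' \<in> \<Union>(S ` Q)"
    and c: "\<not> same_class S Q x y" "same_class S Q x x'" "same_class S Q y y'"
  have "\<not> same_class S Q y x" using c(1) same_class_sym by fast
  then show "- f x < - f y \<longleftrightarrow> - g x' < - g y'"
    using alignedD[OF assms m(2,1,4,3) _ c(3,2)] by simp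
qed

lemma convex_union:
  assumes "convex_in f X T" "convex_in f X U" "T \<inter> U \<noteq> {}" "T \<subseteq> X" "U \<subseteq> X" "inj_on f X"
  shows "convex_in f X (T \<union> U)"
  unfolding convex_in_def
proof (intro ballI impI)
  fix x z y assume h: "x \<in> T \<union> U" "z \<in> T \<union> U" "y \<in> X" "f x < f y" "f y < f z"
  obtain c where c: "c \<in> T" "c \<in> U" using assms(3) by blast
  consider "f c < f y" | "f y < f c" | "y = c"
    using assms(4,6) c h(3) by (metis inj_onD linorder_neqE subsetD)
  then show "y \<in> T \<union> U"
  proof cases
    case 1 then show ?thesis using h c convex_inD[OF assms(1), of c z y] convex_inD[OF assms(2), of c z y] by blast
  next
    case 2 then show ?thesis using h c convex_inD[OF assms(1), of x c y] convex_inD[OF assms(2), of x c y] by blast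
  next
    case 3 then show ?thesis using c by blast
  qed
qed

lemma convex_Union:
  assumes "finite Q" "conn (\<lambda>i j. overlap (S i) (S j)) Q" "lin S Q X f" "\<And>i. i \<in> Q \<Longrightarrow> S i \<subseteq> X"
  shows "convex_in f X (\<Union>(S ` Q))"
proof (cases "Q = {}")
  case True then show ?thesis by (simp add: convex_in_def)
next
  case False
  then obtain a where a: "a \<in> Q" by blast
  show ?thesis
    using assms(1,2) symp_overlap a
  proof (induction rule: conn_induct)
    case single then show ?case using assms(3) a unfolding lin_def by simp
  next
    case (insert T q b)
    have "convex_in f X (S b \<union> \<Union>(S ` T))"
    proof (rule convex_union)
      show "convex_in f X (S b)" "inj_on f X" using assms(3) insert unfolding lin_def by auto
      show "S b \<inter> \<Union> (S ` T) \<noteq> {}" using insert unfolding overlap_def by blast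
    qed (use insert assms(4) in auto)
    then show ?case by simp
  qed
qed

text \<open>Two overlapping intervals can lie in two mirror-image ways only, and the pair
  \<open>a1\<close>, \<open>a2\<close> tells which.\<close>

lemma overlap_order:
  assumes P: "convex_in f X P" and B: "convex_in f X B" and sub: "P \<subseteq> X" "B \<subseteq> X" and inj: "inj_on f X"
    and ov: "overlap P B" and a: "a1 \<in> P - B" "a2 \<in> P \<inter> B" "f a1 < f a2"
  shows "z \<in> B - P \<Longrightarrow> p \<in> P \<Longrightarrow> f p < f z"
    and "p \<in> P - B \<Longrightarrow> q \<in> P \<inter> B \<Longrightarrow> f p < f q"
proof -
  have ne: "f u \<noteq> f v" if "u \<in> X" "v \<in> X" "u \<noteq> v" for u v using inj that by (auto dest: inj_onD)
  have up: "f p < f z" if z: "z \<in> B - P" and p: "p \<in> P" for p z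
  proof -
    have "\<not> f z < f a2"
    proof
      assume l: "f z < f a2"
      have "f z \<noteq> f a1" using ne[of z a1] z a sub by blast
      then consider "f z < f a1" | "f a1 < f z" by linarith
      then show False
        using convex_inD[OF B, of z a2 a1] convex_inD[OF P, of a1 a2 z] a z sub l by cases blast+
    qed
    then have l: "f a2 < f z" using ne[of z a2] z a sub by fastforce
    have "\<not> f z < f p" using convex_inD[OF P, of a2 p z] a z p l sub by blast
    then show ?thesis using ne[of z p] z p sub by fastforce
  qed
  then show "z \<in> B - P \<Longrightarrow> p \<in> P \<Longrightarrow> f p < f z" by blast
  obtain z where z: "z \<in> B - P" using ov unfolding overlap_def by blast
  assume p: "p \<in> P - B" and q: "q \<in> P \<inter> B"
  have "\<not> f q < f p" using convex_inD[OF B, of q z p] up[OF z] p q z sub by blast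
  then show "f p < f q" using ne[of p q] p q sub by fastforce
qed

text \<open>The pair \<open>a1\<close>, \<open>a2\<close> orients \<open>S b\<close> against
  \<open>S q\<close> equally under \<open>f\<close> and \<open>g\<close>. Two things are new:
  columns of \<open>S b\<close> outside the old union, which must lie beyond the union, and classes
  that \<open>S b\<close> cuts in two.\<close>

lemma aligned_step:
  assumes fin: "finite T" and T: "conn (\<lambda>i j. overlap (S i) (S j)) T"
    and sub: "\<And>i. i \<in> insert b T \<Longrightarrow> S i \<subseteq> X"
    and f: "lin S (insert b T) X f" and g: "lin S (insert b T) X g"
    and al: "aligned S T f g" and q: "q \<in> T" "overlap (S q) (S b)"
    and a: "a1 \<in> S q - S b" "a2 \<in> S q \<inter> S b" "f a1 < f a2" "g a1 < g a2"
  shows "aligned S (insert b T) f g"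
proof -
  let ?U = "\<Union>(S ` T)" and ?P = "S q" and ?B = "S b"
  have inj: "inj_on f X" "inj_on g X" using f g unfolding lin_def by auto
  have cf: "convex_in f X ?P" "convex_in f X ?B" and cg: "convex_in g X ?P" "convex_in g X ?B"
    using f g q unfolding lin_def by auto
  have sX: "?P \<subseteq> X" "?B \<subseteq> X" using sub q by auto
  have UX: "?U \<subseteq> X" using sub by auto
  have PU: "?P \<subseteq> ?U" using q by blast
  note of = overlap_order[OF cf sX inj(1) q(2) a(1,2,3)]
  note og = overlap_order[OF cg sX inj(2) q(2) a(1,2,4)]
  have cUf: "convex_in f X ?U" using convex_Union[OF fin T lin_mono[OF f]] sub by auto
  have cUg: "convex_in g X ?U" using convex_Union[OF fin T lin_mono[OF g]] sub by auto
  have a2U: "a2 \<in> ?U" using a PU by blast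
  have above: "f x < f y \<and> g x < g y" if "x \<in> ?U" "y \<in> ?B" "y \<notin> ?U" for x y
  proof -
    have y: "y \<in> ?B - ?P" "y \<in> X" using that PU sX by auto
    have "x \<in> X" "x \<noteq> y" using that UX by auto
    then have ne: "f x \<noteq> f y" "g x \<noteq> g y"
      using inj_onD[OF inj(1), of x y] inj_onD[OF inj(2), of x y] y(2) by auto
    have "f a2 < f y" "g a2 < g y" using of(1)[OF y(1), of a2] og(1)[OF y(1), of a2] a by auto
    then have "\<not> f y < f x" "\<not> g y < g x"
      using convex_inD[OF cUf a2U that(1) y(2)] convex_inD[OF cUg a2U that(1) y(2)] that(3) by auto
    then show ?thesis using ne by auto
  qed
  have cut: "(if x \<in> ?P then f y < f x \<and> g y' < g x' else f x < f y \<and> g x' < g y')"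
    if m: "x \<in> ?U" "y \<in> ?U" "x' \<in> ?U" "y' \<in> ?U" and c: "same_class S T x y" "same_class S T x x'" "same_class S T y y'"
      and B: "x \<in> ?B" "x' \<in> ?B" "y \<notin> ?B" "y' \<notin> ?B" for x y x' y'
  proof (cases "x \<in> ?P")
    case True
    then have "y \<in> ?P" "x' \<in> ?P" "y' \<in> ?P" using c q unfolding same_class_def by auto
    then show ?thesis using of(2)[of y x] og(2)[of y' x'] True B by simp
  next
    case False
    \<comment> \<open>Outside \<open>S q\<close> the part of the class in \<open>S b\<close> lies
      nearer to \<open>a2\<close>: \<open>S b\<close> is convex and contains \<open>a2\<close>, so
      no column outside \<open>S b\<close> lies between \<open>a2\<close> and
      \<open>x\<close>.\<close>
    then have nP: "y \<notin> ?P" "x' \<notin> ?P" "y' \<notin> ?P" using c q unfolding same_class_def by auto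
    have na: "\<not> same_class S T a2 x" using a q(1) False unfolding same_class_def by blast
    have fx: "f a2 < f x" and gx: "g a2 < g x'" using of(1)[of x a2] og(1)[of x' a2] a False nP B by auto
    have gy: "g a2 < g y'"
      using alignedD[OF al a2U m(1) a2U m(4) na] fx c by (meson same_class_refl same_class_trans)
    have fy: "f a2 < f y"
    proof -
      have "\<not> same_class S T a2 y" using na c by (meson same_class_sym same_class_trans)
      then show ?thesis
        using alignedD[OF al a2U m(2) a2U m(3)] gx c by (meson same_class_refl same_class_sym same_class_trans)
    qed
    have "\<not> f y < f x" using convex_inD[OF cf(2), of a2 x y] a B fy m UX by blast
    moreover have "\<not> g y' < g x'" using convex_inD[OF cg(2), of a2 x' y'] a B gy m UX by blast
    moreover have "f x \<noteq> f y" "g x' \<noteq> g y'" using inj m UX B by (metis inj_onD subsetD)+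
    ultimately show ?thesis using False by simp
  qed
  show ?thesis
    unfolding aligned_def
  proof (intro ballI impI)
    fix x y x' y'
    assume m: "x \<in> \<Union>(S ` insert b T)" "y \<in> \<Union>(S ` insert b T)" "x' \<in> \<Union>(S ` insert b T)" "y' \<in> \<Union>(S ` insert b T)"
      and c: "\<not> same_class S (insert b T) x y" "same_class S (insert b T) x x'" "same_class S (insert b T) y y'"
    have cT: "same_class S T x x'" "same_class S T y y'" using c(2,3) by (auto intro: same_class_mono)
    have B: "x \<in> ?B \<longleftrightarrow> x' \<in> ?B" "y \<in> ?B \<longleftrightarrow> y' \<in> ?B" using c(2,3) unfolding same_class_def by auto
    have xU: "x \<in> ?U \<longleftrightarrow> x' \<in> ?U" "y \<in> ?U \<longleftrightarrow> y' \<in> ?U" using cT unfolding same_class_def by auto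
    show "f x < f y \<longleftrightarrow> g x' < g y'"
    proof (cases "x \<in> ?U"; cases "y \<in> ?U")
      assume U: "x \<in> ?U" "y \<in> ?U"
      then have U': "x' \<in> ?U" "y' \<in> ?U" using xU by auto
      show ?thesis
      proof (cases "same_class S T x y")
        case False
        then show ?thesis using alignedD[OF al U U'] cT by blast
      next
        case True
        then have "x \<in> ?B \<longleftrightarrow> y \<notin> ?B" using c(1) unfolding same_class_def by auto
        then show ?thesis
          using cut[OF U U' True cT] cut[OF U(2,1) U'(2,1) same_class_sym[OF True] cT(2,1)] B
          by (cases "x \<in> ?B") (auto split: if_splits)
      qed
    next
      assume U: "x \<in> ?U" "y \<notin> ?U"
      then have "y \<in> ?B" "y' \<in> ?B" "y' \<notin> ?U" "x' \<in> ?U" using m xU B by auto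
      then show ?thesis using above[of x y] above[of x' y'] U by auto
    next
      assume U: "x \<notin> ?U" "y \<in> ?U"
      then have "x \<in> ?B" "x' \<in> ?B" "x' \<notin> ?U" "y' \<in> ?U" using m xU B by auto
      then show ?thesis using above[of y x] above[of y' x'] U by auto
    next
      assume U: "x \<notin> ?U" "y \<notin> ?U"
      then have "same_class S (insert b T) x y" using m unfolding same_class_def by auto
      then show ?thesis using c(1) by blast
    qed
  qed
qed

text \<open>Consecutive arrangements of a connected family are unique up to reversal and up to
  permutations inside the classes.\<close>
theorem conn_aligned:
  assumes fin: "finite Q" and Q: "conn (\<lambda>i j. overlap (S i) (S j)) Q"
    and sub: "\<And>i. i \<in> Q \<Longrightarrow> S i \<subseteq> X"
    and f: "lin S Q X f" and g: "lin S Q X g"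
  shows "aligned S Q f g \<or> aligned S Q f (\<lambda>x. - g x)"
proof (cases "Q = {}")
  case True then show ?thesis by (simp add: aligned_def)
next
  case False
  then obtain a where a: "a \<in> Q" by blast
  have inj: "inj_on f X" "inj_on g X" using f g unfolding lin_def by auto
  show ?thesis
    using fin Q symp_overlap a
  proof (induction rule: conn_induct)
    case single
    then show ?case by (auto simp: aligned_def same_class_def)
  next
    case (insert T q b)
    have finT: "finite T" using insert fin finite_subset by blast
    have subT: "S i \<subseteq> X" if "i \<in> insert b T" for i using that insert sub by blast
    have fb: "lin S (insert b T) X f" and gb: "lin S (insert b T) X g"
      using f g insert lin_mono by (metis Diff_iff insert_subset)+
    have ov: "overlap (S q) (S b)" using insert by blast
    have step: "aligned S (insert b T) f h"
      if h: "lin S (insert b T) X h" "aligned S T f h"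
        and a: "a1 \<in> S q - S b" "a2 \<in> S q \<inter> S b" "f a1 < f a2 \<longleftrightarrow> h a1 < h a2" for h a1 a2
    proof -
      have aX: "a1 \<in> X" "a2 \<in> X" "a1 \<noteq> a2" using a subT insert by auto
      have "inj_on h X" using h unfolding lin_def by blast
      then have ne: "f a1 \<noteq> f a2" "h a1 \<noteq> h a2" using aX inj by (auto dest: inj_onD)
      show ?thesis
      proof (cases "f a1 < f a2")
        case True
        then show ?thesis
          using aligned_step[OF finT insert.hyps(3) subT fb h insert.hyps(4) ov a(1,2)] a(3) by blast
      next
        case False
        have "aligned S (insert b T) (\<lambda>x. - f x) (\<lambda>x. - h x)"
          using aligned_step[OF finT insert.hyps(3) subT lin_neg[OF fb] lin_neg[OF h(1)] aligned_neg[OF h(2)]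
              insert.hyps(4) ov a(1,2)] a(3) False ne by simp
        from aligned_neg[OF this] show ?thesis by simp
      qed
    qed
    show ?case
    proof (cases "T = {q}")
      case True
      \<comment> \<open>A single set has only one class inside its union, so alignment is vacuous
        and \<open>g\<close> or its reversal can be chosen freely.\<close>
      have al: "aligned S T f h" for h unfolding True aligned_def same_class_def by auto
      obtain a1 a2 where aa: "a1 \<in> S q - S b" "a2 \<in> S q \<inter> S b" using ov unfolding overlap_def by blast
      then have aX: "a1 \<in> X" "a2 \<in> X" "a1 \<noteq> a2" using subT insert by auto
      then have "g a1 \<noteq> g a2" using inj by (auto dest: inj_onD)
      then have "(f a1 < f a2 \<longleftrightarrow> g a1 < g a2) \<or> (f a1 < f a2 \<longleftrightarrow> - g a1 < - g a2)" by auto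
      then show ?thesis using step[OF gb al aa] step[OF lin_neg[OF gb] al aa] by blast
    next
      case False
      have "\<exists>c\<in>T. c \<noteq> q \<and> overlap (S q) (S c)"
        using conn_neighbour[OF insert.hyps(3) insert.hyps(4)] False insert.hyps(4) by blast
      then obtain c where c: "c \<in> T" "overlap (S q) (S c)" by blast
      obtain b1 b2 where bb: "b1 \<in> S q - S b" "b2 \<in> S q \<inter> S b" using ov unfolding overlap_def by blast
      obtain c1 c2 where cc: "c1 \<in> S q - S c" "c2 \<in> S q \<inter> S c" using c unfolding overlap_def by blast
      \<comment> \<open>Witnesses in different classes let the old alignment decide the orientation
        towards \<open>S b\<close>. If there were none, all of \<open>S q\<close> would be one
        class, but \<open>S c\<close> splits it.\<close>
      have "\<exists>a1 a2. a1 \<in> S q - S b \<and> a2 \<in> S q \<inter> S b \<and> \<not> same_class S T a1 a2"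
      proof (rule ccontr)
        assume n: "\<not> ?thesis"
        then have al: "same_class S T u v" if "u \<in> S q - S b" "v \<in> S q \<inter> S b" for u v using that by blast
        have "same_class S T u b2" if "u \<in> S q" for u
          using al[of u b2] al[OF bb] al[of b1 u] bb that by (metis DiffI IntI same_class_sym same_class_trans)
        then have "same_class S T c1 c2" using cc by (metis DiffD1 IntD1 same_class_sym same_class_trans)
        then show False using c cc unfolding same_class_def by blast
      qed
      then obtain a1 a2 where aa: "a1 \<in> S q - S b" "a2 \<in> S q \<inter> S b" "\<not> same_class S T a1 a2" by blast
      have aU: "a1 \<in> \<Union>(S ` T)" "a2 \<in> \<Union>(S ` T)" using aa insert.hyps(4) by auto
      have agree: "f a1 < f a2 \<longleftrightarrow> h a1 < h a2" if "aligned S T f h" for h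
        using alignedD[OF that aU aU aa(3)] by simp
      show ?thesis
        using insert.IH step[OF gb _ aa(1,2)] step[OF lin_neg[OF gb] _ aa(1,2)] agree by blast
    qed
  qed
qed

text \<open>By uniqueness \<open>f\<close> is aligned with itself or with its reversal, and the pair
  \<open>x\<close>, \<open>y\<close> excludes the reversal.\<close>

lemma aligned_self:
  assumes "finite Q" "conn (\<lambda>i j. overlap (S i) (S j)) Q" "\<And>i. i \<in> Q \<Longrightarrow> S i \<subseteq> X" "lin S Q X f"
    and xy: "x \<in> \<Union>(S ` Q)" "y \<in> \<Union>(S ` Q)" "\<not> same_class S Q x y"
  shows "aligned S Q f f"
proof -
  have "\<not> aligned S Q f (\<lambda>x. - f x)"
  proof
    assume al: "aligned S Q f (\<lambda>x. - f x)"
    have "f x < f y \<longleftrightarrow> - f x < - f y"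
      using alignedD[OF al xy(1,2,1,2,3)] by simp
    moreover have "f x \<noteq> f y"
    proof
      assume "f x = f y"
      moreover have "x \<in> X" "y \<in> X" using xy assms(3) by auto
      ultimately have "x = y" using assms(4) unfolding lin_def by (auto dest: inj_onD)
      then show False using xy(3) by simp
    qed
    ultimately show False by auto
  qed
  then show ?thesis using conn_aligned[OF assms(1-4,4)] by blast
qed

text \<open>The classes of \<open>insert r Q\<close> are ordered by \<open>f\<close>, the columns
  inside each class by \<open>g\<close>. The rows of \<open>insert r Q\<close> do not see the order
  inside a class. For \<open>s\<close>, the order of the two parts into which \<open>r\<close> cuts
  a class of \<open>Q\<close> has to fit \<open>g\<close>, and this is \<open>agree\<close>.\<close>

lemma lin_merge:
  assumes finX: "finite X" and finQ: "finite Q"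
    and Q: "conn (\<lambda>i j. overlap (S i) (S j)) Q" and Qr: "conn (\<lambda>i j. overlap (S i) (S j)) (insert r Q)"
    and sub: "\<And>i. i \<in> insert s (insert r Q) \<Longrightarrow> S i \<subseteq> X"
    and f: "lin S (insert r Q) X f" and g: "lin S (insert s Q) X g" and al: "aligned S Q f g"
    and ab: "a \<in> \<Union>(S ` Q)" "b \<in> \<Union>(S ` Q)" "\<not> same_class S Q a b"
    and sU: "S s \<subseteq> \<Union>(S ` Q)"
    and agree: "\<And>x y. x \<in> \<Union>(S ` Q) \<Longrightarrow> y \<in> \<Union>(S ` Q) \<Longrightarrow> same_class S Q x y \<Longrightarrow>
      x \<in> S r \<Longrightarrow> y \<notin> S r \<Longrightarrow> (x \<in> S s) \<noteq> (y \<in> S s) \<Longrightarrow> f x < f y \<longleftrightarrow> g x < g y"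
  shows "\<exists>h. lin S (insert s (insert r Q)) X h"
proof -
  let ?U = "\<Union>(S ` Q)"
  have inj: "inj_on f X" "inj_on g X" using f g unfolding lin_def by auto
  have UX: "?U \<subseteq> X" using sub by auto
  define cl where "cl x = {y\<in>X. same_class S (insert r Q) x y}" for x
  \<comment> \<open>Only classes inside the union are contracted to one value; the columns outside
    all sets may lie at both ends and need not form an interval.\<close>
  define F where "F x = (if x \<in> ?U then Min (f ` cl x) else f x)" for x
  have rep: "\<exists>x'\<in>X. F x = f x' \<and> same_class S (insert r Q) x x' \<and> (x \<notin> ?U \<longrightarrow> x' = x)" if x: "x \<in> X" for x
  proof (cases "x \<in> ?U")
    case True
    have "x \<in> cl x" "finite (cl x)" using x finX unfolding cl_def by auto
    then have "Min (f ` cl x) \<in> f ` cl x" by (intro Min_in) auto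
    then show ?thesis using True unfolding F_def cl_def by auto
  next
    case False then show ?thesis using x unfolding F_def by (auto intro!: bexI[of _ x])
  qed
  have Feq: "F x = F y" if "x \<in> ?U" "same_class S (insert r Q) x y" for x y
  proof -
    have "y \<in> ?U" using that unfolding same_class_def by auto
    moreover have "cl x = cl y" using that(2) unfolding cl_def same_class_def by auto
    ultimately show ?thesis using that(1) unfolding F_def by simp
  qed
  have Feq': "same_class S (insert r Q) x y" if xy: "x \<in> X" "y \<in> X" "F x = F y" for x y
  proof -
    obtain x' where x': "x' \<in> X" "F x = f x'" "same_class S (insert r Q) x x'" using rep[OF xy(1)] by blast
    obtain y' where y': "y' \<in> X" "F y = f y'" "same_class S (insert r Q) y y'" using rep[OF xy(2)] by blast
    have "x' = y'" using x' y' xy(3) inj(1) by (auto dest: inj_onD)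
    then show ?thesis using x' y' by (metis same_class_sym same_class_trans)
  qed
  define K where "K = 2 * Max ((\<lambda>x. \<bar>g x\<bar>) ` X) + 1"
  have bd: "2 * \<bar>g x\<bar> < K" if "x \<in> X" for x
  proof -
    have "\<bar>g x\<bar> \<le> Max ((\<lambda>x. \<bar>g x\<bar>) ` X)" using that finX by simp
    then show ?thesis unfolding K_def by linarith
  qed
  define h where "h x = F x * K + g x" for x
  have Flt: "h x < h y" if "x \<in> X" "y \<in> X" "F x < F y" for x y
  proof -
    have "0 \<le> K" using bd[OF that(1)] by linarith
    then have "(F x + 1) * K \<le> F y * K" using that(3) by (intro mult_right_mono) auto
    then show ?thesis using bd[OF that(1)] bd[OF that(2)] unfolding h_def by (simp add: algebra_simps)
  qed
  have hlt: "F x < F y \<or> F x = F y \<and> g x < g y" if "x \<in> X" "y \<in> X" "h x < h y" for x y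
    using Flt[of y x] that unfolding h_def by (cases "F x" "F y" rule: linorder_cases) auto
  have "inj_on h X"
  proof (rule inj_onI)
    fix x y assume xy: "x \<in> X" "y \<in> X" "h x = h y"
    then have "F x = F y" using Flt[of x y] Flt[of y x] by (cases "F x" "F y" rule: linorder_cases) auto
    then show "x = y" using xy inj(2) unfolding h_def by (auto dest: inj_onD)
  qed
  moreover have "convex_in h X (S i)" if i: "i \<in> insert r Q" for i
    unfolding convex_in_def
  proof (intro ballI impI)
    fix x z y assume k: "x \<in> S i" "z \<in> S i" "y \<in> X" "h x < h y" "h y < h z"
    have X: "x \<in> X" "z \<in> X" using k sub i by auto
    have c: "convex_in f X (S i)" using f i unfolding lin_def by blast
    obtain x' where x': "x' \<in> X" "F x = f x'" "same_class S (insert r Q) x x'" using rep[OF X(1)] by blast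
    obtain y' where y': "y' \<in> X" "F y = f y'" "same_class S (insert r Q) y y'" using rep[OF k(3)] by blast
    obtain z' where z': "z' \<in> X" "F z = f z'" "same_class S (insert r Q) z z'" using rep[OF X(2)] by blast
    have m: "x' \<in> S i" "z' \<in> S i" "y' \<in> S i \<longleftrightarrow> y \<in> S i" using x' z' y' k i unfolding same_class_def by blast+
    show "y \<in> S i"
    proof (cases "F x = F y \<or> F y = F z")
      case True
      then show ?thesis using Feq'[OF X(1) k(3)] Feq'[OF k(3) X(2)] k i unfolding same_class_def by blast
    next
      case False
      then have "f x' < f y'" "f y' < f z'" using hlt[OF X(1) k(3,4)] hlt[OF k(3) X(2) k(5)] x' y' z' by auto
      then show ?thesis using convex_inD[OF c m(1,2) y'(1)] m(3) by blast
    qed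
  qed
  moreover have "convex_in h X (S s)"
    unfolding convex_in_def
  proof (intro ballI impI, rule ccontr)
    fix x z y assume k: "x \<in> S s" "z \<in> S s" "y \<in> X" "h x < h y" "h y < h z" and n: "y \<notin> S s"
    have U: "x \<in> ?U" "z \<in> ?U" using k sU by auto
    then have X: "x \<in> X" "z \<in> X" using UX by auto
    have finQr: "finite (insert r Q)" using finQ by simp
    have cU: "convex_in f X ?U" by (rule convex_Union[OF finQ Q lin_mono[OF f]]) (use sub in auto)
    have yU: "y \<in> ?U"
    proof (rule ccontr)
      assume ny: "y \<notin> ?U"
      obtain x' where x': "x' \<in> X" "F x = f x'" "same_class S (insert r Q) x x'" using rep[OF X(1)] by blast
      obtain z' where z': "z' \<in> X" "F z = f z'" "same_class S (insert r Q) z z'" using rep[OF X(2)] by blast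
      have U': "x' \<in> ?U" "z' \<in> ?U" using x' z' U unfolding same_class_def by auto
      have "F x \<noteq> F y" "F y \<noteq> F z"
        using Feq'[OF X(1) k(3)] Feq'[OF k(3) X(2)] U ny unfolding same_class_def by auto
      then have "f x' < f y" "f y < f z'"
        using hlt[OF X(1) k(3,4)] hlt[OF k(3) X(2) k(5)] x' z' ny unfolding F_def[of y] by auto
      then show False using convex_inD[OF cU U' k(3)] ny by blast
    qed
    have self: "aligned S (insert r Q) f f"
    proof (rule aligned_self[OF finQr Qr _ f])
      show "\<not> same_class S (insert r Q) a b" using ab(3) by (auto intro: same_class_mono)
    qed (use sub ab in auto)
    \<comment> \<open>Where \<open>s\<close> separates two columns, \<open>h\<close> orders them as
      \<open>g\<close> does, so a gap of \<open>S s\<close> under \<open>h\<close> would be a gap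
      under \<open>g\<close>.\<close>
    have key: "g u < g v" if uv: "u \<in> ?U" "v \<in> ?U" "h u < h v" "(u \<in> S s) \<noteq> (v \<in> S s)" for u v
    proof -
      have uX: "u \<in> X" "v \<in> X" using uv UX by auto
      obtain u' where u': "u' \<in> X" "F u = f u'" "same_class S (insert r Q) u u'" using rep[OF uX(1)] by blast
      obtain v' where v': "v' \<in> X" "F v = f v'" "same_class S (insert r Q) v v'" using rep[OF uX(2)] by blast
      have cQ: "same_class S Q u' u" "same_class S Q v' v"
        using u' v' by (auto intro: same_class_mono same_class_sym)
      have U': "u' \<in> ?U" "v' \<in> ?U" using cQ uv unfolding same_class_def by auto
      show ?thesis
      proof (cases "same_class S (insert r Q) u v")
        case True
        then have "F u = F v" using Feq uv by blast
        then show ?thesis using hlt[OF uX uv(3)] by simp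
      next
        case False
        then have "F u \<noteq> F v" using Feq'[OF uX] by blast
        then have l: "f u' < f v'" using hlt[OF uX uv(3)] u' v' by auto
        have n': "\<not> same_class S (insert r Q) u' v'"
          using False u'(3) v'(3) by (meson same_class_sym same_class_trans)
        have fuv: "f u < f v"
          using alignedD[OF self _ _ _ _ n' same_class_sym[OF u'(3)] same_class_sym[OF v'(3)]] l U' uv by auto
        show ?thesis
        proof (cases "same_class S Q u v")
          case True
          then have "(u \<in> S r) \<noteq> (v \<in> S r)" using False unfolding same_class_def by auto
          moreover have "g u \<noteq> g v" using inj(2) uX uv(4) by (auto dest: inj_onD)
          ultimately show ?thesis
            using agree[OF uv(1,2) True] agree[OF uv(2,1) same_class_sym[OF True]] uv(4) fuv by fastforce
        next
          case F2: False
          then show ?thesis using alignedD[OF al uv(1,2,1,2) F2] fuv by simp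
        qed
      qed
    qed
    have "g x < g y" "g y < g z" using key[of x y] key[of y z] U yU k n by auto
    moreover have "convex_in g X (S s)" using g unfolding lin_def by blast
    ultimately show False using convex_inD[of g X "S s" x z y] k n by simp
  qed
  ultimately show ?thesis unfolding lin_def by blast
qed

section \<open>Merging two extensions of a connected family\<close>

text \<open>All four quadrants are inhabited, a condition that is invariant under complementing
  rows.\<close>

definition crosses :: "'c set \<Rightarrow> ('r \<Rightarrow> 'c \<Rightarrow> bool) \<Rightarrow> 'r \<Rightarrow> 'r \<Rightarrow> bool" where
  "crosses X A i j \<longleftrightarrow> (\<forall>a b. \<exists>x\<in>X. A i x = a \<and> A j x = b)"

lemma crosses_sym: "crosses X A i j \<Longrightarrow> crosses X A j i"
  unfolding crosses_def by blast

lemma symp_crosses: "symp (crosses X A)"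
  using crosses_sym by (rule sympI)

text \<open>The base column itself inhabits the fourth quadrant, the one outside both sets.\<close>

lemma crosses_iff_overlap:
  assumes "b \<in> X"
  shows "crosses X A = (\<lambda>i j. overlap (differ_set X A b i) (differ_set X A b j))"
proof (intro ext)
  fix i j
  show "crosses X A i j = overlap (differ_set X A b i) (differ_set X A b j)"
  proof
    assume c: "crosses X A i j"
    then obtain x y z where "x \<in> X" "A i x = (\<not> A i b)" "A j x = (\<not> A j b)" "y \<in> X" "A i y = (\<not> A i b)" "A j y = A j b"
      "z \<in> X" "A i z = A i b" "A j z = (\<not> A j b)" unfolding crosses_def by metis
    then have "x \<in> differ_set X A b i \<inter> differ_set X A b j" "y \<in> differ_set X A b i - differ_set X A b j"
      "z \<in> differ_set X A b j - differ_set X A b i" unfolding differ_set_def by auto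
    then show "overlap (differ_set X A b i) (differ_set X A b j)" unfolding overlap_def by blast
  next
    assume "overlap (differ_set X A b i) (differ_set X A b j)"
    then obtain x y z where "x \<in> X" "A i x = (\<not> A i b)" "A j x = (\<not> A j b)" "y \<in> X" "A i y = (\<not> A i b)" "A j y = A j b"
      "z \<in> X" "A i z = A i b" "A j z = (\<not> A j b)" unfolding overlap_def differ_set_def by blast
    then show "crosses X A i j" unfolding crosses_def using assms by metis
  qed
qed

lemma same_class_differ_set:
  assumes "x \<in> X" "y \<in> X"
  shows "same_class (differ_set X A b) Q x y \<longleftrightarrow> (\<forall>q\<in>Q. A q x = A q y)"
  using assms unfolding same_class_def differ_set_def by auto

text \<open>Two crossing rows have four quadrants, and the ends of an arc lie in at most two of the classes,
  so some class is not cut by \<open>s\<close>.\<close>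
lemma exists_uncut_class:
  assumes fin: "finite X" and ab: "a \<in> Q" "b \<in> Q" "crosses X A a b" and c: "circ (insert s Q) X A"
  shows "\<exists>p\<in>X. \<forall>x\<in>X. (\<forall>q\<in>Q. A q x = A q p) \<longrightarrow> A s x = A s p"
proof (rule ccontr)
  assume "\<not> ?thesis"
  then have cutp: "\<exists>x\<in>X. (\<forall>q\<in>Q. A q x = A q p) \<and> A s x \<noteq> A s p" if "p \<in> X" for p using that by blast
  obtain p where p: "p \<in> X" using ab(3) unfolding crosses_def by blast
  let ?S = "differ_set X A p"
  obtain f where f: "lin ?S (insert s Q) X f" using circ_imp_lin[OF c fin p] by blast
  have ov: "overlap (?S a) (?S b)" using ab(3) unfolding crosses_iff_overlap[OF p] .
  have both: "\<exists>u\<in>T. \<exists>v\<in>T. u \<in> ?S s \<and> v \<notin> ?S s"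
    if w: "w \<in> T" and T: "T = ?S a - ?S b \<or> T = ?S a \<inter> ?S b \<or> T = ?S b - ?S a" for w T
  proof -
    have wX: "w \<in> X" using w T unfolding differ_set_def by auto
    obtain x where x: "x \<in> X" "\<forall>q\<in>Q. A q x = A q w" "A s x \<noteq> A s w" using cutp[OF wX] by blast
    have "x \<in> T" using w T x ab unfolding differ_set_def by auto
    moreover have "(x \<in> ?S s) \<noteq> (w \<in> ?S s)" using x wX unfolding differ_set_def by auto
    ultimately show ?thesis using w by blast
  qed
  obtain w1 w2 w3 where w: "w1 \<in> ?S a - ?S b" "w2 \<in> ?S a \<inter> ?S b" "w3 \<in> ?S b - ?S a"
    using ov unfolding overlap_def by blast
  obtain u1 where u1: "u1 \<in> ?S a - ?S b" "u1 \<in> ?S s" using both[OF w(1)] by blast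
  obtain v2 where v2: "v2 \<in> ?S a \<inter> ?S b" "v2 \<notin> ?S s" using both[OF w(2)] by blast
  obtain u3 where u3: "u3 \<in> ?S b - ?S a" "u3 \<in> ?S s" using both[OF w(3)] by blast
  have X: "u1 \<in> X" "v2 \<in> X" "u3 \<in> X" using u1 v2 u3 unfolding differ_set_def by auto
  \<comment> \<open>The three columns come from the three consecutive pieces of two overlapping
    intervals, so \<open>v2\<close>, outside the set of \<open>s\<close>, lies between two of its
    members.\<close>
  have main: False if g: "lin ?S (insert s Q) X g" and l: "g u1 < g v2" for g
  proof -
    have cv: "convex_in g X (?S a)" "convex_in g X (?S b)" "convex_in g X (?S s)" "inj_on g X"
      using g ab unfolding lin_def by auto
    have "g v2 < g u3"
      using overlap_order(1)[OF cv(1,2) _ _ cv(4) ov u1(1) v2(1) l u3(1)] v2(1) unfolding differ_set_def by auto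
    then show False using convex_inD[OF cv(3) u1(2) u3(2) X(2) l] v2 by blast
  qed
  have "f u1 \<noteq> f v2" using f X u1 v2 unfolding lin_def by (metis inj_onD)
  then show False using main[OF f] main[OF lin_neg[OF f]] by force
qed

text \<open>The rows \<open>r\<close> and \<open>s\<close> are added to a connected family \<open>Q\<close>. The hypothesis \<open>agree\<close> says that the two
  single extensions order every class of \<open>Q\<close> compatibly; the base column is chosen such that \<open>s\<close> does not
  cut the unordered outer class.\<close>
lemma circ_merge:
  fixes A :: "'r \<Rightarrow> 'c \<Rightarrow> bool"
  assumes finX: "finite X" and finQ: "finite Q" and Q: "conn (crosses X A) Q"
    and Q': "Q' \<subseteq> Q" "a \<in> Q'" "b \<in> Q'" "crosses X A a b"
    and r: "q \<in> Q" "crosses X A q r" and cr: "circ (insert r Q) X A" and cs: "circ (insert s Q) X A"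
    and agree: "\<And>p f g x y. p \<in> X \<Longrightarrow> lin (differ_set X A p) (insert r Q) X f \<Longrightarrow> lin (differ_set X A p) (insert s Q) X g \<Longrightarrow>
      aligned (differ_set X A p) Q f g \<Longrightarrow> differ_set X A p s \<subseteq> \<Union>(differ_set X A p ` Q') \<Longrightarrow>
      x \<in> \<Union>(differ_set X A p ` Q) \<Longrightarrow> y \<in> \<Union>(differ_set X A p ` Q) \<Longrightarrow> same_class (differ_set X A p) Q x y \<Longrightarrow>
      x \<in> differ_set X A p r \<Longrightarrow> y \<notin> differ_set X A p r \<Longrightarrow> (x \<in> differ_set X A p s) \<noteq> (y \<in> differ_set X A p s) \<Longrightarrow>
      f x < f y \<longleftrightarrow> g x < g y"
  shows "circ (insert s (insert r Q)) X A"
proof -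
  have "circ (insert s Q') X A" using circ_mono[OF cs] Q'(1) by blast
  then obtain p where p: "p \<in> X" "\<And>x. x \<in> X \<Longrightarrow> (\<forall>q\<in>Q'. A q x = A q p) \<Longrightarrow> A s x = A s p"
    using exists_uncut_class[OF finX Q'(2-4)] by blast
  let ?S = "differ_set X A p"
  have cross: "crosses X A = (\<lambda>i j. overlap (?S i) (?S j))" using crosses_iff_overlap[OF p(1)] .
  have sub: "?S i \<subseteq> X" for i unfolding differ_set_def by auto
  have sU': "?S s \<subseteq> \<Union>(?S ` Q')" using p(2) unfolding differ_set_def by auto
  then have sU: "?S s \<subseteq> \<Union>(?S ` Q)" using Q'(1) by blast
  have Qr: "conn (crosses X A) (insert r Q)" using conn_insert[OF Q symp_crosses r] .
  obtain f where f: "lin ?S (insert r Q) X f" using circ_imp_lin[OF cr finX p(1)] by blast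
  obtain g0 where g0: "lin ?S (insert s Q) X g0" using circ_imp_lin[OF cs finX p(1)] by blast
  have "aligned ?S Q f g0 \<or> aligned ?S Q f (\<lambda>x. - g0 x)"
    using conn_aligned[OF finQ Q[unfolded cross] sub lin_mono[OF f] lin_mono[OF g0]] by blast
  then obtain g where g: "lin ?S (insert s Q) X g" "aligned ?S Q f g" using g0 lin_neg[OF g0] by blast
  obtain x y where xy: "x \<in> ?S a - ?S b" "y \<in> ?S a \<inter> ?S b" using Q'(4) unfolding cross overlap_def by blast
  have "\<exists>h. lin ?S (insert s (insert r Q)) X h"
  proof (rule lin_merge[OF finX finQ Q[unfolded cross] Qr[unfolded cross] sub f g])
    show "x \<in> \<Union>(?S ` Q)" "y \<in> \<Union>(?S ` Q)" using xy Q' by blast+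
    show "\<not> same_class ?S Q x y" using xy Q' unfolding same_class_def by blast
  qed (use sU agree[OF p(1) f g sU'] in blast)+
  then obtain h where "lin ?S (insert s (insert r Q)) X h" by blast
  then show ?thesis by (rule lin_imp_circ)
qed

text \<open>For \<open>z\<close> inside the union this is self-alignment; a column outside cannot
  come between because the union is an interval.\<close>

lemma class_contiguous:
  assumes "finite Q" "conn (\<lambda>i j. overlap (S i) (S j)) Q" "\<And>i. i \<in> Q \<Longrightarrow> S i \<subseteq> X" "lin S Q X f"
    and xy: "x \<in> \<Union>(S ` Q)" "y \<in> \<Union>(S ` Q)" "same_class S Q x y" and z: "z \<in> X" "\<not> same_class S Q z x"
  shows "f z < f x \<longleftrightarrow> f z < f y"
proof (cases "z \<in> \<Union>(S ` Q)")
  case True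
  have "aligned S Q f f" using aligned_self[OF assms(1-4) True xy(1) z(2)] .
  then show ?thesis using alignedD[of S Q f f z x z y] True xy z(2) by simp
next
  case False
  have c: "convex_in f X (\<Union>(S ` Q))" using convex_Union[OF assms(1,2,4,3)] .
  have X: "x \<in> X" "y \<in> X" using xy assms(3) by auto
  have "inj_on f X" "z \<noteq> x" "z \<noteq> y" using False xy assms(4) unfolding lin_def by auto
  then have "f z \<noteq> f x" "f z \<noteq> f y" using inj_onD[of f X z x] inj_onD[of f X z y] X z(1) by auto
  then show ?thesis
    using convex_inD[OF c xy(1,2) z(1)] convex_inD[OF c xy(2,1) z(1)] False by linarith
qed

text \<open>Two extensions can only conflict in a pair of columns that is equal on \<open>Q\<close>
  and separated by both \<open>r\<close> and \<open>s\<close>. The contrapositive supplies such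
  pairs in minimal obstructions.\<close>

lemma circ_merge_no_pair:
  assumes "finite X" "finite Q" "conn (crosses X A) Q" "a \<in> Q" "b \<in> Q" "crosses X A a b"
    and "q \<in> Q" "crosses X A q r" "circ (insert r Q) X A" "circ (insert s Q) X A"
    and none: "\<not> (\<exists>x\<in>X. \<exists>y\<in>X. (\<forall>q\<in>Q. A q x = A q y) \<and> A r x \<noteq> A r y \<and> A s x \<noteq> A s y)"
  shows "circ (insert s (insert r Q)) X A"
proof (rule circ_merge[OF assms(1,2,3) subset_refl assms(4-10)])
  fix p and f g :: "'a \<Rightarrow> int" and x y
  assume h: "x \<in> \<Union>(differ_set X A p ` Q)" "y \<in> \<Union>(differ_set X A p ` Q)" "same_class (differ_set X A p) Q x y"
    "x \<in> differ_set X A p r" "y \<notin> differ_set X A p r" "(x \<in> differ_set X A p s) \<noteq> (y \<in> differ_set X A p s)"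
  then have X: "x \<in> X" "y \<in> X" unfolding differ_set_def by auto
  have "\<forall>q\<in>Q. A q x = A q y" using h(3) same_class_differ_set[OF X] by metis
  moreover have "A r x \<noteq> A r y" "A s x \<noteq> A s y" using h(4-6) X unfolding differ_set_def by auto
  ultimately show "f x < f y \<longleftrightarrow> g x < g y" using none X by blast
qed

text \<open>An arrangement \<open>k\<close> of \<open>Q'\<close> with both rows orders the critical
  pair as \<open>f\<close> and as \<open>g\<close>. The crossing rows \<open>a\<close>,
  \<open>b\<close> fix the orientation, so \<open>k\<close> cannot be aligned with \<open>f\<close>
  and reversed against \<open>g\<close>. Hence a conflict over \<open>Q\<close> is already one over
  \<open>Q'\<close>.\<close>

lemma circ_merge_subfamily:
  assumes finX: "finite X" and finQ: "finite Q" and Q: "conn (crosses X A) Q"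
    and Q': "Q' \<subseteq> Q" "conn (crosses X A) Q'" "a \<in> Q'" "b \<in> Q'" "crosses X A a b"
    and r: "q \<in> Q'" "crosses X A q r" and s: "q' \<in> Q'" "crosses X A q' s"
    and cr: "circ (insert r Q) X A" and cs: "circ (insert s Q) X A" and c: "circ (insert s (insert r Q')) X A"
  shows "circ (insert s (insert r Q)) X A"
proof (rule circ_merge[OF finX finQ Q Q'(1,3-5) _ r(2) cr cs])
  show "q \<in> Q" using Q' r by blast
  fix p and f g :: "'a \<Rightarrow> int" and x y
  let ?S = "differ_set X A p"
  let ?U = "\<Union>(?S ` Q)" and ?U' = "\<Union>(?S ` Q')"
  assume p: "p \<in> X" and f: "lin ?S (insert r Q) X f" and g: "lin ?S (insert s Q) X g" and al: "aligned ?S Q f g"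
    and sU: "?S s \<subseteq> ?U'" and xy: "x \<in> ?U" "y \<in> ?U" "same_class ?S Q x y" "x \<in> ?S r" "y \<notin> ?S r"
      "(x \<in> ?S s) \<noteq> (y \<in> ?S s)"
  have cross: "crosses X A = (\<lambda>i j. overlap (?S i) (?S j))" using crosses_iff_overlap[OF p] .
  have sub: "?S i \<subseteq> X" for i unfolding differ_set_def by auto
  have finQ': "finite (insert i Q')" for i using finQ Q'(1) finite_subset by blast
  have Qr: "conn (\<lambda>i j. overlap (?S i) (?S j)) (insert r Q')" and Qs: "conn (\<lambda>i j. overlap (?S i) (?S j)) (insert s Q')"
    using conn_insert[OF Q'(2) symp_crosses r] conn_insert[OF Q'(2) symp_crosses s] unfolding cross by simp_all
  obtain k0 where k0: "lin ?S (insert s (insert r Q')) X k0" using circ_imp_lin[OF c finX p] by blast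
  have f': "lin ?S (insert r Q') X f" and g': "lin ?S (insert s Q') X g"
    by (rule lin_mono[OF f], use Q'(1) in blast) (rule lin_mono[OF g], use Q'(1) in blast)
  have "aligned ?S (insert r Q') f k0 \<or> aligned ?S (insert r Q') f (\<lambda>x. - k0 x)"
    by (rule conn_aligned[OF finQ' Qr sub f' lin_mono[OF k0]]) blast
  then obtain k where k: "lin ?S (insert s (insert r Q')) X k" "aligned ?S (insert r Q') f k"
    using k0 lin_neg[OF k0] by blast
  have or: "aligned ?S (insert s Q') g k \<or> aligned ?S (insert s Q') g (\<lambda>x. - k x)"
    by (rule conn_aligned[OF finQ' Qs sub g' lin_mono[OF k(1)]]) blast
  obtain u v where uv: "u \<in> ?S a - ?S b" "v \<in> ?S a \<inter> ?S b" using Q'(5) unfolding cross overlap_def by blast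
  have uvU: "u \<in> ?U'" "v \<in> ?U'" using uv Q' by blast+
  have nuv: "\<not> same_class ?S Q' u v" using uv Q' unfolding same_class_def by blast
  have mono: "\<not> same_class ?S T u v" if "Q' \<subseteq> T" for T using nuv that same_class_mono by metis
  have U: "?U' \<subseteq> \<Union>(?S ` insert i Q')" "?U' \<subseteq> ?U" for i using Q'(1) by auto
  have "\<not> aligned ?S (insert s Q') g (\<lambda>x. - k x)"
  proof
    assume n: "aligned ?S (insert s Q') g (\<lambda>x. - k x)"
    have "g u < g v \<longleftrightarrow> - k u < - k v" using alignedD[OF n, of u v u v] uvU U mono[of "insert s Q'"] by auto
    moreover have "f u < f v \<longleftrightarrow> k u < k v" using alignedD[OF k(2), of u v u v] uvU U mono[of "insert r Q'"] by auto
    moreover have "f u < f v \<longleftrightarrow> g u < g v" using alignedD[OF al, of u v u v] uvU U mono[of Q] Q'(1) by auto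
    moreover have "k u \<noteq> k v"
    proof -
      have "u \<in> X" "v \<in> X" "u \<noteq> v" using uv sub by blast+
      then show ?thesis using k(1) inj_onD[of k X u v] unfolding lin_def by blast
    qed
    ultimately show False by auto
  qed
  then have ak: "aligned ?S (insert s Q') g k" using or by blast
  have "same_class ?S Q' x y" using xy(3) Q'(1) same_class_mono by metis
  then have "x \<in> ?U' \<longleftrightarrow> y \<in> ?U'" unfolding same_class_def by auto
  then have U': "x \<in> ?U'" "y \<in> ?U'" using xy(6) sU by auto
  have "f x < f y \<longleftrightarrow> k x < k y"
    using alignedD[OF k(2), of x y x y] U' U xy unfolding same_class_def by auto
  moreover have "g x < g y \<longleftrightarrow> k x < k y"
    using alignedD[OF ak, of x y x y] U' U xy unfolding same_class_def by auto
  ultimately show "f x < f y \<longleftrightarrow> g x < g y" by blast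
qed

text \<open>If two columns of one class were ordered differently by the two extensions, then both \<open>r\<close> and \<open>s\<close>
  would reach out of that class on the same side.\<close>
lemma circ_merge_not_crossing:
  assumes finX: "finite X" and finQ: "finite Q" and Q: "conn (crosses X A) Q"
    and ab: "a \<in> Q" "b \<in> Q" "crosses X A a b"
    and q1: "q1 \<in> Q" "crosses X A q1 r" "\<not> crosses X A q1 s"
    and q2: "q2 \<in> Q" "crosses X A q2 s" "\<not> crosses X A q2 r"
    and n: "\<not> crosses X A r s"
    and cr: "circ (insert r Q) X A" and cs: "circ (insert s Q) X A"
  shows "circ (insert s (insert r Q)) X A"
proof (rule circ_merge[OF finX finQ Q subset_refl ab q1(1,2) cr cs])
  fix p and f0 g0 :: "'a \<Rightarrow> int" and x y
  let ?S = "differ_set X A p"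
  let ?U = "\<Union>(?S ` Q)"
  assume p: "p \<in> X" and f0: "lin ?S (insert r Q) X f0" and g0: "lin ?S (insert s Q) X g0" and al0: "aligned ?S Q f0 g0"
    and sU: "?S s \<subseteq> ?U" and x: "x \<in> ?U" and y: "y \<in> ?U" and xy: "same_class ?S Q x y"
    and rx: "x \<in> ?S r" and ry: "y \<notin> ?S r" and sxy: "(x \<in> ?S s) \<noteq> (y \<in> ?S s)"
  have cross: "crosses X A = (\<lambda>i j. overlap (?S i) (?S j))" using crosses_iff_overlap[OF p] .
  have sub: "?S i \<subseteq> X" for i unfolding differ_set_def by auto
  note Q' = Q[unfolded cross]
  have X: "x \<in> X" "y \<in> X" using x y sub by auto
  have nov: "?S r \<inter> ?S s = {} \<or> ?S r \<subseteq> ?S s \<or> ?S s \<subseteq> ?S r" using n unfolding cross overlap_def by blast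
  have ov1: "overlap (?S q1) (?S r)" "\<not> overlap (?S q1) (?S s)" using q1 unfolding cross by auto
  have ov2: "overlap (?S q2) (?S s)" "\<not> overlap (?S q2) (?S r)" using q2 unfolding cross by auto
  have xyQ: "x \<in> ?S i \<longleftrightarrow> y \<in> ?S i" if "i \<in> Q" for i using xy that unfolding same_class_def by blast
  \<comment> \<open>One implication suffices; reversing both arrangements gives the other.\<close>
  have imp: "g x < g y" if f: "lin ?S (insert r Q) X f" and g: "lin ?S (insert s Q) X g" and al: "aligned ?S Q f g"
    and fxy: "f x < f y" for f g
  proof (rule ccontr)
    assume "\<not> g x < g y"
    moreover have inj: "inj_on f X" "inj_on g X" using f g unfolding lin_def by auto
    moreover have "x \<noteq> y" using rx ry by blast
    ultimately have gyx: "g y < g x" using X by (metis inj_onD linorder_neqE)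
    have ne: "f z \<noteq> f w" "g z \<noteq> g w" if "z \<in> X" "w \<in> X" "z \<noteq> w" for z w
      using inj_onD[OF inj(1), of z w] inj_onD[OF inj(2), of z w] that by auto
    have cr: "convex_in f X (?S r)" and cs: "convex_in g X (?S s)" using f g unfolding lin_def by auto
    have cf: "f z < f x \<longleftrightarrow> f z < f y" if "z \<in> X" "\<not> same_class ?S Q z x" for z
      by (rule class_contiguous[OF finQ Q' sub lin_mono[OF f] x y xy that]) blast
    have cg: "g z < g x \<longleftrightarrow> g z < g y" if "z \<in> X" "\<not> same_class ?S Q z x" for z
      by (rule class_contiguous[OF finQ Q' sub lin_mono[OF g] x y xy that]) blast
    have fg: "f z < f w \<longleftrightarrow> g z < g w" if "z \<in> ?U" "w \<in> ?U" "\<not> same_class ?S Q z w" for z w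
      using alignedD[OF al that(1,2,1,2,3)] by simp
    \<comment> \<open>\<open>r\<close> contains \<open>x\<close> but not the later \<open>y\<close>;
      being an interval, it can leave the class only before it.\<close>
    have below_r: "f u < f x" if u: "u \<in> ?S r" "\<not> same_class ?S Q u x" for u
    proof (rule ccontr)
      assume "\<not> f u < f x"
      then have "\<not> f u < f y" using cf u sub by blast
      then have "f y < f u" using ne(1)[of y u] u ry X sub by fastforce
      then show False using convex_inD[OF cr rx u(1) X(2) fxy] ry by blast
    qed
    show False
    proof (cases "x \<in> ?S s")
      case sx: False
      then have sy: "y \<in> ?S s" using sxy by blast
      have dj: "?S r \<inter> ?S s = {}" using nov rx ry sx sy by blast
      have below_s: "g v < g y" if v: "v \<in> ?S s" "\<not> same_class ?S Q v x" for v
      proof (rule ccontr)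
        assume "\<not> g v < g y"
        then have "\<not> g v < g x" using cg v sub by blast
        then have "g x < g v" using ne(2)[of x v] v sx X sub by fastforce
        then show False using convex_inD[OF cs sy v(1) X(1) gyx] sx by blast
      qed
      \<comment> \<open>\<open>q1\<close> crosses \<open>r\<close> but not \<open>s\<close>, and
        \<open>r\<close>, \<open>s\<close> are disjoint here; so the set of \<open>s\<close> lies on
        one side of \<open>q1\<close>, and \<open>r\<close> has a column \<open>u\<close> on the
        other side.\<close>
      have "\<exists>u\<in>?S r. (u \<in> ?S q1) \<noteq> (x \<in> ?S q1) \<and> (\<forall>w\<in>?S s. (w \<in> ?S q1) \<noteq> (u \<in> ?S q1))"
      proof -
        have "\<not> ?S q1 \<subseteq> ?S s" using ov1(1) dj unfolding overlap_def by blast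
        then consider "?S q1 \<inter> ?S s = {}" | "?S s \<subseteq> ?S q1" using ov1(2) unfolding overlap_def by blast
        then show ?thesis
        proof cases
          case 1
          moreover obtain u where "u \<in> ?S q1 \<inter> ?S r" using ov1(1) unfolding overlap_def by blast
          moreover have "x \<notin> ?S q1" using 1 sy xyQ[OF q1(1)] by blast
          ultimately show ?thesis by blast
        next
          case 2
          moreover obtain u where "u \<in> ?S r - ?S q1" using ov1(1) unfolding overlap_def by blast
          moreover have "x \<in> ?S q1" using 2 sy xyQ[OF q1(1)] by blast
          ultimately show ?thesis by blast
        qed
      qed
      then obtain u where u: "u \<in> ?S r" "(u \<in> ?S q1) \<noteq> (x \<in> ?S q1)" "\<And>w. w \<in> ?S s \<Longrightarrow> (w \<in> ?S q1) \<noteq> (u \<in> ?S q1)"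
        by blast
      obtain v where v: "v \<in> ?S s" "(v \<in> ?S q2) \<noteq> (x \<in> ?S q2)"
        using ov2(1) unfolding overlap_def by blast
      have cu: "\<not> same_class ?S Q u x" and cv: "\<not> same_class ?S Q v x" and cuv: "\<not> same_class ?S Q u v"
        using u v q1(1) q2(1) unfolding same_class_def by blast+
      have uX: "u \<in> X" and vX: "v \<in> X" and vU: "v \<in> ?U" using u v sub sU by blast+
      have fu: "f u < f x" using below_r u(1) cu by blast
      have gv: "g v < g y" using below_s v(1) cv by blast
      have cvy: "\<not> same_class ?S Q v y" using cv xy by (meson same_class_sym same_class_trans)
      have fv: "f v < f x" using fg[OF vU y cvy] gv cf[OF vX cv] by blast
      have "\<not> f u < f v" using convex_inD[OF cr u(1) rx vX _ fv] v(1) dj by blast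
      \<comment> \<open>In \<open>f\<close> the order is \<open>v\<close>, \<open>u\<close>,
        \<open>x\<close>. If \<open>u\<close> is in the union, this transfers to \<open>g\<close>
        and puts \<open>u\<close> between two columns of \<open>s\<close>, against disjointness; if
        not, it contradicts the convexity of the union.\<close>
      then have fvu: "f v < f u" using ne(1)[OF uX vX] cuv by force
      show False
      proof (cases "u \<in> ?U")
        case True
        have "\<not> same_class ?S Q v u" using cuv same_class_sym by fast
        then have "g v < g u" using fg[OF vU True] fvu by blast
        moreover have "g u < g y" using fg[OF True x cu] fu cg[OF uX cu] by blast
        ultimately have "u \<in> ?S s" using convex_inD[OF cs v(1) sy uX] by blast
        then show False using dj u(1) by blast
      next
        case False
        have "convex_in f X ?U" by (rule convex_Union[OF finQ Q' lin_mono[OF f] sub]) blast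
        then show False using convex_inD[of f X ?U v x u] vU x uX fvu fu False by blast
      qed
    next
      case sx: True
      then have sy: "y \<notin> ?S s" using sxy by blast
      \<comment> \<open>A column of the smaller set outside the class belongs to both sets. It would
        have to precede the class for \<open>r\<close> and follow it for \<open>s\<close>, although
        \<open>f\<close> and \<open>g\<close> agree about its place.\<close>
      consider "?S r \<subseteq> ?S s" | "?S s \<subseteq> ?S r" using nov rx sx by blast
      then show False
      proof cases
        case 1
        obtain u where u: "u \<in> ?S r" "(u \<in> ?S q1) \<noteq> (x \<in> ?S q1)"
          using ov1(1) unfolding overlap_def by blast
        have cu: "\<not> same_class ?S Q u x" using u q1(1) unfolding same_class_def by blast
        have uX: "u \<in> X" and uU: "u \<in> ?U" and us: "u \<in> ?S s" using u sub sU 1 by blast+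
        have "f u < f x" using below_r u(1) cu by blast
        then have "g u < g y" using fg[OF uU x cu] cg[OF uX cu] by blast
        then show False using convex_inD[OF cs us sx X(2) _ gyx] sy by blast
      next
        case 2
        obtain v where v: "v \<in> ?S s" "(v \<in> ?S q2) \<noteq> (x \<in> ?S q2)"
          using ov2(1) unfolding overlap_def by blast
        have cv: "\<not> same_class ?S Q v x" using v q2(1) unfolding same_class_def by blast
        have vX: "v \<in> X" and vU: "v \<in> ?U" using v sub sU by blast+
        have "\<not> g v < g x" using cg[OF vX cv] convex_inD[OF cs v(1) sx X(2) _ gyx] sy by blast
        then have "\<not> f v < f y" using fg[OF vU x cv] cf[OF vX cv] by blast
        then have "f y < f v" using ne(1)[OF vX X(2)] v(1) 2 ry by force
        then show False using convex_inD[OF cr rx _ X(2) fxy] v(1) 2 ry by blast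
      qed
    qed
  qed
  have "f0 x \<noteq> f0 y" using f0 X rx ry inj_onD[of f0 X x y] unfolding lin_def by blast
  then show "f0 x < f0 y \<longleftrightarrow> g0 x < g0 y"
    using imp[OF f0 g0 al0] imp[OF lin_neg[OF f0] lin_neg[OF g0] aligned_neg[OF al0]] by fastforce
qed

section \<open>Minimal obstructions with at least five rows\<close>

definition minimal_noncirc :: "'r set \<Rightarrow> 'c set \<Rightarrow> ('r \<Rightarrow> 'c \<Rightarrow> bool) \<Rightarrow> bool" where
  "minimal_noncirc R X A \<longleftrightarrow> finite R \<and> finite X \<and> \<not> circ R X A \<and>
     (\<forall>R'. R' \<subset> R \<longrightarrow> circ R' X A) \<and> (\<forall>X'. X' \<subset> X \<longrightarrow> circ R X' A)"

lemma exists_minimal_noncirc: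
  assumes "finite R" "finite X" "\<not> circ R X A"
  shows "\<exists>R' X'. R' \<subseteq> R \<and> X' \<subseteq> X \<and> minimal_noncirc R' X' A"
  using assms
proof (induction "card R + card X" arbitrary: R X rule: less_induct)
  case less
  show ?case
  proof (cases "minimal_noncirc R X A")
    case True then show ?thesis by blast
  next
    case False
    then consider R' where "R' \<subset> R" "\<not> circ R' X A" | X' where "X' \<subset> X" "\<not> circ R X' A"
      using less.prems unfolding minimal_noncirc_def by blast
    then show ?thesis
    proof cases
      case 1
      then show ?thesis
        using less.hyps[of R' X] less.prems psubset_card_mono[OF less.prems(1) 1(1)]
        by (meson add_less_mono1 finite_subset order_trans psubset_imp_subset)
    next
      case 2
      then show ?thesis
        using less.hyps[of R X'] less.prems psubset_card_mono[OF less.prems(2) 2(1)]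
        by (meson add_less_cancel_left finite_subset order_trans psubset_imp_subset)
    qed
  qed
qed

text \<open>A row with at most one column on some side is an arc in every arrangement, so the matrix
  without it would still be non-circular.\<close>

lemma minimal_noncirc_two_each:
  assumes "minimal_noncirc R X A" "i \<in> R"
  shows "\<exists>x\<in>X. \<exists>y\<in>X. x \<noteq> y \<and> A i x = c \<and> A i y = c"
proof (rule ccontr)
  assume n: "\<not> ?thesis"
  have "circ (R - {i}) X A" using assms unfolding minimal_noncirc_def by blast
  then obtain f where f: "inj_on f X" "\<forall>j\<in>R - {i}. alt_free f X (A j)" unfolding circ_def by blast
  have "alt_free f X (A i)"
    unfolding alt_free_def
  proof (intro ballI impI, rule ccontr)
    fix x y z w assume h: "x \<in> X" "y \<in> X" "z \<in> X" "w \<in> X" "f x < f y" "f y < f z" "f z < f w"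
      "A i x = A i z" "A i y = A i w" "A i x \<noteq> A i y"
    have "x \<noteq> z" "y \<noteq> w" using h by auto
    then show False using n h by (cases "A i x = c") blast+
  qed
  then have "\<forall>j\<in>R. alt_free f X (A j)" using f(2) by blast
  then show False using f(1) assms unfolding minimal_noncirc_def circ_def by blast
qed

text \<open>Otherwise the two sides could be glued. Two columns on each side make both pieces proper
  column sets, which minimality declares circular.\<close>

lemma minimal_noncirc_glue:
  assumes M: "minimal_noncirc R X A" and P: "P \<subseteq> X"
    and two: "p \<in> P" "p' \<in> P" "p \<noteq> p'" "q \<in> X - P" "q' \<in> X - P" "q \<noteq> q'"
  shows "\<exists>i\<in>R. (\<exists>x\<in>P. \<exists>y\<in>P. A i x \<noteq> A i y) \<and> (\<exists>x\<in>X - P. \<exists>y\<in>X - P. A i x \<noteq> A i y)"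
proof (rule ccontr)
  assume n: "\<not> ?thesis"
  have "circ R X A"
  proof (rule circ_glue[OF _ P two(1,4)])
    show "finite X" using M unfolding minimal_noncirc_def by blast
    show "(\<forall>x\<in>P. A i x = A i p) \<or> (\<forall>x\<in>X - P. A i x = A i q)" if "i \<in> R" for i
      using n that two by blast
    have "insert q P \<subset> X" using P two by blast
    moreover have "insert p (X - P) \<subset> X"
    proof
      show "insert p (X - P) \<subseteq> X" using P two by blast
      have "p' \<in> X" "p' \<notin> insert p (X - P)" using P two(2,3) by auto
      then show "insert p (X - P) \<noteq> X" by blast
    qed
    ultimately show "circ R (insert q P) A" "circ R (insert p (X - P)) A"
      using M unfolding minimal_noncirc_def by blast+
  qed
  then show False using M unfolding minimal_noncirc_def by blast
qed

lemma not_crosses_const: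
  "\<not> crosses X A i j \<longleftrightarrow> (\<exists>b. \<forall>x\<in>X. \<forall>y\<in>X. A j x = b \<longrightarrow> A j y = b \<longrightarrow> A i x = A i y)"
  (is "?l \<longleftrightarrow> ?r")
proof
  assume ?l
  then obtain a b where "\<forall>x\<in>X. A i x = a \<longrightarrow> A j x \<noteq> b" unfolding crosses_def by blast
  then have "\<forall>x\<in>X. \<forall>y\<in>X. A j x = b \<longrightarrow> A j y = b \<longrightarrow> A i x = A i y" by (cases a) blast+
  then show ?r by blast
next
  assume ?r
  then obtain b where b: "\<forall>x\<in>X. \<forall>y\<in>X. A j x = b \<longrightarrow> A j y = b \<longrightarrow> A i x = A i y" by blast
  show ?l
  proof
    assume c: "crosses X A i j"
    obtain x where "x \<in> X" "A i x" "A j x = b" using c unfolding crosses_def by blast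
    moreover obtain y where "y \<in> X" "\<not> A i y" "A j y = b" using c unfolding crosses_def by blast
    ultimately show False using b by blast
  qed
qed

text \<open>A row outside a connected set of rows without crossings to it has a side inside one class of that
  set, and this class is a column set that no row crosses.\<close>
lemma minimal_noncirc_conn:
  assumes M: "minimal_noncirc R X A"
  shows "conn (crosses X A) R"
proof (rule ccontr)
  assume "\<not> ?thesis"
  then obtain T0 where T0: "T0 \<subseteq> R" "T0 \<noteq> {}" "T0 \<noteq> R" "\<forall>a\<in>T0. \<forall>b\<in>R - T0. \<not> crosses X A a b"
    unfolding conn_def by blast
  define cl where "cl T \<longleftrightarrow> T \<subseteq> R \<and> T \<noteq> {} \<and> T \<noteq> R \<and> (\<forall>a\<in>T. \<forall>b\<in>R - T. \<not> crosses X A a b)" for T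
  have finR: "finite R" using M unfolding minimal_noncirc_def by blast
  have "finite {T. cl T}" unfolding cl_def by (rule finite_subset[of _ "Pow R"]) (use finR in auto)
  moreover have "T0 \<in> {T. cl T}" using T0 unfolding cl_def by blast
  ultimately obtain T where T: "cl T" and minT: "\<And>T'. cl T' \<Longrightarrow> T' \<subseteq> T \<Longrightarrow> T = T'"
    using finite_has_minimal[of "{T. cl T}"] by blast
  have connT: "conn (crosses X A) T"
    unfolding conn_def
  proof (intro allI impI, rule ccontr)
    fix T' assume T': "T' \<subseteq> T" "T' \<noteq> {}" "T' \<noteq> T" "\<not> (\<exists>a\<in>T'. \<exists>b\<in>T - T'. crosses X A a b)"
    have "cl T'" using T T' unfolding cl_def by blast
    then show False using minT T' by blast
  qed
  have side: "\<exists>b. \<forall>a\<in>T. \<forall>x\<in>X. \<forall>y\<in>X. A j x = b \<longrightarrow> A j y = b \<longrightarrow> A a x = A a y" if j: "j \<in> R - T" for j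
  proof -
    \<comment> \<open>\<open>K b\<close> collects the rows of \<open>T\<close> that are constant on
      side \<open>b\<close> of \<open>j\<close>. If a row of \<open>K False\<close> crossed one of
      \<open>K True\<close>, the column taking the opposite values of both constants would lie on
      neither side of \<open>j\<close>. So connectedness makes one of the two sets all of
      \<open>T\<close>.\<close>
    define K where "K b = {a\<in>T. \<forall>x\<in>X. \<forall>y\<in>X. A j x = b \<longrightarrow> A j y = b \<longrightarrow> A a x = A a y}" for b
    have all: "a \<in> K True \<or> a \<in> K False" if "a \<in> T" for a
    proof -
      have "\<not> crosses X A a j" using T that j unfolding cl_def by blast
      then obtain b where "\<forall>x\<in>X. \<forall>y\<in>X. A j x = b \<longrightarrow> A j y = b \<longrightarrow> A a x = A a y"
        unfolding not_crosses_const by blast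
      then have "a \<in> K b" using that unfolding K_def by blast
      then show ?thesis by (cases b) simp_all
    qed
    have "K False = T \<or> K False = {}"
    proof (rule ccontr)
      assume "\<not> ?thesis"
      moreover have "K False \<subseteq> T" unfolding K_def by blast
      ultimately obtain a a' where aa: "a \<in> K False" "a' \<in> T - K False" "crosses X A a a'"
        using connD[OF connT, of "K False"] by blast
      then have a': "a' \<in> K True" using all by blast
      obtain x0 where x0: "x0 \<in> X" "\<not> A j x0" using minimal_noncirc_two_each[OF M, of j False] j by blast
      obtain x1 where x1: "x1 \<in> X" "A j x1" using minimal_noncirc_two_each[OF M, of j True] j by blast
      obtain z where z: "z \<in> X" "A a z = (\<not> A a x0)" "A a' z = (\<not> A a' x1)"
        using aa(3) unfolding crosses_def by metis
      show False
      proof (cases "A j z")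
        case True then show False using a' x1 z unfolding K_def by blast
      next
        case False then show False using aa(1) x0 z unfolding K_def by blast
      qed
    qed
    then have "K False = T \<or> K True = T" using all unfolding K_def by blast
    then show ?thesis
    proof
      assume "K False = T" then show ?thesis unfolding K_def by (intro exI[of _ False]) blast
    next
      assume "K True = T" then show ?thesis unfolding K_def by (intro exI[of _ True]) blast
    qed
  qed
  obtain j where j: "j \<in> R - T" using T unfolding cl_def by blast
  obtain b where b: "\<forall>a\<in>T. \<forall>x\<in>X. \<forall>y\<in>X. A j x = b \<longrightarrow> A j y = b \<longrightarrow> A a x = A a y" using side[OF j] by blast
  obtain p p' where p: "p \<in> X" "p' \<in> X" "p \<noteq> p'" "A j p = b" "A j p' = b"
    using minimal_noncirc_two_each[OF M, of j b] j by blast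
  \<comment> \<open>This class contains the whole side \<open>b\<close> of \<open>j\<close>, hence
    two columns. A row not constant on \<open>P\<close> and not constant outside it lies outside
    \<open>T\<close>, so one of its sides is contained in a single class; but that side meets both
    \<open>P\<close> and its complement.\<close>
  define P where "P = {x\<in>X. \<forall>a\<in>T. A a x = A a p}"
  obtain a where a: "a \<in> T" "a \<in> R" using T unfolding cl_def by blast
  obtain q q' where q: "q \<in> X" "q' \<in> X" "q \<noteq> q'" "A a q = (\<not> A a p)" "A a q' = (\<not> A a p)"
    using minimal_noncirc_two_each[OF M a(2), of "\<not> A a p"] by blast
  have PX: "P \<subseteq> X" "p \<in> P" "p' \<in> P" "q \<in> X - P" "q' \<in> X - P" using p q a b unfolding P_def by blast+
  obtain i where i: "i \<in> R" "\<exists>x\<in>P. \<exists>y\<in>P. A i x \<noteq> A i y" "\<exists>x\<in>X - P. \<exists>y\<in>X - P. A i x \<noteq> A i y"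
    using minimal_noncirc_glue[OF M PX(1-3) p(3) PX(4,5) q(3)] by blast
  have "i \<notin> T" using i(2) unfolding P_def by auto
  then obtain c where c: "\<forall>a\<in>T. \<forall>x\<in>X. \<forall>y\<in>X. A i x = c \<longrightarrow> A i y = c \<longrightarrow> A a x = A a y"
    using side[of i] i(1) by blast
  obtain x where x: "x \<in> P" "A i x = c" using i(2) by (metis (full_types))
  obtain y where y: "y \<in> X - P" "A i y = c" using i(3) by (metis (full_types))
  have "A a y = A a p" if "a \<in> T" for a
  proof -
    have "A a y = A a x" using c that x y PX(1) by blast
    then show ?thesis using x(1) that unfolding P_def by blast
  qed
  then show False using y unfolding P_def by blast
qed

section \<open>Removable vertices, shortest paths and induced cycles in connected graphs\<close>

lemma exists_leaf_pair:
  assumes fin: "finite R" and R: "conn E R" and sym: "symp E" and card: "3 \<le> card R"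
  shows "\<exists>r\<in>R. \<exists>s\<in>R. r \<noteq> s \<and> conn E (R - {r, s}) \<and> (\<exists>q\<in>R - {r, s}. E q r) \<and> (\<exists>q\<in>R - {r, s}. E q s)"
proof -
  have "R \<noteq> {}" using card by auto
  then obtain a where a: "a \<in> R" by blast
  have "R \<noteq> {a}" using card by auto
  from conn_remove[OF fin R sym a this] obtain r where r: "r \<in> R" "conn E (R - {r})" by auto
  have "R \<noteq> {r}" using card by auto
  then have "\<exists>a\<in>{r}. \<exists>b\<in>R - {r}. E a b" by (intro connD[OF R]) (use r(1) in auto)
  then obtain y where y: "y \<in> R - {r}" "E r y" by auto
  have "R - {r} \<noteq> {y}"
  proof
    assume "R - {r} = {y}"
    then have "card (R - {r}) = card {y}" by (rule arg_cong)
    then show False using card card_Diff_singleton[OF r(1)] by simp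
  qed
  \<comment> \<open>Protecting the neighbour \<open>y\<close> of \<open>r\<close> guarantees that
    \<open>r\<close> still has a neighbour after \<open>s\<close> is removed.\<close>
  from conn_remove[OF finite_Diff[OF fin] r(2) sym y(1) this]
  obtain s where s: "s \<in> R - {r}" "s \<noteq> y" "conn E (R - {r} - {s})" by auto
  have "{s} \<noteq> R - {r}"
  proof
    assume e: "{s} = R - {r}"
    have "y \<in> {s}" unfolding e by (rule y(1))
    then show False using s(2) by simp
  qed
  moreover have "{s} \<subseteq> R - {r}" using s(1) by simp
  ultimately have "\<exists>a\<in>{s}. \<exists>b\<in>R - {r} - {s}. E a b" using connD[OF r(2), of "{s}"] by simp
  then obtain c where c: "c \<in> R - {r} - {s}" "E s c" by auto
  have e: "R - {r} - {s} = R - {r, s}" by blast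
  show ?thesis
  proof (intro bexI conjI)
    show "r \<noteq> s" "r \<in> R" "s \<in> R" "y \<in> R - {r, s}" "c \<in> R - {r, s}"
      using r(1) s(1,2) y(1) c(1) by auto
    show "conn E (R - {r, s})" using s(3) unfolding e .
    show "E y r" "E c s" using sympD[OF sym y(2)] sympD[OF sym c(2)] .
  qed
qed

text \<open>The vertices reached from \<open>q\<close> inside \<open>Q\<close> form a set that no
  edge leaves.\<close>

lemma exists_linking_list:
  assumes Q: "conn E Q" and q: "q \<in> Q" and t: "t \<in> Q"
  shows "\<exists>ws. ws \<noteq> [] \<and> hd ws = q \<and> last ws = t \<and> set ws \<subseteq> Q \<and> successively E ws"
proof -
  define T where "T = {t\<in>Q. \<exists>ws. ws \<noteq> [] \<and> hd ws = q \<and> last ws = t \<and> set ws \<subseteq> Q \<and> successively E ws}"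
  have "q \<in> T" using q unfolding T_def by (auto intro!: exI[of _ "[q]"])
  have "T = Q"
  proof (rule ccontr)
    assume "T \<noteq> Q"
    moreover have "T \<subseteq> Q" "T \<noteq> {}" using \<open>q \<in> T\<close> unfolding T_def by auto
    ultimately obtain a b where ab: "a \<in> T" "b \<in> Q - T" "E a b" using connD[OF Q] by blast
    then obtain ws where ws: "ws \<noteq> []" "hd ws = q" "last ws = a" "set ws \<subseteq> Q" "successively E ws"
      unfolding T_def by blast
    have "successively E (ws @ [b])" "hd (ws @ [b]) = q" "set (ws @ [b]) \<subseteq> Q" "ws @ [b] \<noteq> []" "last (ws @ [b]) = b"
      using ws ab by (simp_all add: successively_append_iff)
    then have "b \<in> T" unfolding T_def using ab(2) by blast
    then show False using ab by blast
  qed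
  then show ?thesis using t unfolding T_def by blast
qed

lemma conn_successively:
  assumes "successively E ws" "symp E"
  shows "conn E (set ws)"
  using assms(1)
proof (induction ws)
  case Nil then show ?case by (simp add: conn_def)
next
  case (Cons a ws)
  show ?case
  proof (cases ws)
    case Nil then show ?thesis by (simp add: conn_singleton)
  next
    case (Cons b vs)
    then have "conn E (set ws)" "E a b" "b \<in> set ws" using Cons.IH Cons.prems by auto
    then show ?thesis using conn_insert[OF _ assms(2), of "set ws" b a] assms(2) by (auto dest: sympD)
  qed
qed

lemma successively_nth: "successively E ws \<Longrightarrow> Suc i < length ws \<Longrightarrow> E (ws ! i) (ws ! Suc i)"
  by (simp add: successively_conv_nth)

text \<open>A shortest list linking \<open>r\<close> to \<open>s\<close> through \<open>Q\<close> is an induced path, and minimality makes it exhaust \<open>Q\<close>.\<close>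
lemma exists_induced_cycle:
  assumes fin: "finite R" and sym: "symp E" and irr: "irreflp E" and card: "5 \<le> card R"
    and rs: "r \<in> R" "s \<in> R" "r \<noteq> s" "E r s" and Q: "conn E (R - {r, s})"
    and q: "q1 \<in> R - {r, s}" "E q1 r" "q2 \<in> R - {r, s}" "E q2 s"
    and nc: "\<And>q. q \<in> R - {r, s} \<Longrightarrow> E q r \<Longrightarrow> E q s \<Longrightarrow> False"
    and min: "\<And>Q' a b q q'. Q' \<subseteq> R - {r, s} \<Longrightarrow> conn E Q' \<Longrightarrow> a \<in> Q' \<Longrightarrow> b \<in> Q' \<Longrightarrow> E a b \<Longrightarrow>
      q \<in> Q' \<Longrightarrow> E q r \<Longrightarrow> q' \<in> Q' \<Longrightarrow> E q' s \<Longrightarrow> Q' = R - {r, s}"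
  shows "\<exists>v. bij_betw v {..<card R} R \<and> (\<forall>i<card R. \<forall>j<card R.
    E (v i) (v j) \<longleftrightarrow> j = Suc i mod card R \<or> i = Suc j mod card R)"
proof -
  let ?Q = "R - {r, s}"
  have symD: "E a b \<Longrightarrow> E b a" for a b using sym by (rule sympD)
  define W where "W ws \<longleftrightarrow> ws \<noteq> [] \<and> set ws \<subseteq> ?Q \<and> E (hd ws) r \<and> E (last ws) s \<and> successively E ws" for ws
  have "\<exists>ws. W ws" using exists_linking_list[OF Q q(1,3)] q unfolding W_def by metis
  then obtain ws where ws: "W ws" and least: "\<And>us. W us \<Longrightarrow> length ws \<le> length us"
    using ex_has_least_nat[of W _ length] by blast
  define m where "m = length ws"
  have mem: "ws ! i \<in> ?Q" if "i < m" for i using ws that nth_mem unfolding W_def m_def by blast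
  have m0: "0 < m" using ws unfolding W_def m_def by simp
  have hd: "E (ws ! 0) r" and last: "E (ws ! (m - 1)) s"
    using ws unfolding W_def m_def by (auto simp: hd_conv_nth last_conv_nth)
  have suc: "E (ws ! i) (ws ! Suc i)" if "Suc i < m" for i
    using ws that successively_nth unfolding W_def m_def by blast
  have tk: "successively E (take i ws)" "successively E (drop i ws)" for i
    using ws successively_append_iff[of E "take i ws" "drop i ws"] unfolding W_def by simp_all
  \<comment> \<open>The shortest length excludes every shortcut: a later neighbour of
    \<open>r\<close>, an earlier neighbour of \<open>s\<close>, and a chord.\<close>
  have r0: "j = 0" if "j < m" "E (ws ! j) r" for j
  proof -
    have "hd (drop j ws) = ws ! j" "last (drop j ws) = last ws" "drop j ws \<noteq> []"
      using that(1) unfolding m_def by (simp_all add: hd_drop_conv_nth)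
    then have "W (drop j ws)"
      using that(2) ws tk(2)[of j] set_drop_subset[of j ws] unfolding W_def by auto
    then show ?thesis using least[of "drop j ws"] that unfolding m_def by simp
  qed
  have s0: "i = m - 1" if "i < m" "E (ws ! i) s" for i
  proof -
    have "last (take (Suc i) ws) = ws ! i" "hd (take (Suc i) ws) = hd ws" "take (Suc i) ws \<noteq> []"
      using that(1) ws unfolding m_def W_def by (simp_all add: take_Suc_conv_app_nth hd_append hd_conv_nth)
    then have "W (take (Suc i) ws)"
      using that(2) ws tk(1)[of "Suc i"] set_take_subset[of "Suc i" ws] unfolding W_def by auto
    then show ?thesis using least[of "take (Suc i) ws"] that unfolding m_def by simp
  qed
  have chord: "j = Suc i" if "i < j" "j < m" "E (ws ! i) (ws ! j)" for i j
  proof -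
    let ?us = "take (Suc i) ws @ drop j ws"
    have "last (take (Suc i) ws) = ws ! i" using that by (simp add: take_Suc_conv_app_nth m_def)
    moreover have "hd (drop j ws) = ws ! j" using that by (simp add: hd_drop_conv_nth m_def)
    ultimately have "successively E ?us" using tk that by (auto simp: successively_append_iff)
    moreover have "set ?us \<subseteq> ?Q"
      using ws set_take_subset[of "Suc i" ws] set_drop_subset[of j ws] unfolding W_def by auto
    moreover have "hd ?us = hd ws" "last ?us = last ws" "?us \<noteq> []" using that ws unfolding m_def W_def by auto
    ultimately have "W ?us" using ws unfolding W_def by simp
    then show ?thesis using least[of ?us] that unfolding m_def by simp
  qed
  have m2: "2 \<le> m"
  proof (rule ccontr)
    assume "\<not> ?thesis"
    then have "m - 1 = 0" by simp
    then show False using nc[OF mem[OF m0] hd] last by simp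
  qed
  have "distinct ws"
    unfolding distinct_conv_nth
  proof (intro allI impI)
    have ne: "ws ! i \<noteq> ws ! j" if ij: "i < j" "j < m" for i j
    proof
      assume e: "ws ! i = ws ! j"
      show False
      proof (cases "j = m - 1")
        case True then show False using s0[of i] ij e last by simp
      next
        case False
        then have "Suc j < m" using ij by linarith
        moreover from this have "E (ws ! i) (ws ! Suc j)" using suc[of j] e by simp
        ultimately show False using chord[of i "Suc j"] ij by simp
      qed
    qed
    fix i j assume "i < length ws" "j < length ws" "i \<noteq> j"
    then show "ws ! i \<noteq> ws ! j" using ne[of i j] ne[of j i] unfolding m_def by (cases "i < j") auto
  qed
  \<comment> \<open>The path is connected, contains an edge and neighbours of both \<open>r\<close>
    and \<open>s\<close>, so \<open>min\<close> identifies it with the whole rest.\<close>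
  have setws: "set ws = ?Q"
  proof (rule min[of _ "ws ! 0" "ws ! 1" "ws ! 0" "ws ! (m - 1)"])
    show "set ws \<subseteq> ?Q" using ws unfolding W_def by blast
    show "conn E (set ws)" using ws conn_successively[OF _ sym] unfolding W_def by blast
    show "ws ! 0 \<in> set ws" "ws ! 1 \<in> set ws" "ws ! (m - 1) \<in> set ws" "ws ! 0 \<in> set ws"
      using m2 unfolding m_def by (auto intro!: nth_mem)
    show "E (ws ! 0) (ws ! 1)" using suc[of 0] m2 by simp
  qed (use hd last in blast)+
  define vs where "vs = r # ws @ [s]"
  have dv: "distinct vs" using \<open>distinct ws\<close> setws rs(3) unfolding vs_def by auto
  have sv: "set vs = R" using setws rs unfolding vs_def by auto
  have n: "card R = m + 2" using distinct_card[OF dv] sv unfolding vs_def m_def by simp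
  have lv: "length vs = card R" using n unfolding vs_def m_def by simp
  have bij: "bij_betw ((!) vs) {..<card R} R" using bij_betw_nth[OF dv] lv sv by simp
  have v0: "vs ! 0 = r" and vl: "vs ! Suc m = s" and vm: "vs ! Suc i = ws ! i" if "i < m" for i
    using that unfolding vs_def m_def by (auto simp: nth_append)
  have v0: "vs ! 0 = r" unfolding vs_def by simp
  have vl: "vs ! Suc m = s" unfolding vs_def m_def by (simp add: nth_append)
  have adj: "E (vs ! i) (vs ! j) \<longleftrightarrow> j = Suc i \<or> i = 0 \<and> j = Suc m" if ij: "i < j" "j < card R" for i j
  proof -
    obtain j' where j': "j = Suc j'" "j' \<le> m" using ij n by (cases j) auto
    show ?thesis
    proof (cases i)
      case 0
      show ?thesis
      proof (cases "j' = m")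
        case True then show ?thesis using 0 j' v0 vl rs(4) by simp
      next
        case False
        then have jm: "j' < m" using j' by simp
        have "E r (ws ! j') \<longleftrightarrow> j' = 0" using r0[OF jm] hd symD by blast
        then show ?thesis using 0 j' v0 vm[OF jm] False by simp
      qed
    next
      case (Suc i')
      then have im: "i' < m" using ij n by simp
      show ?thesis
      proof (cases "j' = m")
        case True
        have "E (ws ! i') s \<longleftrightarrow> i' = m - 1" using s0[OF im] last by blast
        then show ?thesis using Suc True j' vl vm[OF im] m0 by auto
      next
        case False
        then have jm: "j' < m" using j' by simp
        have "E (ws ! i') (ws ! j') \<longleftrightarrow> j' = Suc i'" using chord[of i' j'] suc[of i'] ij Suc j' jm by auto
        then show ?thesis using Suc j' vm[OF im] vm[OF jm] False by simp
      qed
    qed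
  qed
  have sm: "Suc i mod card R = (if Suc i = card R then 0 else Suc i)" if "i < card R" for i using that by simp
  have "E (vs ! i) (vs ! j) \<longleftrightarrow> j = Suc i mod card R \<or> i = Suc j mod card R" if ij: "i < card R" "j < card R" for i j
  proof (cases i j rule: linorder_cases)
    case less
    then show ?thesis unfolding adj[OF less ij(2)] sm[OF ij(1)] sm[OF ij(2)] using ij n by auto
  next
    case equal
    then show ?thesis unfolding sm[OF ij(1)] sm[OF ij(2)] using ij n irr by (auto simp: irreflp_def)
  next
    case greater
    have "E (vs ! i) (vs ! j) \<longleftrightarrow> E (vs ! j) (vs ! i)" using symD by blast
    then show ?thesis unfolding adj[OF greater ij(1)] sm[OF ij(1)] sm[OF ij(2)] using greater ij n by auto
  qed
  then show ?thesis using bij by blast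
qed

lemma irreflp_crosses: "irreflp (crosses X A)"
proof (rule irreflpI)
  fix i show "\<not> crosses X A i i"
  proof
    assume "crosses X A i i"
    then obtain x where "A i x = True \<and> A i x = False" unfolding crosses_def by blast
    then show False by simp
  qed
qed

section \<open>Two rows of a minimal obstruction whose removal leaves a connected family\<close>

context
  fixes R :: "'r set" and X :: "'c set" and A :: "'r \<Rightarrow> 'c \<Rightarrow> bool" and r s
  assumes M: "minimal_noncirc R X A" and rs: "r \<in> R" "s \<in> R" "r \<noteq> s"
    and Q: "conn (crosses X A) (R - {r, s})" and card: "4 \<le> card R"
    and q: "\<exists>q\<in>R - {r, s}. crosses X A q r" "\<exists>q\<in>R - {r, s}. crosses X A q s"
begin

lemma fin: "finite R" "finite X" and noncirc: "\<not> circ R X A"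
  using M unfolding minimal_noncirc_def by auto

lemma insert_rest: "insert s (insert r (R - {r, s})) = R"
  using rs by blast

lemma insert_circ: "circ (insert r (R - {r, s})) X A" "circ (insert s (R - {r, s})) X A"
proof -
  have "s \<notin> insert r (R - {r, s})" "r \<notin> insert s (R - {r, s})"
    "insert r (R - {r, s}) \<subseteq> R" "insert s (R - {r, s}) \<subseteq> R" using rs by auto
  then have "insert r (R - {r, s}) \<subset> R" "insert s (R - {r, s}) \<subset> R" using rs(1,2) by blast+
  then show "circ (insert r (R - {r, s})) X A" "circ (insert s (R - {r, s})) X A"
    using M unfolding minimal_noncirc_def by simp_all
qed

lemma card_rest: "card (R - {r, s}) = card R - 2"
  using rs fin by (simp add: card_Diff_subset)

lemma rest_neighbour:
  assumes "a \<in> R - {r, s}"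
  shows "\<exists>b\<in>R - {r, s}. crosses X A a b"
proof -
  have "R - {r, s} \<noteq> {a}"
  proof
    assume "R - {r, s} = {a}"
    then have "card (R - {r, s}) = card {a}" by (rule arg_cong)
    then show False using card_rest card by simp
  qed
  then obtain b where "b \<in> R - {r, s}" "a \<noteq> b" using assms by blast
  then show ?thesis using conn_neighbour[OF Q assms] by blast
qed

text \<open>If rows were left over, minimality would make the smaller family with \<open>r\<close>
  and \<open>s\<close> circular, and \<open>circ_merge_subfamily\<close> would extend this to all
  rows.\<close>

lemma rest_minimal:
  assumes Q': "Q' \<subseteq> R - {r, s}" "conn (crosses X A) Q'" "a \<in> Q'" "b \<in> Q'" "crosses X A a b"
    and "q \<in> Q'" "crosses X A q r" "q' \<in> Q'" "crosses X A q' s"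
  shows "Q' = R - {r, s}"
proof (rule ccontr)
  assume n: "Q' \<noteq> R - {r, s}"
  then obtain t where t: "t \<in> R - {r, s}" "t \<notin> Q'" using Q'(1) by blast
  have "insert s (insert r Q') \<subset> R" using t rs Q'(1) by blast
  then have "circ (insert s (insert r Q')) X A" using M unfolding minimal_noncirc_def by simp
  then have "circ (insert s (insert r (R - {r, s}))) X A"
    by (rule circ_merge_subfamily[OF fin(2) finite_Diff[OF fin(1)] Q assms insert_circ])
  then show False using noncirc unfolding insert_rest by simp
qed

text \<open>These two columns locate the conflict. Later they compare the empty quadrants of
  neighbouring rows of the cycle.\<close>

lemma exists_differing_pair:
  "\<exists>x\<in>X. \<exists>y\<in>X. (\<forall>q\<in>R - {r, s}. A q x = A q y) \<and> A r x \<noteq> A r y \<and> A s x \<noteq> A s y"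
proof (rule ccontr)
  assume n: "\<not> ?thesis"
  obtain t where t: "t \<in> R - {r, s}" "crosses X A t r" using q(1) by blast
  obtain b where b: "b \<in> R - {r, s}" "crosses X A t b" using rest_neighbour[OF t(1)] by blast
  have "circ (insert s (insert r (R - {r, s}))) X A"
    by (rule circ_merge_no_pair[OF fin(2) finite_Diff[OF fin(1)] Q t(1) b t insert_circ n])
  then show False using noncirc unfolding insert_rest by simp
qed

text \<open>A row crossing both, with one of its neighbours, is a connected family as in
  \<open>rest_minimal\<close>, hence all of the rest; there would be only four rows.\<close>

lemma no_common_neighbour:
  assumes c: "5 \<le> card R" and t: "t \<in> R - {r, s}" "crosses X A t r" "crosses X A t s"
  shows False
proof -
  obtain b where b: "b \<in> R - {r, s}" "crosses X A t b" using rest_neighbour[OF t(1)] by blast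
  have "{t, b} = R - {r, s}"
    by (rule rest_minimal[of _ t b t t]) (use t b conn_pair[OF b(2) symp_crosses] in auto)
  then have "card (R - {r, s}) = card {t, b}" by (rule arg_cong[OF sym])
  also have "\<dots> \<le> 2" by (simp add: card_insert_if)
  finally show False using card_rest c by linarith
qed

text \<open>Without common neighbours, a neighbour of \<open>r\<close> does not cross
  \<open>s\<close> and conversely, so non-crossing \<open>r\<close> and \<open>s\<close> could be
  merged by \<open>circ_merge_not_crossing\<close>.\<close>

lemma leaf_pair_crosses:
  assumes c: "5 \<le> card R"
  shows "crosses X A r s"
proof (rule ccontr)
  assume n: "\<not> crosses X A r s"
  obtain t where t: "t \<in> R - {r, s}" "crosses X A t r" using q(1) by blast
  obtain u where u: "u \<in> R - {r, s}" "crosses X A u s" using q(2) by blast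
  obtain b where b: "b \<in> R - {r, s}" "crosses X A t b" using rest_neighbour[OF t(1)] by blast
  have "\<not> crosses X A t s" "\<not> crosses X A u r" using no_common_neighbour[OF c] t u by blast+
  then have "circ (insert s (insert r (R - {r, s}))) X A"
    by (intro circ_merge_not_crossing[OF fin(2) finite_Diff[OF fin(1)] Q t(1) b t _ u _ n insert_circ])
  then show False using noncirc unfolding insert_rest by simp
qed

lemma leaf_pair_cycle:
  assumes c: "5 \<le> card R"
  shows "\<exists>v. bij_betw v {..<card R} R \<and> (\<forall>i<card R. \<forall>j<card R.
    crosses X A (v i) (v j) \<longleftrightarrow> j = Suc i mod card R \<or> i = Suc j mod card R)"
proof -
  obtain t where t: "t \<in> R - {r, s}" "crosses X A t r" using q(1) by blast
  obtain u where u: "u \<in> R - {r, s}" "crosses X A u s" using q(2) by blast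
  show ?thesis
    by (rule exists_induced_cycle[OF fin(1) symp_crosses irreflp_crosses c rs leaf_pair_crosses[OF c] Q t u
      no_common_neighbour[OF c] rest_minimal])
qed

end

lemma minimal_noncirc_cycle:
  assumes M: "minimal_noncirc R X A" and c: "5 \<le> card R"
  shows "\<exists>v. bij_betw v {..<card R} R \<and> (\<forall>i<card R. \<forall>j<card R.
    crosses X A (v i) (v j) \<longleftrightarrow> j = Suc i mod card R \<or> i = Suc j mod card R)"
proof -
  have "finite R" using M unfolding minimal_noncirc_def by blast
  moreover have "3 \<le> card R" using c by simp
  ultimately obtain r s where rs: "r \<in> R" "s \<in> R" "r \<noteq> s" "conn (crosses X A) (R - {r, s})"
    "\<exists>q\<in>R - {r, s}. crosses X A q r" "\<exists>q\<in>R - {r, s}. crosses X A q s"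
    using exists_leaf_pair[OF _ minimal_noncirc_conn[OF M] symp_crosses] by blast
  have "4 \<le> card R" using c by simp
  then show ?thesis using leaf_pair_cycle[OF M rs(1-4) _ rs(5,6) c] by blast
qed

lemma conn_image_interval:
  assumes "\<And>j. a \<le> j \<Longrightarrow> j < b \<Longrightarrow> E (w j) (w (Suc j))" "symp E"
  shows "conn E (w ` {a..b::nat})"
proof -
  have "successively E (map w [a..<Suc b])"
    using assms(1) by (auto simp: successively_conv_nth simp del: upt_Suc)
  from conn_successively[OF this assms(2)] show ?thesis by (simp add: atLeastLessThanSuc_atLeastAtMost del: upt_Suc)
qed

text \<open>In an induced cycle of at least five rows, the differing pairs of columns force each row to have a
  side that is disjoint from a side of every non-adjacent row, the same side for all of them.\<close>
lemma minimal_noncirc_sides: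
  assumes M: "minimal_noncirc R X A" and c: "5 \<le> card R" and n: "n = card R"
    and bij: "bij_betw v {..<n} R"
    and adj: "\<And>i j. i < n \<Longrightarrow> j < n \<Longrightarrow> crosses X A (v i) (v j) \<longleftrightarrow> j = Suc i mod n \<or> i = Suc j mod n"
    and j: "j < n"
  shows "\<exists>b. \<forall>i<n. i \<noteq> j \<longrightarrow> \<not> crosses X A (v i) (v j) \<longrightarrow>
    (\<forall>\<alpha> \<beta>. \<not> (\<exists>x\<in>X. A (v i) x = \<alpha> \<and> A (v j) x = \<beta>) \<longrightarrow> \<beta> = b)"
proof -
  define w where "w k = v (k mod n)" for k
  have n5: "5 \<le> n" using c n by simp
  have modlt: "k mod n < n" for k using n5 by simp
  have adjw: "crosses X A (w k) (w (Suc k))" for k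
  proof -
    have "Suc k mod n = Suc (k mod n) mod n" by (simp add: mod_Suc_eq)
    then show ?thesis unfolding w_def adj[OF modlt modlt] by simp
  qed
  have wR: "w k \<in> R" for k using bij modlt unfolding w_def bij_betw_def by blast
  have weq: "w a = w b \<longleftrightarrow> a mod n = b mod n" for a b
    using inj_on_eq_iff[of v "{..<n}" "a mod n" "b mod n"] bij modlt unfolding w_def bij_betw_def by simp
  have modne: "(k + a) mod n \<noteq> (k + b) mod n" if "a < b" "b < a + n" for k a b
  proof
    assume "(k + a) mod n = (k + b) mod n"
    then have "n dvd (k + b) - (k + a)" using that mod_eq_dvd_iff_nat[of "k + a" "k + b" n] by simp
    then have "n dvd b - a" by simp
    then show False using that by (auto dest: dvd_imp_le)
  qed
  \<comment> \<open>Removing two adjacent rows of the cycle leaves a path, which is connected; so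
    every pair of adjacent rows can play the part of \<open>r\<close> and \<open>s\<close>.\<close>
  have rest: "R - {w i, w (Suc i)} = w ` {i + 2..i + (n - 1)}" for i
  proof
    show "w ` {i + 2..i + (n - 1)} \<subseteq> R - {w i, w (Suc i)}"
    proof
      fix y assume "y \<in> w ` {i + 2..i + (n - 1)}"
      then obtain k where k: "y = w k" "i + 2 \<le> k" "k \<le> i + (n - 1)" by auto
      have "(i + 0) mod n \<noteq> (i + (k - i)) mod n" "(i + 1) mod n \<noteq> (i + (k - i)) mod n"
        using k n5 by (intro modne; linarith)+
      then show "y \<in> R - {w i, w (Suc i)}" using k wR weq by auto
    qed
    show "R - {w i, w (Suc i)} \<subseteq> w ` {i + 2..i + (n - 1)}"
    proof
      fix y assume y: "y \<in> R - {w i, w (Suc i)}"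
      then obtain k where k: "k < n" "y = v k" using bij unfolding bij_betw_def by auto
      define d where "d = (k + n - i mod n) mod n"
      have "(i + d) mod n = (i mod n + (k + n - i mod n)) mod n"
        unfolding d_def by (simp add: mod_add_left_eq mod_add_right_eq)
      also have "i mod n + (k + n - i mod n) = k + n" using modlt[of i] by linarith
      also have "(k + n) mod n = k" using k by simp
      finally have wd: "w (i + d) = y" using k unfolding w_def by simp
      have "d \<noteq> 0" using y wd by (cases d) auto
      moreover have "d \<noteq> 1" using y wd by auto
      moreover have "d < n" unfolding d_def by (rule modlt)
      ultimately have "i + d \<in> {i + 2..i + (n - 1)}" using n5 by auto
      then show "y \<in> w ` {i + 2..i + (n - 1)}" using wd by blast
    qed
  qed
  have pair: "\<exists>x\<in>X. \<exists>y\<in>X. (\<forall>q\<in>R - {w i, w (Suc i)}. A q x = A q y) \<and>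
      A (w i) x \<noteq> A (w i) y \<and> A (w (Suc i)) x \<noteq> A (w (Suc i)) y" for i
  proof (rule exists_differing_pair[OF M])
    have "(i + 0) mod n \<noteq> (i + 1) mod n" using n5 by (intro modne; linarith)
    then show "w i \<noteq> w (Suc i)" using weq by simp
    show "conn (crosses X A) (R - {w i, w (Suc i)})"
      unfolding rest by (rule conn_image_interval) (rule adjw symp_crosses)+
    have "i + 2 \<in> {i + 2..i + (n - 1)}" "i + (n - 1) \<in> {i + 2..i + (n - 1)}" using n5 by auto
    then have m: "w (i + 2) \<in> R - {w i, w (Suc i)}" "w (i + (n - 1)) \<in> R - {w i, w (Suc i)}"
      unfolding rest by blast+
    have "Suc (i + (n - 1)) = i + n" using n5 by simp
    then have "w (Suc (i + (n - 1))) = w i" unfolding weq by simp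
    then have "crosses X A (w (i + (n - 1))) (w i)" using adjw[of "i + (n - 1)"] by simp
    then show "\<exists>q\<in>R - {w i, w (Suc i)}. crosses X A q (w i)" using m by blast
    have "crosses X A (w (i + 2)) (w (Suc i))" using crosses_sym[OF adjw[of "Suc i"]] by simp
    then show "\<exists>q\<in>R - {w i, w (Suc i)}. crosses X A q (w (Suc i))" using m by blast
  qed (use wR c in auto)
  \<comment> \<open>An empty quadrant of row \<open>i\<close> against \<open>v j\<close>;
    \<open>K d b\<close> confines those at distance \<open>d\<close> along the cycle to side
    \<open>b\<close> of \<open>v j\<close>.\<close>
  define D where "D i \<alpha> \<beta> \<longleftrightarrow> \<not> (\<exists>x\<in>X. A i x = \<alpha> \<and> A (v j) x = \<beta>)" for i \<alpha> \<beta>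
  define K where "K d b \<longleftrightarrow> (\<forall>\<alpha> \<beta>. D (w (j + d)) \<alpha> \<beta> \<longrightarrow> \<beta> = b)" for d b
  have wj: "w j = v j" using j unfolding w_def by simp
  have exD: "\<exists>\<alpha> \<beta>. D (w (j + d)) \<alpha> \<beta>" if d: "2 \<le> d" "d \<le> n - 2" for d
  proof -
    have "(j + d) mod n \<noteq> (j + 1) mod n" using modne[of 1 d j] d n5 by fastforce
    moreover have "(j + 0) mod n \<noteq> (j + Suc d) mod n" using d n5 by (intro modne; linarith)
    ultimately have "\<not> crosses X A (v ((j + d) mod n)) (v j)"
      unfolding adj[OF modlt j] using j by (simp add: mod_Suc_eq)
    then show ?thesis unfolding D_def crosses_def w_def by blast
  qed
  \<comment> \<open>The pair for the rows at distances \<open>d\<close> and \<open>d + 1\<close>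
    agrees on \<open>v j\<close>. On that side of \<open>v j\<close> both rows take both values, so
    their empty quadrants lie on the other side.\<close>
  have step: "\<exists>b. K d b \<and> K (Suc d) b" if d: "2 \<le> d" "Suc d \<le> n - 2" for d
  proof -
    obtain x y where xy: "x \<in> X" "y \<in> X" "\<forall>q\<in>R - {w (j + d), w (Suc (j + d))}. A q x = A q y"
      "A (w (j + d)) x \<noteq> A (w (j + d)) y" "A (w (Suc (j + d))) x \<noteq> A (w (Suc (j + d))) y"
      using pair by blast
    have "(j + 0) mod n \<noteq> (j + d) mod n" "(j + 0) mod n \<noteq> (j + Suc d) mod n"
      using d n5 by (intro modne; linarith)+
    then have "v j \<in> R - {w (j + d), w (Suc (j + d))}" using wR[of j] weq[of j] wj by auto
    then have e: "A (v j) x = A (v j) y" using xy(3) by blast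
    have "\<beta> = (\<not> A (v j) x)" if "D (w (j + d)) \<alpha> \<beta>" for \<alpha> \<beta>
      using that xy(1,2,4) e unfolding D_def by (cases \<alpha>; cases \<beta>; auto)
    moreover have "\<beta> = (\<not> A (v j) x)" if "D (w (Suc (j + d))) \<alpha> \<beta>" for \<alpha> \<beta>
      using that xy(1,2,5) e unfolding D_def by (cases \<alpha>; cases \<beta>; auto)
    ultimately show ?thesis unfolding K_def by auto
  qed
  have "Suc 2 \<le> n - 2" using n5 by linarith
  then obtain b where b: "K 2 b" using step[of 2] by auto
  have Kb: "K d b" if d: "2 \<le> d" "d \<le> n - 2" for d
    using d
  proof (induction d rule: nat_induct_at_least)
    case base show ?case using b .
  next
    case (Suc d)
    obtain b' where b': "K d b'" "K (Suc d) b'" using step Suc by blast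
    obtain \<alpha> \<beta> where "D (w (j + d)) \<alpha> \<beta>" using exD[of d] Suc by auto
    moreover have "K d b" using Suc by simp
    ultimately have "b' = b" using b'(1) unfolding K_def by blast
    then show ?case using b'(2) by simp
  qed
  have main: "\<beta> = b" if i: "i < n" "i \<noteq> j" "\<not> crosses X A (v i) (v j)" and D: "D (v i) \<alpha> \<beta>" for i \<alpha> \<beta>
  proof -
    define d where "d = (i + n - j) mod n"
    have "(j + d) mod n = (j + (i + n - j)) mod n" unfolding d_def by (simp add: mod_add_right_eq)
    also have "\<dots> = i" using i(1) j by simp
    finally have jd: "(j + d) mod n = i" .
    then have wi: "w (j + d) = v i" unfolding w_def by simp
    have "d < n" unfolding d_def by (rule modlt)
    moreover have "d \<noteq> 0"
    proof
      assume "d = 0"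
      then show False using jd i(2) j by simp
    qed
    moreover have "d \<noteq> 1" using i(3) crosses_sym[OF adjw[of j]] wi wj by auto
    moreover have "d \<noteq> n - 1"
    proof
      assume "d = n - 1"
      then have "Suc (j + d) = j + n" using n5 by simp
      then have "w (Suc (j + d)) = w j" unfolding weq by (metis mod_add_self2)
      then show False using i(3) adjw[of "j + d"] wi wj by simp
    qed
    ultimately have "K d b" by (intro Kb) linarith+
    then show ?thesis using D wi unfolding K_def by simp
  qed
  show ?thesis
    by (rule exI[of _ b]) (intro allI impI, rule main, simp_all add: D_def)
qed

text \<open>After complementation by \<open>\<mu>\<close>, non-adjacent rows are disjoint and
  adjacent rows meet. If every column belonged to some row, the columns would have types following
  each other round the cycle and the matrix would be circular; so some column \<open>x0\<close> lies
  in no row.\<close>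

theorem minimal_noncirc_large:
  assumes M: "minimal_noncirc R X A" and c: "5 \<le> card R"
  shows "\<exists>v cc x0 (\<mu> :: nat \<Rightarrow> bool). inj_on v {..<card R} \<and> v ` {..<card R} \<subseteq> R \<and> x0 \<in> X \<and> cc ` {..<card R} \<subseteq> X \<and>
    (\<forall>i<card R. A (v i) x0 \<noteq> \<mu> i) \<and>
    (\<forall>i<card R. \<forall>j<card R. A (v i) (cc j) = \<mu> i \<longleftrightarrow> j = i \<or> j = Suc i mod card R)"
proof -
  define n where "n = card R"
  have n5: "5 \<le> n" using c n_def by simp
  obtain v where bij: "bij_betw v {..<n} R"
    and adj: "\<And>i j. i < n \<Longrightarrow> j < n \<Longrightarrow> crosses X A (v i) (v j) \<longleftrightarrow> j = Suc i mod n \<or> i = Suc j mod n"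
    using minimal_noncirc_cycle[OF M c] unfolding n_def by blast
  have "\<forall>j\<in>{..<n}. \<exists>b. \<forall>i<n. i \<noteq> j \<longrightarrow> \<not> crosses X A (v i) (v j) \<longrightarrow>
      (\<forall>\<alpha> \<beta>. \<not> (\<exists>x\<in>X. A (v i) x = \<alpha> \<and> A (v j) x = \<beta>) \<longrightarrow> \<beta> = b)"
    using minimal_noncirc_sides[OF M c n_def bij adj] by blast
  from bchoice[OF this] obtain \<mu> where \<mu>: "\<And>i j \<alpha> \<beta>. j < n \<Longrightarrow> i < n \<Longrightarrow> i \<noteq> j \<Longrightarrow> \<not> crosses X A (v i) (v j) \<Longrightarrow>
      \<not> (\<exists>x\<in>X. A (v i) x = \<alpha> \<and> A (v j) x = \<beta>) \<Longrightarrow> \<beta> = \<mu> j"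
    by (metis lessThan_iff)
  define e where "e i x \<longleftrightarrow> A (v i) x = \<mu> i" for i x
  define nx where "nx i = (if Suc i = n then 0 else Suc i)" for i
  have nx: "Suc i mod n = nx i" if "i < n" for i using that unfolding nx_def by simp
  have nxlt: "nx i < n" if "i < n" for i using that unfolding nx_def by simp
  have nx3: "nx (nx (nx l)) \<noteq> l" if "l < n" for l using that n5 unfolding nx_def by auto
  have nx_inj: "i = l" if "i < n" "l < n" "nx i = nx l" for i l
    using that unfolding nx_def by (auto split: if_splits)
  have disj: "\<not> (e i x \<and> e j x)" if ij: "i < n" "j < n" "i \<noteq> j" "j \<noteq> nx i" "i \<noteq> nx j" and x: "x \<in> X" for i j x
  proof -
    have nc: "\<not> crosses X A (v i) (v j)" using adj[OF ij(1,2)] nx ij by simp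
    then obtain \<alpha> \<beta> where ab: "\<not> (\<exists>x\<in>X. A (v i) x = \<alpha> \<and> A (v j) x = \<beta>)" unfolding crosses_def by blast
    have "\<beta> = \<mu> j" using \<mu>[OF ij(2,1,3) nc ab] .
    moreover have "\<alpha> = \<mu> i"
    proof (rule \<mu>[OF ij(1,2)])
      show "j \<noteq> i" using ij by simp
      show "\<not> crosses X A (v j) (v i)" using nc crosses_sym by fast
      show "\<not> (\<exists>x\<in>X. A (v j) x = \<beta> \<and> A (v i) x = \<alpha>)" using ab by blast
    qed
    ultimately show ?thesis using ab x unfolding e_def by blast
  qed
  have meet: "\<exists>x\<in>X. e i x \<and> e (nx i) x" if "i < n" for i
  proof -
    have "crosses X A (v i) (v (nx i))" using adj[OF that nxlt[OF that]] nx[OF that] by simp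
    then show ?thesis unfolding crosses_def e_def by blast
  qed
  define pv where "pv j = (if j = 0 then n - 1 else j - 1)" for j
  have pvlt: "pv j < n" and nxpv: "nx (pv j) = j" if "j < n" for j
    using that n5 unfolding nx_def pv_def by auto
  have "\<forall>j\<in>{..<n}. \<exists>x. x \<in> X \<and> e (pv j) x \<and> e j x"
    using meet pvlt nxpv by (metis lessThan_iff)
  from bchoice[OF this] obtain cc where cc: "\<And>j. j < n \<Longrightarrow> cc j \<in> X \<and> e (pv j) (cc j) \<and> e j (cc j)"
    by (metis lessThan_iff)
  have ecol: "e i (cc j) \<longleftrightarrow> j = i \<or> j = nx i" if ij: "i < n" "j < n" for i j
  proof
    assume l: "j = i \<or> j = nx i"
    have "i = pv (nx i)" using ij unfolding pv_def nx_def by auto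
    then show "e i (cc j)" using l cc[OF ij(2)] by metis
  next
    assume ei: "e i (cc j)"
    show "j = i \<or> j = nx i"
    proof (rule ccontr)
      assume n: "\<not> ?thesis"
      then have "i = nx j" using disj[OF ij, of "cc j"] ei cc[OF ij(2)] by blast
      moreover have "i = pv j \<or> pv j = nx i \<or> i = nx (pv j)"
        using disj[OF ij(1) pvlt[OF ij(2)], of "cc j"] ei cc[OF ij(2)] by blast
      ultimately show False using n ij n5 unfolding nx_def pv_def by (auto split: if_splits)
    qed
  qed
  have "\<exists>x0\<in>X. \<forall>i<n. \<not> e i x0"
  proof (rule ccontr)
    assume n: "\<not> ?thesis"
    \<comment> \<open>Columns of row \<open>i\<close> alone get the odd position
      \<open>2 * i + 1\<close>, columns of two adjacent rows the even position shared by these rows.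
      Only row \<open>n - 1\<close> wraps, and its complement is the interval from 1 to
      \<open>2 * n - 3\<close>.\<close>
    define kx where "kx x k \<longleftrightarrow> (\<exists>i<n. k = 2 * int i + 1 \<and> (\<forall>l<n. e l x \<longleftrightarrow> l = i)) \<or>
      (\<exists>i<n. k = 2 * int (nx i) \<and> (\<forall>l<n. e l x \<longleftrightarrow> l = i \<or> l = nx i))" for x k
    have "\<forall>x\<in>X. \<exists>k. kx x k"
    proof
      fix x assume x: "x \<in> X"
      show "\<exists>k. kx x k"
      proof (cases "\<exists>i<n. e i x \<and> e (nx i) x")
        case True
        then obtain i where i: "i < n" "e i x" "e (nx i) x" by blast
        have "e l x \<longleftrightarrow> l = i \<or> l = nx i" if l: "l < n" for l
        proof
          assume el: "e l x"
          show "l = i \<or> l = nx i"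
          proof (rule ccontr)
            assume m: "\<not> ?thesis"
            have "i = nx l" using disj[of i l x] i l x el m by metis
            moreover have "l = nx (nx i) \<or> nx i = nx l" using disj[of "nx i" l x] nxlt[OF i(1)] i(3) l x el m by metis
            ultimately show False using m nx3[OF l] nx_inj[OF i(1) l] by metis
          qed
        qed (use i in blast)
        then have "kx x (2 * int (nx i))" unfolding kx_def using i(1) by blast
        then show ?thesis by blast
      next
        case False
        obtain i where i: "i < n" "e i x" using n x by blast
        have "e l x \<longleftrightarrow> l = i" if l: "l < n" for l
        proof
          assume el: "e l x"
          show "l = i"
          proof (rule ccontr)
            assume m: "l \<noteq> i"
            have "l \<noteq> nx i" "i \<noteq> nx l" using False el i l by auto
            then show False using disj[OF i(1) l _ _ _ x] i el m by blast
          qed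
        qed (use i in simp)
        then have "kx x (2 * int i + 1)" unfolding kx_def using i(1) by blast
        then show ?thesis by blast
      qed
    qed
    from bchoice[OF this] obtain key where key: "\<And>x. x \<in> X \<Longrightarrow> kx x (key x)" by blast
    have low: "e i x \<longleftrightarrow> 2 * int i \<le> key x \<and> key x \<le> 2 * int i + 2" if "x \<in> X" "Suc i < n" for i x
      using key[OF that(1)] unfolding kx_def
    proof (elim disjE exE conjE)
      fix k assume "k < n" "key x = 2 * int k + 1" "\<forall>l<n. e l x \<longleftrightarrow> l = k"
      then show ?thesis using that(2) by auto
    next
      fix k assume k: "k < n" "key x = 2 * int (nx k)" "\<forall>l<n. e l x \<longleftrightarrow> l = k \<or> l = nx k"
      then have "e i x \<longleftrightarrow> i = k \<or> i = nx k" using that(2) by auto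
      then show ?thesis using that(2) k(1,2) unfolding nx_def by (auto split: if_splits)
    qed
    have high: "\<not> e (n - 1) x \<longleftrightarrow> 1 \<le> key x \<and> key x \<le> 2 * int n - 3" if "x \<in> X" for x
      using key[OF that(1)] unfolding kx_def
    proof (elim disjE exE conjE)
      fix k assume "k < n" "key x = 2 * int k + 1" "\<forall>l<n. e l x \<longleftrightarrow> l = k"
      then show ?thesis using n5 by auto
    next
      fix k assume k: "k < n" "key x = 2 * int (nx k)" "\<forall>l<n. e l x \<longleftrightarrow> l = k \<or> l = nx k"
      then have "e (n - 1) x \<longleftrightarrow> n - 1 = k \<or> n - 1 = nx k" using n5 by auto
      then show ?thesis using n5 k(1,2) unfolding nx_def by (auto split: if_splits)
    qed
    have alt_e: "alt_free key X (e i)" if "i < n" for i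
    proof (cases "Suc i < n")
      case True
      then show ?thesis using low by (intro alt_free_interval) blast
    next
      case False
      then have i: "i = n - 1" using that by simp
      have "alt_free key X (\<lambda>x. \<not> e i x)" unfolding i using high by (intro alt_free_interval) blast
      then show ?thesis unfolding alt_free_Not .
    qed
    have alt_v: "alt_free key X (A (v i))" if "i < n" for i
    proof (cases "\<mu> i")
      case True
      then show ?thesis using alt_e[OF that] unfolding e_def by simp
    next
      case False
      then show ?thesis using alt_e[OF that] unfolding e_def by (simp add: alt_free_Not)
    qed
    have Rv: "\<exists>i<n. k = v i" if "k \<in> R" for k using that bij unfolding bij_betw_def by auto
    have "circ R X A"
    proof (rule circ_by_key)
      show "finite X" using M unfolding minimal_noncirc_def by blast
      show "alt_free key X (A k)" if "k \<in> R" for k using Rv[OF that] alt_v by blast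
      fix x y k assume xy: "x \<in> X" "y \<in> X" "key x = key y" "k \<in> R"
      obtain i where i: "i < n" "k = v i" using Rv[OF xy(4)] by blast
      have "e i x \<longleftrightarrow> e i y"
      proof (cases "Suc i < n")
        case True then show ?thesis using low xy by simp
      next
        case False
        then have "i = n - 1" using i(1) by simp
        then show ?thesis using high[OF xy(1)] high[OF xy(2)] xy(3) by metis
      qed
      then show "A k x = A k y" unfolding e_def i(2) by blast
    qed
    then show False using M unfolding minimal_noncirc_def by blast
  qed
  then obtain x0 where x0: "x0 \<in> X" "\<And>i. i < n \<Longrightarrow> \<not> e i x0" by blast
  have "inj_on v {..<n}" "v ` {..<n} \<subseteq> R" using bij unfolding bij_betw_def by auto
  moreover have "cc ` {..<n} \<subseteq> X" using cc by auto
  moreover have "\<forall>i<n. A (v i) x0 \<noteq> \<mu> i" using x0(2) unfolding e_def by blast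
  moreover have "\<forall>i<n. \<forall>j<n. A (v i) (cc j) = \<mu> i \<longleftrightarrow> j = i \<or> j = Suc i mod n"
    using ecol nx unfolding e_def by simp
  ultimately show ?thesis using x0(1) unfolding n_def by blast
qed

section \<open>Obstructions with at most four rows\<close>

definition embeds_fun :: "nat \<Rightarrow> nat \<Rightarrow> (nat \<Rightarrow> nat \<Rightarrow> bool) \<Rightarrow> 'r set \<Rightarrow> 'c set \<Rightarrow> ('r \<Rightarrow> 'c \<Rightarrow> bool) \<Rightarrow> bool" where
  "embeds_fun k l N R X A \<longleftrightarrow> (\<exists>\<rho> \<gamma>. inj_on \<rho> {..<k} \<and> \<rho> ` {..<k} \<subseteq> R \<and> inj_on \<gamma> {..<l} \<and> \<gamma> ` {..<l} \<subseteq> X \<and>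
     (\<forall>i<k. \<forall>j<l. N i j = A (\<rho> i) (\<gamma> j)))"

definition embeds_list :: "nat list list \<Rightarrow> 'r set \<Rightarrow> 'c set \<Rightarrow> ('r \<Rightarrow> 'c \<Rightarrow> bool) \<Rightarrow> bool" where
  "embeds_list N = embeds_fun (length N) (length (hd N)) (\<lambda>i j. N ! i ! j = 1)"

text \<open>Pairwise distinct columns of \<open>N\<close> are automatically realised by different
  columns of \<open>A\<close>. Hence only the set of occurring patterns matters, which makes a
  propositional check possible.\<close>

lemma embeds_fun_by_columns:
  assumes "inj_on v {..<k}" "v ` {..<k} \<subseteq> R"
    and "\<And>j j'. j < l \<Longrightarrow> j' < l \<Longrightarrow> j \<noteq> j' \<Longrightarrow> \<exists>i<k. N i j \<noteq> N i j'"
    and "\<And>j. j < l \<Longrightarrow> \<exists>x\<in>X. \<forall>i<k. A (v i) x = N i j"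
  shows "embeds_fun k l N R X A"
proof -
  have "\<forall>j\<in>{..<l}. \<exists>x. x \<in> X \<and> (\<forall>i<k. A (v i) x = N i j)" using assms(4) by blast
  from bchoice[OF this] obtain g where g: "\<And>j. j < l \<Longrightarrow> g j \<in> X \<and> (\<forall>i<k. A (v i) (g j) = N i j)" by auto
  have "inj_on g {..<l}"
  proof (rule inj_onI, rule ccontr)
    fix j j' assume h: "j \<in> {..<l}" "j' \<in> {..<l}" "g j = g j'" "j \<noteq> j'"
    then obtain i where "i < k" "N i j \<noteq> N i j'" using assms(3)[of j j'] by auto
    then show False using g[of j] g[of j'] h by simp
  qed
  moreover have "g ` {..<l} \<subseteq> X" using g by blast
  ultimately show ?thesis using assms(1,2) g unfolding embeds_fun_def by blast
qed

text \<open>The four entries lie in four different runs.\<close>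

lemma remdups_adj_four:
  assumes "a < b" "b < c" "c < d" "d < length xs" "xs ! a \<noteq> xs ! b" "xs ! b \<noteq> xs ! c" "xs ! c \<noteq> xs ! d"
  shows "4 \<le> length (remdups_adj xs)"
proof -
  obtain f :: "nat \<Rightarrow> nat" where f: "mono f" "f ` {0..<size xs} = {0..<size (remdups_adj xs)}"
    "\<forall>i<size xs. xs ! i = remdups_adj xs ! f i"
    using remdups_adj_altdef[of xs "remdups_adj xs"] by blast
  have ne: "f a \<noteq> f b" "f b \<noteq> f c" "f c \<noteq> f d" using f(3) assms by (metis less_trans)+
  have le: "f a \<le> f b" "f b \<le> f c" "f c \<le> f d" using f(1) assms by (auto simp: mono_def)
  have "f d < size (remdups_adj xs)" using f(2) assms(4) by (metis atLeastLessThan_iff imageI zero_le)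
  then show ?thesis using le ne by linarith
qed

text \<open>No four alternating entries means at most three runs along the line.\<close>

definition arc_list :: "nat \<Rightarrow> bool list list \<Rightarrow> bool" where
  "arc_list n L \<longleftrightarrow> list_all (\<lambda>i. length (remdups_adj (map (\<lambda>p. p ! i) L)) \<le> 3) [0..<n]"

lemma circ_by_patterns:
  assumes fin: "finite X" and L: "arc_list n L" and R: "R \<subseteq> v ` {..<n}"
    and sub: "\<And>x. x \<in> X \<Longrightarrow> map (\<lambda>i. A (v i) x) [0..<n] \<in> set L"
  shows "circ R X A"
proof -
  define key where "key x = (LEAST k. k < length L \<and> L ! k = map (\<lambda>i. A (v i) x) [0..<n])" for x
  have key: "key x < length L" "L ! key x = map (\<lambda>i. A (v i) x) [0..<n]" if "x \<in> X" for x
  proof -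
    have "\<exists>k. k < length L \<and> L ! k = map (\<lambda>i. A (v i) x) [0..<n]" using sub[OF that] by (simp add: in_set_conv_nth)
    then have "key x < length L \<and> L ! key x = map (\<lambda>i. A (v i) x) [0..<n]" unfolding key_def by (rule LeastI_ex)
    then show "key x < length L" "L ! key x = map (\<lambda>i. A (v i) x) [0..<n]" by auto
  qed
  have row: "\<exists>i<n. k = v i" if "k \<in> R" for k using R that by blast
  have val: "map (\<lambda>p. p ! i) L ! key x = A (v i) x" if "x \<in> X" "i < n" for x i
    using key[OF that(1)] that(2) by simp
  show ?thesis
  proof (rule circ_by_key[OF fin, of "\<lambda>x. int (key x)"])
    fix x y k assume h: "x \<in> X" "y \<in> X" "int (key x) = int (key y)" "k \<in> R"
    obtain i where i: "i < n" "k = v i" using row[OF h(4)] by blast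
    show "A k x = A k y" using val[OF h(1) i(1)] val[OF h(2) i(1)] h(3) i(2) by simp
  next
    fix k assume "k \<in> R"
    then obtain i where i: "i < n" "k = v i" using row by blast
    have l3: "length (remdups_adj (map (\<lambda>p. p ! i) L)) \<le> 3"
      using L i(1) unfolding arc_list_def by (simp add: list_all_iff)
    show "alt_free (\<lambda>x. int (key x)) X (A k)"
      unfolding alt_free_def
    proof (intro ballI impI, rule ccontr)
      fix x y z w assume h: "x \<in> X" "y \<in> X" "z \<in> X" "w \<in> X" "int (key x) < int (key y)" "int (key y) < int (key z)"
        "int (key z) < int (key w)" "A k x = A k z" "A k y = A k w" "A k x \<noteq> A k y"
      have "4 \<le> length (remdups_adj (map (\<lambda>p. p ! i) L))"
        by (rule remdups_adj_four[of "key x" "key y" "key z" "key w"])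
          (use h val i key in \<open>simp_all del: nth_map\<close>)
      then show False using l3 by simp
    qed
  qed
qed

section \<open>Propositional encoding for three and four rows\<close>

definition decode :: "nat \<Rightarrow> nat \<Rightarrow> bool list" where
  "decode n p = take n [odd p, odd (p div 2), odd (p div 4), odd (p div 8)]"

definition missed :: "nat \<Rightarrow> bool list list \<Rightarrow> bool list list" where
  "missed n L = filter (\<lambda>p. p \<notin> set L) (List.n_lists n [False, True])"

lemma noncirc_missed:
  assumes "\<not> circ R X A" "finite X" "R \<subseteq> v ` {..<n}" "arc_list n L"
  shows "list_ex (\<lambda>p. \<exists>x\<in>X. map (\<lambda>i. A (v i) x) [0..<n] = p) (missed n L)"
proof -
  have "\<not> (\<forall>x\<in>X. map (\<lambda>i. A (v i) x) [0..<n] \<in> set L)" using circ_by_patterns[OF assms(2,4,3)] assms(1) by blast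
  then obtain x where x: "x \<in> X" "map (\<lambda>i. A (v i) x) [0..<n] \<notin> set L" by blast
  moreover have "map (\<lambda>i. A (v i) x) [0..<n] \<in> set (List.n_lists n [False, True])"
    by (auto simp: set_n_lists)
  ultimately show ?thesis unfolding list_ex_iff missed_def by auto
qed

lemma circ_complement: "circ R X (\<lambda>i x. \<not> A i x) \<longleftrightarrow> circ R X A"
  unfolding circ_def alt_free_Not ..

text \<open>The number \<open>p\<close> stands for the column whose entry in row \<open>i\<close> is bit \<open>i\<close> of \<open>p\<close>. The lists are the maximal
  sets of columns on four rows that can be arranged on a circle, up to permuting the rows and
  complementing the matrix.\<close>
definition circles_four :: "bool list list list" where
  "circles_four = map (map (decode 4)) [[0,4,6,2,3,1,9,8], [0,2,6,7,3,1,9,8], [0,4,6,7,3,1,9,8], [1,5,4,6,2,10,8,9],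
    [1,5,7,6,2,10,8,9], [0,1,9,11,3,7,6,2], [0,1,9,11,3,7,6,4], [0,4,6,7,3,11,9,8],
    [1,5,7,6,2,10,11,9], [3,7,6,4,12,8,9,11], [0,1,5,7,15,11,3,2], [0,1,3,11,15,7,5,4],
    [0,2,3,11,15,7,5,4], [0,1,9,11,15,7,6,2], [0,1,9,11,15,7,6,4], [0,4,5,7,15,11,9,8],
    [0,4,6,7,15,11,9,8]]"

definition circles_three :: "bool list list list" where
  "circles_three = map (map (decode 3)) [[2,3,7,5,4,6], [1,3,7,6,4,5], [1,3,2,6,7,5],
    [1,3,2,6,4,5], [0,2,6,7,5,4], [0,1,5,7,6,4], [0,1,5,7,6,2], [0,1,5,4,6,2], [0,2,3,7,6,4], [0,1,3,7,6,4], [0,1,3,7,6,2],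
    [0,1,3,2,6,4],[0,2,3,7,5,4],[0,1,3,7,5,4],[0,1,5,7,3,2],[0,2,3,1,5,4]]"

lemma circles_arc: "list_all (arc_list 4) circles_four" "list_all (arc_list 3) circles_three"
  by code_simp+

text \<open>\<open>B\<close> records which of the 16 patterns occur. A non-circular matrix has a
  pattern outside every circle.\<close>

definition misses_four :: "(bool \<Rightarrow> bool \<Rightarrow> bool \<Rightarrow> bool \<Rightarrow> bool) \<Rightarrow> bool" where
  "misses_four B \<longleftrightarrow> list_all (\<lambda>L. list_ex (\<lambda>p. B (p ! 0) (p ! 1) (p ! 2) (p ! 3)) (missed 4 L)) circles_four"

definition misses_three :: "(bool \<Rightarrow> bool \<Rightarrow> bool \<Rightarrow> bool) \<Rightarrow> bool" where
  "misses_three B \<longleftrightarrow> list_all (\<lambda>L. list_ex (\<lambda>p. B (p ! 0) (p ! 1) (p ! 2)) (missed 3 L)) circles_three"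

text \<open>The first two matrices are the transposes of \<open>M_I(3)\<^sup>*\<close> and of its complement.\<close>
definition small_four :: "nat list list list" where
  "small_four = [
    [[1,0,1],[1,1,0],[0,1,1],[0,0,0]], [[0,1,0],[0,0,1],[1,0,0],[1,1,1]],
    [[1,1,0,0,0],[0,1,1,0,0],[0,0,1,1,0],[1,0,0,1,0]],
    [[0,0,1,1,1],[1,0,0,1,1],[1,1,0,0,1],[0,1,1,0,1]],
    [[1,1,0,0,0],[0,1,1,0,0],[0,0,1,1,0],[0,1,1,0,1]],
    [[1,1,0,0,0],[0,1,1,0,0],[1,1,0,0,1],[0,1,1,0,1]],
    [[1,1,0,0,0],[1,0,0,1,1],[1,1,0,0,1],[0,1,1,0,1]],
    [[1,1,0,0,0,0],[1,1,1,1,0,0],[0,0,1,1,0,0],[1,0,0,1,1,0]],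
    [[0,0,1,1,1,1],[0,0,0,0,1,1],[1,1,0,0,1,1],[0,1,1,0,0,1]]]"

definition small_three :: "nat list list list" where
  "small_three = [[[1,1,0,0],[0,1,1,0],[1,0,1,0]], [[0,0,1,1],[1,0,0,1],[0,1,0,1]]]"

definition avoids_four :: "(bool \<Rightarrow> bool \<Rightarrow> bool \<Rightarrow> bool \<Rightarrow> bool) \<Rightarrow> bool" where
  "avoids_four B \<longleftrightarrow> list_all (\<lambda>N. \<not> list_all (\<lambda>j. B (N ! 0 ! j = 1) (N ! 1 ! j = 1) (N ! 2 ! j = 1) (N ! 3 ! j = 1))
     [0..<length (hd N)]) small_four"

definition avoids_three :: "(bool \<Rightarrow> bool \<Rightarrow> bool \<Rightarrow> bool) \<Rightarrow> bool" where
  "avoids_three B \<longleftrightarrow> list_all (\<lambda>N. \<not> list_all (\<lambda>j. B (N ! 0 ! j = 1) (N ! 1 ! j = 1) (N ! 2 ! j = 1))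
     [0..<length (hd N)]) small_three"

lemma n_lists_numeral: "List.n_lists (numeral k) xs =
    concat (map (\<lambda>ys. map (\<lambda>y. y # ys) xs) (List.n_lists (pred_numeral k) xs))"
  by (simp add: numeral_eq_Suc)

context
  notes [simp] = missed_def decode_def n_lists_numeral
begin

lemmas misses_four_eq = misses_four_def[unfolded circles_four_def, simplified]
lemmas misses_three_eq = misses_three_def[unfolded circles_three_def, simplified]

end

lemmas avoids_four_eq = avoids_four_def[unfolded small_four_def, simplified]
lemmas avoids_three_eq = avoids_three_def[unfolded small_three_def, simplified]

text \<open>With the eight values of \<open>B\<close> as variables: patterns that fit on no circle
  include all four even or all four odd ones.\<close>

lemma three_rows: "misses_three B \<Longrightarrow> avoids_three B \<Longrightarrow> False"
  unfolding misses_three_eq avoids_three_eq by sat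

text \<open>The 24 orders of the rows; they supply the circles and matrices that are listed only up
  to permuting rows.\<close>

definition all_orders :: "((bool \<Rightarrow> bool \<Rightarrow> bool \<Rightarrow> bool \<Rightarrow> bool) \<Rightarrow> bool) \<Rightarrow> (bool \<Rightarrow> bool \<Rightarrow> bool \<Rightarrow> bool \<Rightarrow> bool) \<Rightarrow> bool" where
  "all_orders P B \<longleftrightarrow>
     P (\<lambda>a b c d. B a b c d) \<and> P (\<lambda>a b c d. B a b d c) \<and> P (\<lambda>a b c d. B a c b d) \<and>
     P (\<lambda>a b c d. B a c d b) \<and> P (\<lambda>a b c d. B a d b c) \<and> P (\<lambda>a b c d. B a d c b) \<and>
     P (\<lambda>a b c d. B b a c d) \<and> P (\<lambda>a b c d. B b a d c) \<and> P (\<lambda>a b c d. B b c a d) \<and>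
     P (\<lambda>a b c d. B b c d a) \<and> P (\<lambda>a b c d. B b d a c) \<and> P (\<lambda>a b c d. B b d c a) \<and>
     P (\<lambda>a b c d. B c a b d) \<and> P (\<lambda>a b c d. B c a d b) \<and> P (\<lambda>a b c d. B c b a d) \<and>
     P (\<lambda>a b c d. B c b d a) \<and> P (\<lambda>a b c d. B c d a b) \<and> P (\<lambda>a b c d. B c d b a) \<and>
     P (\<lambda>a b c d. B d a b c) \<and> P (\<lambda>a b c d. B d a c b) \<and> P (\<lambda>a b c d. B d b a c) \<and>
     P (\<lambda>a b c d. B d b c a) \<and> P (\<lambda>a b c d. B d c a b) \<and> P (\<lambda>a b c d. B d c b a)"

lemma all_ordersI:
  assumes h: "\<And>p q s t. {p, q, s, t} = {r0, r1, r2, r3} \<Longrightarrow>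
    P (\<lambda>a b c d. \<exists>x\<in>X. A p x = a \<and> A q x = b \<and> A s x = c \<and> A t x = d)"
  shows "all_orders P (\<lambda>a b c d. \<exists>x\<in>X. A r0 x = a \<and> A r1 x = b \<and> A r2 x = c \<and> A r3 x = d)"
  unfolding all_orders_def
  using h[of r0 r1 r2 r3] h[of r0 r1 r3 r2] h[of r0 r2 r1 r3] h[of r0 r2 r3 r1] h[of r0 r3 r1 r2] h[of r0 r3 r2 r1]
    h[of r1 r0 r2 r3] h[of r1 r0 r3 r2] h[of r1 r2 r0 r3] h[of r1 r2 r3 r0] h[of r1 r3 r0 r2] h[of r1 r3 r2 r0]
    h[of r2 r0 r1 r3] h[of r2 r0 r3 r1] h[of r2 r1 r0 r3] h[of r2 r1 r3 r0] h[of r2 r3 r0 r1] h[of r2 r3 r1 r0]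
    h[of r3 r0 r1 r2] h[of r3 r0 r2 r1] h[of r3 r1 r0 r2] h[of r3 r1 r2 r0] h[of r3 r2 r0 r1] h[of r3 r2 r1 r0]
  by (simp only: insert_commute conj_ac simp_thms)

text \<open>There are 16 variables. The first two hypotheses restore the circles omitted by symmetry
  under permutations and complementation; the last four exclude the obstructions on each triple of
  rows.\<close>

lemma four_rows:
  assumes "all_orders misses_four B"
    "all_orders (\<lambda>B. misses_four (\<lambda>a b c d. B (\<not> a) (\<not> b) (\<not> c) (\<not> d))) B"
    "all_orders avoids_four B"
    "avoids_three (\<lambda>a b c. \<exists>d. B a b c d)" "avoids_three (\<lambda>a b c. \<exists>d. B a b d c)"
    "avoids_three (\<lambda>a b c. \<exists>d. B a d b c)" "avoids_three (\<lambda>a b c. \<exists>d. B d a b c)"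
  shows False
  using assms unfolding all_orders_def misses_four_eq avoids_four_eq avoids_three_eq ex_bool_eq
    not_True_eq_False not_False_eq_True
  by sat

lemma misses_four_rows:
  assumes "\<not> circ R X A" "finite X" "R \<subseteq> {p, q, s, t}"
    and B: "\<And>a b c d. B a b c d \<longleftrightarrow> (\<exists>x\<in>X. A p x = a \<and> A q x = b \<and> A s x = c \<and> A t x = d)"
  shows "misses_four B"
  unfolding misses_four_def list_all_iff
proof
  fix L assume L: "L \<in> set circles_four"
  define v where "v i = [p, q, s, t] ! i" for i
  have "{p, q, s, t} = v ` {..<4}" unfolding v_def by (auto simp: numeral_eq_Suc lessThan_Suc)
  moreover have "arc_list 4 L" using circles_arc(1) L by (simp add: list_all_iff)
  ultimately obtain m where m: "m \<in> set (missed 4 L)" "\<exists>x\<in>X. map (\<lambda>i. A (v i) x) [0..<4] = m"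
    using noncirc_missed[of R X A v 4 L] assms(1-3) unfolding list_ex_iff by auto
  then have "B (m ! 0) (m ! 1) (m ! 2) (m ! 3)" unfolding B v_def by (auto simp: upt_rec)
  then show "list_ex (\<lambda>p. B (p ! 0) (p ! 1) (p ! 2) (p ! 3)) (missed 4 L)" using m(1) unfolding list_ex_iff by blast
qed

lemma misses_three_rows:
  assumes "\<not> circ R X A" "finite X" "R \<subseteq> {p, q, s}"
  shows "misses_three (\<lambda>a b c. \<exists>x\<in>X. A p x = a \<and> A q x = b \<and> A s x = c)"
  unfolding misses_three_def list_all_iff
proof
  fix L assume L: "L \<in> set circles_three"
  define v where "v i = [p, q, s] ! i" for i
  have "{p, q, s} = v ` {..<3}" unfolding v_def by (auto simp: numeral_eq_Suc lessThan_Suc)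
  moreover have "arc_list 3 L" using circles_arc(2) L by (simp add: list_all_iff)
  ultimately obtain m where m: "m \<in> set (missed 3 L)" "\<exists>x\<in>X. map (\<lambda>i. A (v i) x) [0..<3] = m"
    using noncirc_missed[of R X A v 3 L] assms(1-3) unfolding list_ex_iff by auto
  then have "\<exists>x\<in>X. A p x = m ! 0 \<and> A q x = m ! 1 \<and> A s x = m ! 2" unfolding v_def by (auto simp: upt_rec)
  then show "list_ex (\<lambda>m. \<exists>x\<in>X. A p x = m ! 0 \<and> A q x = m ! 1 \<and> A s x = m ! 2) (missed 3 L)"
    using m(1) unfolding list_ex_iff by blast
qed

lemma all_less_3: "(\<forall>i<3. P i) \<longleftrightarrow> P 0 \<and> P 1 \<and> P (2::nat)"
  and all_less_4: "(\<forall>i<4. P i) \<longleftrightarrow> P 0 \<and> P 1 \<and> P 2 \<and> P (3::nat)"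
  by (simp_all add: numeral_eq_Suc All_less_Suc2)

lemma small_columns_distinct:
  "list_all (\<lambda>N. length N = 4 \<and> list_all (\<lambda>j. list_all (\<lambda>j'. j \<noteq> j' \<longrightarrow>
    list_ex (\<lambda>i. (N ! i ! j = 1) \<noteq> (N ! i ! j' = 1)) [0..<4])
     [0..<length (hd N)]) [0..<length (hd N)]) small_four"
  "list_all (\<lambda>N. length N = 3 \<and> list_all (\<lambda>j. list_all (\<lambda>j'. j \<noteq> j' \<longrightarrow>
    list_ex (\<lambda>i. (N ! i ! j = 1) \<noteq> (N ! i ! j' = 1)) [0..<3])
     [0..<length (hd N)]) [0..<length (hd N)]) small_three"
  by code_simp+

lemma avoids_four_rows:
  assumes no: "\<And>N. N \<in> set small_four \<Longrightarrow> \<not> embeds_list N R X A" and rows: "distinct [p, q, s, t]" "{p, q, s, t} \<subseteq> R"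
    and B: "\<And>a b c d. B a b c d \<longleftrightarrow> (\<exists>x\<in>X. A p x = a \<and> A q x = b \<and> A s x = c \<and> A t x = d)"
  shows "avoids_four B"
  unfolding avoids_four_def list_all_iff
proof (intro ballI notI)
  fix N assume N: "N \<in> set small_four"
    and cc: "\<forall>j\<in>set [0..<length (hd N)]. B (N ! 0 ! j = 1) (N ! 1 ! j = 1) (N ! 2 ! j = 1) (N ! 3 ! j = 1)"
  define v where "v i = [p, q, s, t] ! i" for i
  have len: "length N = 4" using small_columns_distinct(1) N by (simp add: list_all_iff)
  have four: "{..<4::nat} = {0, 1, 2, 3}" by auto
  have "embeds_fun 4 (length (hd N)) (\<lambda>i j. N ! i ! j = 1) R X A"
  proof (rule embeds_fun_by_columns)
    show "inj_on v {..<4}" "v ` {..<4} \<subseteq> R" unfolding four v_def using rows by auto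
    show "\<exists>i<4. (N ! i ! j = 1) \<noteq> (N ! i ! j' = 1)" if "j < length (hd N)" "j' < length (hd N)" "j \<noteq> j'" for j j'
    proof -
      have "list_ex (\<lambda>i. (N ! i ! j = 1) \<noteq> (N ! i ! j' = 1)) [0..<4]"
        using small_columns_distinct(1) N that unfolding list_all_iff by simp
      then show ?thesis unfolding list_ex_iff by auto
    qed
    show "\<exists>x\<in>X. \<forall>i<4. A (v i) x = (N ! i ! j = 1)" if jl: "j < length (hd N)" for j
    proof -
      obtain x where "x \<in> X" "A p x = (N ! 0 ! j = 1)" "A q x = (N ! 1 ! j = 1)" "A s x = (N ! 2 ! j = 1)"
        "A t x = (N ! 3 ! j = 1)"
        using bspec[OF cc, of j] jl unfolding B set_upt atLeastLessThan_iff by blast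
      then show ?thesis unfolding v_def all_less_4 by (intro bexI[of _ x]) simp_all
    qed
  qed
  then show False using no[OF N] unfolding embeds_list_def len by blast
qed

lemma avoids_three_rows:
  assumes no: "\<And>N. N \<in> set small_three \<Longrightarrow> \<not> embeds_list N R X A" and rows: "distinct [p, q, s]" "{p, q, s} \<subseteq> R"
    and B: "\<And>a b c. B a b c \<longleftrightarrow> (\<exists>x\<in>X. A p x = a \<and> A q x = b \<and> A s x = c)"
  shows "avoids_three B"
  unfolding avoids_three_def list_all_iff
proof (intro ballI notI)
  fix N assume N: "N \<in> set small_three"
    and cc: "\<forall>j\<in>set [0..<length (hd N)]. B (N ! 0 ! j = 1) (N ! 1 ! j = 1) (N ! 2 ! j = 1)"
  define v where "v i = [p, q, s] ! i" for i
  have len: "length N = 3" using small_columns_distinct(2) N by (simp add: list_all_iff)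
  have three: "{..<3::nat} = {0, 1, 2}" by auto
  have "embeds_fun 3 (length (hd N)) (\<lambda>i j. N ! i ! j = 1) R X A"
  proof (rule embeds_fun_by_columns)
    show "inj_on v {..<3}" "v ` {..<3} \<subseteq> R" unfolding three v_def using rows by auto
    show "\<exists>i<3. (N ! i ! j = 1) \<noteq> (N ! i ! j' = 1)" if "j < length (hd N)" "j' < length (hd N)" "j \<noteq> j'" for j j'
    proof -
      have "list_ex (\<lambda>i. (N ! i ! j = 1) \<noteq> (N ! i ! j' = 1)) [0..<3]"
        using small_columns_distinct(2) N that unfolding list_all_iff by simp
      then show ?thesis unfolding list_ex_iff by auto
    qed
    show "\<exists>x\<in>X. \<forall>i<3. A (v i) x = (N ! i ! j = 1)" if jl: "j < length (hd N)" for j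
    proof -
      obtain x where "x \<in> X" "A p x = (N ! 0 ! j = 1)" "A q x = (N ! 1 ! j = 1)" "A s x = (N ! 2 ! j = 1)"
        using bspec[OF cc, of j] jl unfolding B set_upt atLeastLessThan_iff by blast
      then show ?thesis unfolding v_def all_less_3 by (intro bexI[of _ x]) simp_all
    qed
  qed
  then show False using no[OF N] unfolding embeds_list_def len by blast
qed

lemma noncirc_four_rows:
  assumes nc: "\<not> circ {r0, r1, r2, r3} X A" and fin: "finite X" and d: "distinct [r0, r1, r2, r3]"
  shows "\<exists>N\<in>set small_four \<union> set small_three. embeds_list N {r0, r1, r2, r3} X A"
proof (rule ccontr)
  let ?R = "{r0, r1, r2, r3}"
  assume "\<not> ?thesis"
  then have no4: "\<And>N. N \<in> set small_four \<Longrightarrow> \<not> embeds_list N ?R X A"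
    and no3: "\<And>N. N \<in> set small_three \<Longrightarrow> \<not> embeds_list N ?R X A" by blast+
  have nc': "\<not> circ ?R X (\<lambda>i x. \<not> A i x)" using nc unfolding circ_complement .
  have a3: "avoids_three B" if "distinct [p, q, s]" "{p, q, s} \<subseteq> ?R"
    "\<And>a b c. B a b c \<longleftrightarrow> (\<exists>x\<in>X. A p x = a \<and> A q x = b \<and> A s x = c)" for p q s B
    by (rule avoids_three_rows[OF _ that]) (rule no3)
  let ?B = "\<lambda>a b c d. \<exists>x\<in>X. A r0 x = a \<and> A r1 x = b \<and> A r2 x = c \<and> A r3 x = d"
  show False
  proof (rule four_rows[of ?B])
    show "all_orders misses_four ?B"
      by (rule all_ordersI) (rule misses_four_rows[OF nc fin _ refl], simp)
    show "all_orders (\<lambda>B. misses_four (\<lambda>a b c d. B (\<not> a) (\<not> b) (\<not> c) (\<not> d))) ?B"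
    proof (rule all_ordersI)
      fix p q s t assume "{p, q, s, t} = {r0, r1, r2, r3}"
      then show "misses_four (\<lambda>a b c d. \<exists>x\<in>X. A p x = (\<not> a) \<and> A q x = (\<not> b) \<and> A s x = (\<not> c) \<and> A t x = (\<not> d))"
        by (intro misses_four_rows[OF nc' fin, of p q s t]) auto
    qed
    show "all_orders avoids_four ?B"
    proof (rule all_ordersI)
      fix p q s t assume e: "{p, q, s, t} = {r0, r1, r2, r3}"
      show "avoids_four (\<lambda>a b c d. \<exists>x\<in>X. A p x = a \<and> A q x = b \<and> A s x = c \<and> A t x = d)"
      proof (rule avoids_four_rows[OF no4 _ _ refl])
        have "set [p, q, s, t] = set [r0, r1, r2, r3]" using e by simp
        then show "distinct [p, q, s, t]"
          by (intro card_distinct) (simp only: distinct_card[OF d] length_Cons list.size)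
        show "{p, q, s, t} \<subseteq> ?R" using e by simp
      qed
    qed
    show "avoids_three (\<lambda>a b c. \<exists>d. ?B a b c d)" by (rule a3[of r0 r1 r2]) (use d in simp, simp, metis)
    show "avoids_three (\<lambda>a b c. \<exists>d. ?B a b d c)" by (rule a3[of r0 r1 r3]) (use d in simp, simp, metis)
    show "avoids_three (\<lambda>a b c. \<exists>d. ?B a d b c)" by (rule a3[of r0 r2 r3]) (use d in simp, simp, metis)
    show "avoids_three (\<lambda>a b c. \<exists>d. ?B d a b c)" by (rule a3[of r1 r2 r3]) (use d in simp, simp, metis)
  qed
qed

lemma noncirc_three_rows:
  assumes nc: "\<not> circ {r0, r1, r2} X A" and fin: "finite X" and d: "distinct [r0, r1, r2]"
  shows "\<exists>N\<in>set small_three. embeds_list N {r0, r1, r2} X A"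
proof (rule ccontr)
  assume "\<not> ?thesis"
  then have no: "\<And>N. N \<in> set small_three \<Longrightarrow> \<not> embeds_list N {r0, r1, r2} X A" by blast
  show False
    by (rule three_rows[OF misses_three_rows[OF nc fin subset_refl] avoids_three_rows[OF _ d subset_refl]]) (rule no,
      assumption, rule refl)
qed

text \<open>In Gray-code order all four patterns of two rows fit on one circle.\<close>

lemma circ_two_rows:
  assumes "finite X" "R \<subseteq> {p, q}"
  shows "circ R X A"
proof (rule circ_by_patterns[OF assms(1)])
  show "arc_list 2 [[False, False], [True, False], [True, True], [False, True]]" by code_simp
  show "R \<subseteq> (\<lambda>i. [p, q] ! i) ` {..<2}" using assms(2) by (auto simp: numeral_eq_Suc lessThan_Suc)
  show "map (\<lambda>i. A ([p, q] ! i) x) [0..<2] \<in> set [[False, False], [True, False], [True, True], [False, True]]" for x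
    by (auto simp: upt_rec)
qed

lemma embeds_fun_mono: "embeds_fun k l N R' X' A \<Longrightarrow> R' \<subseteq> R \<Longrightarrow> X' \<subseteq> X \<Longrightarrow> embeds_fun k l N R X A"
  unfolding embeds_fun_def by (meson order_trans)

text \<open>Both the all-even and the all-odd configuration on three rows occur in \<open>small_three\<close>; all other obstructions
  have at least four rows.\<close>
theorem noncirc_cases:
  assumes fin: "finite R" "finite X" and nc: "\<not> circ R X A"
  obtains (small) N where "N \<in> set small_four \<union> set small_three" "embeds_list N R X A"
    | (large) n v cc x0 \<mu> where "5 \<le> n" "inj_on v {..<n}" "v ` {..<n} \<subseteq> R" "x0 \<in> X" "cc ` {..<n} \<subseteq> X"
      "\<And>i. i < n \<Longrightarrow> A (v i) x0 \<noteq> \<mu> i"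
      "\<And>i j. i < n \<Longrightarrow> j < n \<Longrightarrow> A (v i) (cc j) = \<mu> i \<longleftrightarrow> j = i \<or> j = Suc i mod n"
proof -
  obtain R' X' where sub: "R' \<subseteq> R" "X' \<subseteq> X" and M: "minimal_noncirc R' X' A"
    using exists_minimal_noncirc[OF fin nc] by blast
  have fin': "finite R'" "finite X'" and nc': "\<not> circ R' X' A" using M unfolding minimal_noncirc_def by auto
  note mono = embeds_fun_mono[OF _ sub]
  consider "card R' \<le> 2" | "card R' = 3" | "card R' = 4" | "5 \<le> card R'" by linarith
  then show thesis
  proof cases
    case 1
    then consider "card R' = 0" | "card R' = 1" | "card R' = 2" by linarith
    then have "\<exists>p q. R' \<subseteq> {p, q}"
    proof cases
      case 1 then show ?thesis using fin' by simp
    next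
      case 2
      then obtain p where "R' = {p}" by (rule card_1_singletonE)
      then show ?thesis by blast
    next
      case 3 then show ?thesis unfolding card_2_iff by blast
    qed
    then obtain p q where "R' \<subseteq> {p, q}" by blast
    from circ_two_rows[OF fin'(2) this] show thesis using nc' by contradiction
  next
    case 2
    then obtain r0 r1 r2 where r: "R' = {r0, r1, r2}" "distinct [r0, r1, r2]" unfolding card_3_iff by auto
    then obtain N where "N \<in> set small_three" "embeds_list N R' X' A"
      using noncirc_three_rows[of r0 r1 r2 X' A] nc' fin' by auto
    then show thesis using small mono unfolding embeds_list_def by blast
  next
    case 3
    then obtain b B where b: "R' = insert b B" "b \<notin> B" "card B = 3" using card_Suc_eq[of R' 3] by auto
    then obtain r0 r1 r2 where "B = {r0, r1, r2}" "distinct [r0, r1, r2]" unfolding card_3_iff by auto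
    then have r: "R' = {b, r0, r1, r2}" "distinct [b, r0, r1, r2]" using b by auto
    then obtain N where "N \<in> set small_four \<union> set small_three" "embeds_list N R' X' A"
      using noncirc_four_rows[of b r0 r1 r2 X' A] nc' fin' by auto
    then show thesis using small mono unfolding embeds_list_def by blast
  next
    case 4
    from minimal_noncirc_large[OF M 4] obtain v cc x0 \<mu> where h: "inj_on v {..<card R'}" "v ` {..<card R'} \<subseteq> R'"
      "x0 \<in> X'" "cc ` {..<card R'} \<subseteq> X'" "\<forall>i<card R'. A (v i) x0 \<noteq> \<mu> i"
      "\<forall>i<card R'. \<forall>j<card R'. A (v i) (cc j) = \<mu> i \<longleftrightarrow> j = i \<or> j = Suc i mod card R'" by metis
    show thesis
      by (rule large[OF 4 h(1) order_trans[OF h(2) sub(1)] subsetD[OF sub(2) h(3)] order_trans[OF h(4) sub(2)]])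
        (use h(5,6) in blast)+
  qed
qed

section \<open>Cyclic configurations\<close>

text \<open>Column \<open>cc j\<close> differs from \<open>x0\<close> exactly in the cyclically adjacent rows \<open>j - 1\<close> and \<open>j\<close>.\<close>
definition cyc_config ::
  "nat \<Rightarrow> (nat \<Rightarrow> 'r) \<Rightarrow> (nat \<Rightarrow> 'c) \<Rightarrow> 'c \<Rightarrow> (nat \<Rightarrow> bool) \<Rightarrow>
    'r set \<Rightarrow> 'c set \<Rightarrow> ('r \<Rightarrow> 'c \<Rightarrow> bool) \<Rightarrow> bool" where
  "cyc_config n v cc x0 a R X A \<longleftrightarrow> inj_on v {..<n} \<and> v ` {..<n} \<subseteq> R \<and> x0 \<in> X \<and> cc ` {..<n} \<subseteq> X \<and>
     (\<forall>i<n. A (v i) x0 = a i) \<and> (\<forall>i<n. \<forall>j<n. A (v i) (cc j) = (a i \<noteq> (j = i \<or> j = Suc i mod n)))"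

text \<open>Column \<open>n\<close> stands for the base column \<open>x0\<close>, the columns below
  \<open>n\<close> for those of the cycle.\<close>

definition cyc_entry :: "nat \<Rightarrow> (nat \<Rightarrow> bool) \<Rightarrow> nat \<Rightarrow> nat \<Rightarrow> bool" where
  "cyc_entry n a i j \<longleftrightarrow> a i \<noteq> (j < n \<and> (j = i \<or> j = Suc i mod n))"

lemma cyc_entry_columns:
  assumes n: "3 \<le> n" and j: "j \<le> n" "j' \<le> n" "j < j'"
  shows "\<exists>i<n. cyc_entry n a i j \<noteq> cyc_entry n a i j'"
proof (cases "j' = n")
  case True
  then show ?thesis using j by (intro exI[of _ j]) (auto simp: cyc_entry_def)
next
  case False
  then have lt: "j < n" "j' < n" using j by auto
  show ?thesis
  proof (cases "j' = Suc j mod n")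
    case False
    then show ?thesis using lt j by (intro exI[of _ j]) (auto simp: cyc_entry_def)
  next
    case True
    \<comment> \<open>From three rows on, two columns cannot be cyclic successors of each other, so
      row \<open>j'\<close> separates them.\<close>
    have "j \<noteq> Suc j' mod n" using True lt n j by (cases "Suc j' = n") auto
    then show ?thesis using lt j by (intro exI[of _ j']) (auto simp: cyc_entry_def)
  qed
qed

lemma cyc_config_embeds:
  assumes n: "3 \<le> n" and c: "cyc_config n v cc x0 a R X A"
  shows "embeds_fun n (Suc n) (cyc_entry n a) R X A"
proof (rule embeds_fun_by_columns)
  show "inj_on v {..<n}" "v ` {..<n} \<subseteq> R" using c unfolding cyc_config_def by auto
  show "\<exists>i<n. cyc_entry n a i j \<noteq> cyc_entry n a i j'" if "j < Suc n" "j' < Suc n" "j \<noteq> j'" for j j'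
    using cyc_entry_columns[OF n, of j j' a] cyc_entry_columns[OF n, of j' j a] that
    by (cases "j < j'") auto
  show "\<exists>x\<in>X. \<forall>i<n. A (v i) x = cyc_entry n a i j" if "j < Suc n" for j
  proof (cases "j = n")
    case True
    then show ?thesis using c unfolding cyc_config_def cyc_entry_def by (intro bexI[of _ x0]) auto
  next
    case False
    then show ?thesis using that c unfolding cyc_config_def cyc_entry_def by (intro bexI[of _ "cc j"]) auto
  qed
qed

lemma cyc_config_rotate:
  assumes n: "0 < n" and c: "cyc_config n v cc x0 a R X A"
  shows "cyc_config n (\<lambda>i. v ((i + s) mod n)) (\<lambda>j. cc ((j + s) mod n)) x0 (\<lambda>i. a ((i + s) mod n)) R X A"
proof -
  have lt: "k mod n < n" for k using n by simp
  have inj: "(i + s) mod n = (j + s) mod n \<longleftrightarrow> i = j" if "i < n" "j < n" for i j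
  proof
    assume "(i + s) mod n = (j + s) mod n"
    then have "i mod n = j mod n" by (simp add: nat_mod_eq_iff)
    then show "i = j" using that by simp
  qed simp
  have suc: "Suc ((i + s) mod n) mod n = (Suc i mod n + s) mod n" for i
    by (simp add: mod_Suc_eq mod_add_left_eq)
  have "inj_on (\<lambda>i. v ((i + s) mod n)) {..<n}"
  proof (rule inj_onI)
    fix i j assume h: "i \<in> {..<n}" "j \<in> {..<n}" "v ((i + s) mod n) = v ((j + s) mod n)"
    then have "(i + s) mod n = (j + s) mod n"
      using c lt unfolding cyc_config_def by (meson inj_onD lessThan_iff)
    then show "i = j" using inj h by simp
  qed
  moreover have "A (v ((i + s) mod n)) (cc ((j + s) mod n)) = (a ((i + s) mod n) \<noteq> (j = i \<or> j = Suc i mod n))"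
    if ij: "i < n" "j < n" for i j
  proof -
    have "A (v ((i + s) mod n)) (cc ((j + s) mod n)) = (a ((i + s) mod n) \<noteq>
        ((j + s) mod n = (i + s) mod n \<or> (j + s) mod n = Suc ((i + s) mod n) mod n))"
      using c lt unfolding cyc_config_def by simp
    also have "(j + s) mod n = (i + s) mod n \<longleftrightarrow> j = i" by (rule inj[OF ij(2,1)])
    also have "(j + s) mod n = Suc ((i + s) mod n) mod n \<longleftrightarrow> j = Suc i mod n" unfolding suc by (rule inj[OF ij(2) lt])
    finally show ?thesis .
  qed
  moreover have "(\<lambda>i. v ((i + s) mod n)) ` {..<n} \<subseteq> R" "(\<lambda>j. cc ((j + s) mod n)) ` {..<n} \<subseteq> X"
    "x0 \<in> X" "\<forall>i<n. A (v ((i + s) mod n)) x0 = a ((i + s) mod n)"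
    using c lt unfolding cyc_config_def by auto
  ultimately show ?thesis unfolding cyc_config_def by simp
qed

text \<open>The rows are the four triples with an even number of ones. Those of
  \<open>odd_list\<close>, its entrywise complement, are the triples with an odd number.\<close>

definition even_list :: "nat list list" where
  "even_list = [[1,0,1],[1,1,0],[0,1,1],[0,0,0]]"

definition odd_list :: "nat list list" where
  "odd_list = [[0,1,0],[0,0,1],[1,0,0],[1,1,1]]"

text \<open>Marking the entries different from \<open>c\<close>, the four rows are the even triples
  on \<open>x\<close>, \<open>y\<close>, \<open>z\<close>; if \<open>c\<close> is true, the rows
  themselves are the odd triples.\<close>

lemma even_odd_embeds:
  assumes r: "r0 \<in> R" "r1 \<in> R" "r2 \<in> R" "r3 \<in> R" and x: "x \<in> X" "y \<in> X" "z \<in> X"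
    and 0: "A r0 x = c" "A r0 y = c" "A r0 z = c" and 1: "A r1 x = c" "A r1 y \<noteq> c" "A r1 z \<noteq> c"
    and 2: "A r2 x \<noteq> c" "A r2 y = c" "A r2 z \<noteq> c" and 3: "A r3 x \<noteq> c" "A r3 y \<noteq> c" "A r3 z = c"
  shows "embeds_list even_list R X A \<or> embeds_list odd_list R X A"
proof -
  have d: "distinct [r2, r3, r1, r0]" "distinct [x, y, z]" using 0 1 2 3 by auto
  define \<rho> where "\<rho> i = [r2, r3, r1, r0] ! i" for i
  define \<gamma> where "\<gamma> i = [x, y, z] ! i" for i
  have s: "{..<4::nat} = {0, 1, 2, 3}" "{..<3::nat} = {0, 1, 2}" by auto
  have i: "inj_on \<rho> {..<4}" "\<rho> ` {..<4} \<subseteq> R" "inj_on \<gamma> {..<3}" "\<gamma> ` {..<3} \<subseteq> X"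
    unfolding s \<rho>_def \<gamma>_def using d r x by auto
  show ?thesis
  proof (cases c)
    case False
    have "\<forall>i<4. \<forall>j<3. (even_list ! i ! j = 1) = A (\<rho> i) (\<gamma> j)"
      unfolding all_less_3 all_less_4 \<rho>_def \<gamma>_def even_list_def using 0 1 2 3 False by simp
    moreover have "length even_list = 4" "length (hd even_list) = 3" by (simp_all add: even_list_def)
    ultimately have "embeds_list even_list R X A"
      unfolding embeds_list_def embeds_fun_def using i by (metis (no_types, lifting))
    then show ?thesis ..
  next
    case True
    have "\<forall>i<4. \<forall>j<3. (odd_list ! i ! j = 1) = A (\<rho> i) (\<gamma> j)"
      unfolding all_less_3 all_less_4 \<rho>_def \<gamma>_def odd_list_def using 0 1 2 3 True by simp
    moreover have "length odd_list = 4" "length (hd odd_list) = 3" by (simp_all add: odd_list_def)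
    ultimately have "embeds_list odd_list R X A"
      unfolding embeds_list_def embeds_fun_def using i by (metis (no_types, lifting))
    then show ?thesis ..
  qed
qed

section \<open>Local patterns of a cyclic word that yield a transposed obstruction\<close>

context
  fixes n v cc x0 a R X and A :: "'r \<Rightarrow> 'c \<Rightarrow> bool"
  assumes c: "cyc_config n v cc x0 a R X A"
    and no: "\<not> embeds_list even_list R X A" "\<not> embeds_list odd_list R X A"
begin

text \<open>On the columns \<open>x0\<close>, \<open>cc i1\<close>, \<open>cc i2\<close>, row
  \<open>k\<close> is constant, row \<open>i1\<close> changes in both cycle columns, and rows
  \<open>i0\<close> and \<open>i2\<close> change in one each. With these letters the differences
  from \<open>e\<close> are the four even triples.\<close>

lemma no_star_triple:
  assumes lt: "i0 < n" "i1 < n" "i2 < n" "k < n" and suc: "i1 = Suc i0 mod n" "i2 = Suc i1 mod n"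
    and o: "\<not> (i2 = i0 \<or> i2 = Suc i0 mod n)" "\<not> (i1 = i2 \<or> i1 = Suc i2 mod n)"
    "\<not> (i1 = k \<or> i1 = Suc k mod n)" "\<not> (i2 = k \<or> i2 = Suc k mod n)"
    and a: "a k = e" "a i0 \<noteq> e" "a i1 = e" "a i2 \<noteq> e"
  shows False
proof -
  have z: "A (v i) x0 = a i" if "i < n" for i using c that unfolding cyc_config_def by auto
  have e: "A (v i) (cc j) = (a i \<noteq> (j = i \<or> j = Suc i mod n))" if "i < n" "j < n" for i j
    using c that unfolding cyc_config_def by auto
  have m: "v i \<in> R" "cc i \<in> X" "x0 \<in> X" if "i < n" for i using c that unfolding cyc_config_def by auto
  have i': "A (v p) (cc j) = (a p \<noteq> True)" if "p < n" "j < n" "j = p \<or> j = Suc p mod n" for p j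
    using e[OF that(1,2)] that(3) by simp
  have o': "A (v p) (cc j) = (a p \<noteq> False)" if "p < n" "j < n" "\<not> (j = p \<or> j = Suc p mod n)" for p j
    using e[OF that(1,2)] that(3) by simp
  have v1: "A (v k) (cc i1) = e" using o'[OF lt(4,2) o(3)] a(1) by simp
  have v2: "A (v k) (cc i2) = e" using o'[OF lt(4,3) o(4)] a(1) by simp
  have v3: "A (v i1) (cc i1) \<noteq> e" using i'[OF lt(2,2) disjI1[OF refl]] a(3) by simp
  have v4: "A (v i1) (cc i2) \<noteq> e" using i'[OF lt(2,3) disjI2[OF suc(2)]] a(3) by simp
  have v5: "A (v i0) (cc i1) = e" using i'[OF lt(1,2) disjI2[OF suc(1)]] a(2) by simp
  have v6: "A (v i0) (cc i2) \<noteq> e" using o'[OF lt(1,3) o(1)] a(2) by simp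
  have v7: "A (v i2) (cc i1) \<noteq> e" using o'[OF lt(3,2) o(2)] a(4) by simp
  have v8: "A (v i2) (cc i2) = e" using i'[OF lt(3,3) disjI1[OF refl]] a(4) by simp
  note v = v1 v2 v3 v4 v5 v6 v7 v8
  have "embeds_list even_list R X A \<or> embeds_list odd_list R X A"
    by (rule even_odd_embeds[of "v k" R "v i1" "v i0" "v i2" x0 X "cc i1" "cc i2" A e])
      (simp_all only: v m[OF lt(1)] m[OF lt(2)] m[OF lt(3)] m[OF lt(4)]
        z[OF lt(1)] z[OF lt(2)] z[OF lt(3)] z[OF lt(4)] a simp_thms not_False_eq_True)
  then show False using no by blast
qed

text \<open>Here all three columns belong to the cycle: row \<open>k\<close> meets none of them, and
  each other row meets exactly one, where its value returns to \<open>e\<close>.\<close>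

lemma no_column_triple:
  assumes "k < n" "p1 < n" "p2 < n" "p3 < n" "j1 < n" "j2 < n" "j3 < n"
    and "j1 = p1 \<or> j1 = Suc p1 mod n" "j2 = p2 \<or> j2 = Suc p2 mod n" "j3 = p3 \<or> j3 = Suc p3 mod n"
    and "\<not> (j2 = p1 \<or> j2 = Suc p1 mod n)" "\<not> (j3 = p1 \<or> j3 = Suc p1 mod n)"
    "\<not> (j1 = p2 \<or> j1 = Suc p2 mod n)" "\<not> (j3 = p2 \<or> j3 = Suc p2 mod n)"
    "\<not> (j1 = p3 \<or> j1 = Suc p3 mod n)" "\<not> (j2 = p3 \<or> j2 = Suc p3 mod n)"
    "\<not> (j1 = k \<or> j1 = Suc k mod n)" "\<not> (j2 = k \<or> j2 = Suc k mod n)" "\<not> (j3 = k \<or> j3 = Suc k mod n)"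
    and "a k = e" "a p1 \<noteq> e" "a p2 \<noteq> e" "a p3 \<noteq> e"
  shows False
proof -
  have e: "A (v i) (cc j) = (a i \<noteq> (j = i \<or> j = Suc i mod n))" if "i < n" "j < n" for i j
    using c that unfolding cyc_config_def by auto
  have m: "v i \<in> R" "cc i \<in> X" if "i < n" for i using c that unfolding cyc_config_def by auto
  have i: "A (v p) (cc j) = (a p \<noteq> True)" if "p < n" "j < n" "j = p \<or> j = Suc p mod n" for p j
    using e[OF that(1,2)] that(3) by simp
  have o: "A (v p) (cc j) = (a p \<noteq> False)" if "p < n" "j < n" "\<not> (j = p \<or> j = Suc p mod n)" for p j
    using e[OF that(1,2)] that(3) by simp
  have ne: "(\<not> a p1) = e" "(\<not> a p2) = e" "(\<not> a p3) = e" using assms(21-23) by auto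
  have "embeds_list even_list R X A \<or> embeds_list odd_list R X A"
    by (rule even_odd_embeds[of "v k" R "v p1" "v p2" "v p3" "cc j1" X "cc j2" "cc j3" A e])
      (simp_all only: m i o assms ne simp_thms not_False_eq_True)
  then show False using no by blast
qed

text \<open>After the boundary 1, 0 the remaining three letters must be non-decreasing, which leaves
  four words.\<close>

lemma boundary_five:
  assumes "n = 5" "a 0" "\<not> a 1"
  shows "(\<not> a 2 \<or> a 3) \<and> (\<not> a 3 \<or> a 4)"
proof -
  have s1: "\<not> (\<not> a 3 \<and> a 0 \<and> \<not> a 1 \<and> a 2)"
    by (rule notI, rule no_star_triple[of 0 1 2 3 False]) (simp_all add: assms(1))
  have s2: "\<not> (\<not> a 1 \<and> a 3 \<and> \<not> a 4 \<and> a 0)"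
    by (rule notI, rule no_star_triple[of 3 4 0 1 False]) (simp_all add: assms(1))
  show ?thesis using s1 s2 assms(2,3) by blast
qed

text \<open>Read cyclically from index 1, the only survivor is 000111.\<close>

lemma boundary_six:
  assumes "n = 6" "a 0" "\<not> a 1"
  shows "\<not> a 2 \<and> \<not> a 3 \<and> a 4 \<and> a 5"
proof -
  have "\<not> (\<not> a 3 \<and> a 0 \<and> \<not> a 1 \<and> a 2)" by (rule notI, rule no_star_triple[of 0 1 2 3 False]) (simp_all add: assms(1))
  moreover have "\<not> (\<not> a 1 \<and> a 0 \<and> a 3 \<and> a 4)" by (rule notI,
    rule no_column_triple[of 1 0 3 4 0 3 5 False]) (simp_all add: assms(1))
  moreover have "\<not> (\<not> a 4 \<and> a 0 \<and> \<not> a 1 \<and> a 2)" by (rule notI,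
    rule no_star_triple[of 0 1 2 4 False]) (simp_all add: assms(1))
  moreover have "\<not> (a 0 \<and> \<not> a 2 \<and> a 3 \<and> \<not> a 4)" by (rule notI, rule no_star_triple[of 2 3 4 0 True]) (simp_all add: assms(1))
  moreover have "\<not> (a 0 \<and> \<not> a 1 \<and> \<not> a 3 \<and> \<not> a 4)" by (rule notI,
    rule no_column_triple[of 0 1 3 4 2 3 5 True]) (simp_all add: assms(1))
  moreover have "\<not> (\<not> a 1 \<and> a 4 \<and> \<not> a 5 \<and> a 0)" by (rule notI,
    rule no_star_triple[of 4 5 0 1 False]) (simp_all add: assms(1))
  ultimately show ?thesis using assms(2,3) by blast
qed

lemma boundary_seven:
  assumes "n = 7" "a 0" "\<not> a 1"
  shows False
proof -
  have "\<not> (\<not> a 3 \<and> a 0 \<and> \<not> a 1 \<and> a 2)" by (rule notI, rule no_star_triple[of 0 1 2 3 False]) (simp_all add: assms(1))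
  moreover have "\<not> (\<not> a 1 \<and> a 0 \<and> a 3 \<and> a 4)" by (rule notI,
    rule no_column_triple[of 1 0 3 4 0 3 5 False]) (simp_all add: assms(1))
  moreover have "\<not> (a 0 \<and> \<not> a 1 \<and> \<not> a 4 \<and> \<not> a 5)" by (rule notI,
    rule no_column_triple[of 0 1 4 5 2 4 6 True]) (simp_all add: assms(1))
  moreover have "\<not> (\<not> a 1 \<and> a 3 \<and> \<not> a 4 \<and> a 5)" by (rule notI,
    rule no_star_triple[of 3 4 5 1 False]) (simp_all add: assms(1))
  moreover have "\<not> (a 0 \<and> \<not> a 1 \<and> \<not> a 3 \<and> \<not> a 6)" by (rule notI,
    rule no_column_triple[of 0 1 3 6 2 3 6 True]) (simp_all add: assms(1))
  moreover have "\<not> (\<not> a 2 \<and> a 0 \<and> a 4 \<and> a 6)" by (rule notI,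
    rule no_column_triple[of 2 0 4 6 1 4 6 False]) (simp_all add: assms(1))
  moreover have "\<not> (a 5 \<and> \<not> a 1 \<and> \<not> a 2 \<and> \<not> a 4)" by (rule notI,
    rule no_column_triple[of 5 1 2 4 1 3 4 True]) (simp_all add: assms(1))
  ultimately show False using assms(2,3) by blast
qed

text \<open>Rows 0 to 6 and columns up to 7 suffice. None of the successors involved wraps round, so
  one argument covers all lengths from eight on.\<close>

lemma boundary_eight:
  assumes "8 \<le> n" "a 0" "\<not> a 1"
  shows False
proof -
  have [simp]: "0 < n" "Suc 0 < n" "Suc (Suc 0) < n" "2 < n" "3 < n" "4 < n" "5 < n" "6 < n" "7 < n" "n \<noteq> Suc 0"
    using assms(1) by auto
  have "\<not> (\<not> a 3 \<and> a 0 \<and> \<not> a 1 \<and> a 2)" by (rule notI, rule no_star_triple[of 0 1 2 3 False]) (simp_all add: assms(1))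
  moreover have "\<not> (a 0 \<and> \<not> a 1 \<and> \<not> a 4 \<and> \<not> a 5)" by (rule notI,
    rule no_column_triple[of 0 1 4 5 2 4 6 True]) (simp_all add: assms(1))
  moreover have "\<not> (\<not> a 1 \<and> a 3 \<and> \<not> a 4 \<and> a 5)" by (rule notI,
    rule no_star_triple[of 3 4 5 1 False]) (simp_all add: assms(1))
  moreover have "\<not> (\<not> a 6 \<and> a 0 \<and> a 3 \<and> a 4)" by (rule notI,
    rule no_column_triple[of 6 0 3 4 1 3 5 False]) (simp_all add: assms(1))
  moreover have "\<not> (\<not> a 2 \<and> a 0 \<and> a 4 \<and> a 6)" by (rule notI,
    rule no_column_triple[of 2 0 4 6 1 4 6 False]) (simp_all add: assms(1))
  moreover have "\<not> (a 0 \<and> \<not> a 1 \<and> \<not> a 3 \<and> \<not> a 6)" by (rule notI,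
    rule no_column_triple[of 0 1 3 6 2 3 6 True]) (simp_all add: assms(1))
  moreover have "\<not> (\<not> a 1 \<and> a 2 \<and> a 4 \<and> a 6)" by (rule notI,
    rule no_column_triple[of 1 2 4 6 3 4 6 False]) (simp_all add: assms(1))
  moreover have "\<not> (\<not> a 2 \<and> a 0 \<and> a 5 \<and> a 6)" by (rule notI,
    rule no_column_triple[of 2 0 5 6 1 5 7 False]) (simp_all add: assms(1))
  ultimately show False using assms(2,3) by blast
qed

end

text \<open>Otherwise the ones would propagate round the whole cycle.\<close>

lemma exists_boundary:
  assumes n: "0 < n" and i: "i < n" "a i" and j: "j < n" "\<not> a j"
  shows "\<exists>t<n. a t \<and> \<not> a (Suc t mod n)"
proof (rule ccontr)
  assume "\<not> ?thesis"
  then have step: "a (Suc t mod n)" if "t < n" "a t" for t using that by blast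
  have "a ((i + k) mod n)" for k
  proof (induction k)
    case 0 then show ?case using i by simp
  next
    case (Suc k)
    have "Suc ((i + k) mod n) mod n = (i + Suc k) mod n" by (simp add: mod_Suc_eq)
    then show ?case using step[of "(i + k) mod n"] Suc n by simp
  qed
  from this[of "j + n - i"] show False using i j by simp
qed

definition word_of :: "nat list \<Rightarrow> nat \<Rightarrow> bool" where
  "word_of w i \<longleftrightarrow> w ! i = 1"

lemma cyc_entry_cong: "(\<And>i. i < n \<Longrightarrow> a i = b i) \<Longrightarrow> embeds_fun n l (cyc_entry n a) R X A \<Longrightarrow> embeds_fun n l (cyc_entry n b) R X A"
  unfolding embeds_fun_def cyc_entry_def by simp

lemma all_less_5: "(\<forall>i<5. P i) \<longleftrightarrow> P 0 \<and> P 1 \<and> P 2 \<and> P 3 \<and> P (4::nat)"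
  and all_less_6: "(\<forall>i<6. P i) \<longleftrightarrow> P 0 \<and> P 1 \<and> P 2 \<and> P 3 \<and> P 4 \<and> P (5::nat)"
  by (simp_all add: numeral_eq_Suc All_less_Suc2)

theorem cyc_config_cases:
  assumes n: "5 \<le> n" and c: "cyc_config n v cc x0 a R X A"
  shows "(\<exists>N\<in>set small_four. embeds_list N R X A) \<or> embeds_fun n (Suc n) (cyc_entry n (\<lambda>_. False)) R X A \<or>
    embeds_fun n (Suc n) (cyc_entry n (\<lambda>_. True)) R X A \<or>
    (\<exists>w\<in>{[0,0,0,0,1],[0,0,0,1,1],[0,0,1,1,1],[0,1,1,1,1],[0,0,0,1,1,1]}.
      embeds_fun (length w) (Suc (length w)) (cyc_entry (length w) (word_of w)) R X A)"
proof (rule ccontr)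
  assume contr: "\<not> ?thesis"
  have "even_list \<in> set small_four" "odd_list \<in> set small_four"
    unfolding even_list_def odd_list_def small_four_def by simp_all
  then have no: "\<not> embeds_list even_list R X A" "\<not> embeds_list odd_list R X A" using contr by blast+
  have n3: "3 \<le> n" "0 < n" using n by auto
  have emb: "embeds_fun n (Suc n) (cyc_entry n a) R X A" using cyc_config_embeds[OF n3(1) c] .
  have "\<exists>i<n. a i"
  proof (rule ccontr)
    assume h: "\<not> ?thesis"
    have "embeds_fun n (Suc n) (cyc_entry n (\<lambda>_. False)) R X A"
      by (rule cyc_entry_cong[OF _ emb]) (use h in simp)
    then show False using contr by simp
  qed
  moreover have "\<exists>j<n. \<not> a j"
  proof (rule ccontr)
    assume h: "\<not> ?thesis"
    have "embeds_fun n (Suc n) (cyc_entry n (\<lambda>_. True)) R X A"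
      by (rule cyc_entry_cong[OF _ emb]) (use h in simp)
    then show False using contr by simp
  qed
  ultimately obtain i j where "i < n" "a i" "j < n" "\<not> a j" by auto
  from exists_boundary[of n i a j, OF n3(2) this]
  obtain t where t: "t < n" "a t" "\<not> a (Suc t mod n)" by auto
  define b where "b i = a ((i + t) mod n)" for i
  define v' where "v' i = v ((i + t) mod n)" for i
  define cc' where "cc' i = cc ((i + t) mod n)" for i
  have c': "cyc_config n v' cc' x0 b R X A"
    using cyc_config_rotate[OF n3(2) c, of t] unfolding b_def v'_def cc'_def .
  have b: "b 0" "\<not> b 1" using t unfolding b_def by simp_all
  \<comment> \<open>A further rotation by one lets the word begin with 0 and end with 1, as the
    words of \<open>A_RowCol\<close> do.\<close>
  have rot: "embeds_fun n (Suc n) (cyc_entry n (\<lambda>i. b ((i + 1) mod n))) R X A"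
    by (rule cyc_config_embeds[OF n3(1) cyc_config_rotate[OF n3(2) c', of 1]])
  have word: False if "w \<in> {[0,0,0,0,1],[0,0,0,1,1],[0,0,1,1,1],[0,1,1,1,1],[0,0,0,1,1,1]}" "length w = n"
    "\<forall>i<n. b ((i + 1) mod n) = word_of w i" for w
  proof -
    have "embeds_fun n (Suc n) (cyc_entry n (word_of w)) R X A" by (rule cyc_entry_cong[OF _ rot]) (use that(3) in blast)
    then show False using that(1,2) contr by blast
  qed
  consider "n = 5" | "n = 6" | "n = 7" | "8 \<le> n" using n by linarith
  then show False
  proof cases
    case 1
    have "(\<not> b 2 \<or> b 3) \<and> (\<not> b 3 \<or> b 4)" by (rule boundary_five[OF c' no 1 b])
    then consider "\<not> b 2" "\<not> b 3" "\<not> b 4" | "\<not> b 2" "\<not> b 3" "b 4" | "\<not> b 2" "b 3" "b 4" | "b 2" "b 3" "b 4" by blast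
    then show False
    proof cases
      case a: 1
      show ?thesis
        by (rule word[of "[0,0,0,0,1]"]) (unfold 1 all_less_5, use a b in \<open>simp_all add: word_of_def flip: numeral_2_eq_2\<close>)
    next
      case a: 2
      show ?thesis
        by (rule word[of "[0,0,0,1,1]"]) (unfold 1 all_less_5, use a b in \<open>simp_all add: word_of_def flip: numeral_2_eq_2\<close>)
    next
      case a: 3
      show ?thesis
        by (rule word[of "[0,0,1,1,1]"]) (unfold 1 all_less_5, use a b in \<open>simp_all add: word_of_def flip: numeral_2_eq_2\<close>)
    next
      case a: 4
      show ?thesis
        by (rule word[of "[0,1,1,1,1]"]) (unfold 1 all_less_5, use a b in \<open>simp_all add: word_of_def flip: numeral_2_eq_2\<close>)
    qed
  next
    case 2
    have a: "\<not> b 2" "\<not> b 3" "b 4" "b 5" using boundary_six[OF c' no 2 b] by auto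
    show False
      by (rule word[of "[0,0,0,1,1,1]"]) (unfold 2 all_less_6, use a b in \<open>simp_all add: word_of_def flip: numeral_2_eq_2\<close>)
  next
    case 3 show False by (rule boundary_seven[OF c' no 3 b])
  next
    case 4 show False by (rule boundary_eight[OF c' no 4 b])
  qed
qed

section \<open>Permutations, submatrices and circular orders\<close>

lemma pick_less:
  assumes "i < card {a. a < m \<and> a \<in> I}"
  shows "pick I i \<in> I" "pick I i < m" and "j < i \<Longrightarrow> pick I j < pick I i"
proof -
  let ?S = "{a. a < m \<and> a \<in> I}"
  have e: "pick I l = pick ?S l" if "l < card ?S" for l using pick_reduce_set that by blast
  have "pick ?S i \<in> ?S" using pick_in_set assms by blast
  then show "pick I i \<in> I" "pick I i < m" using e[OF assms] by auto
  show "pick I j < pick I i" if "j < i"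
    using pick_mono[of i ?S j] assms that e[OF assms] e[of j] by simp
qed

lemma pick_inj:
  assumes "i < card {a. a < m \<and> a \<in> I}" "j < card {a. a < m \<and> a \<in> I}" "pick I i = pick I j"
  shows "i = j"
  using pick_less(3)[OF assms(1), of j] pick_less(3)[OF assms(2), of i] assms(3)
  by (cases i j rule: linorder_cases) auto

lemma exists_permutation_pick:
  assumes inj: "inj_on \<rho> {..<k}" and sub: "\<rho> ` {..<k} \<subseteq> {..<m::nat}"
  shows "card {a. a < m \<and> a \<in> \<rho> ` {..<k}} = k \<and>
    (\<exists>\<sigma>. \<sigma> permutes {..<k} \<and> (\<forall>i<k. pick (\<rho> ` {..<k}) (\<sigma> i) = \<rho> i))"
proof
  let ?I = "\<rho> ` {..<k}"
  have e: "{a. a < m \<and> a \<in> ?I} = ?I" using sub by auto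
  show c: "card {a. a < m \<and> a \<in> ?I} = k" unfolding e using card_image[OF inj] by simp
  \<comment> \<open>The rank of \<open>\<rho> i\<close> in the image, because \<open>pick\<close>
    lists a set in increasing order.\<close>
  define \<sigma> where "\<sigma> i = (if i < k then card {a\<in>?I. a < \<rho> i} else i)" for i
  have p: "pick ?I (\<sigma> i) = \<rho> i" if "i < k" for i
    using pick_card_in_set[of "\<rho> i" ?I] that unfolding \<sigma>_def by auto
  have lt: "\<sigma> i < k" if "i < k" for i
  proof -
    have "{a\<in>?I. a < \<rho> i} \<subset> ?I" using that by blast
    then have "card {a\<in>?I. a < \<rho> i} < card ?I" by (intro psubset_card_mono) auto
    then show ?thesis using that card_image[OF inj] unfolding \<sigma>_def by simp
  qed
  have "inj_on \<sigma> {..<k}"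
  proof (rule inj_onI)
    fix i j assume "i \<in> {..<k}" "j \<in> {..<k}" "\<sigma> i = \<sigma> j"
    then have "\<rho> i = \<rho> j" using p[of i] p[of j] by simp
    then show "i = j" using inj \<open>i \<in> _\<close> \<open>j \<in> _\<close> by (auto dest: inj_onD)
  qed
  moreover have "\<sigma> ` {..<k} \<subseteq> {..<k}" using lt by auto
  ultimately have "bij_betw \<sigma> {..<k} {..<k}" by (simp add: endo_inj_surj bij_betw_def)
  then have "\<sigma> permutes {..<k}" by (rule bij_imp_permutes) (simp add: \<sigma>_def)
  then show "\<exists>\<sigma>. \<sigma> permutes {..<k} \<and> (\<forall>i<k. pick ?I (\<sigma> i) = \<rho> i)" using p by blast
qed

lemma embeds_funI:
  "inj_on \<rho> {..<k} \<Longrightarrow> \<rho> ` {..<k} \<subseteq> R \<Longrightarrow> inj_on \<gamma> {..<l} \<Longrightarrow> \<gamma> ` {..<l} \<subseteq> X \<Longrightarrow>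
    (\<And>i j. i < k \<Longrightarrow> j < l \<Longrightarrow> N i j = A (\<rho> i) (\<gamma> j)) \<Longrightarrow> embeds_fun k l N R X A"
  unfolding embeds_fun_def by blast

abbreviation embeds_mat :: "bool mat \<Rightarrow> bool mat \<Rightarrow> bool" where
  "embeds_mat N M \<equiv> embeds_fun (dim_row N) (dim_col N) (\<lambda>i j. N $$ (i, j)) {..<dim_row M} {..<dim_col M} (\<lambda>i j. M $$ (i, j))"

text \<open>\<open>submatrix\<close> keeps the order of rows and columns; an injective map combines
  the selection with the permutation.\<close>

lemma contains_configuration_iff: "contains_configuration M N \<longleftrightarrow> embeds_mat N M"
proof
  assume "contains_configuration M N"
  then obtain I J \<sigma> \<tau> where p: "\<sigma> permutes {..<dim_row (submatrix M I J)}" "\<tau> permutes {..<dim_col (submatrix M I J)}"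
    and N: "N = mat (dim_row (submatrix M I J)) (dim_col (submatrix M I J)) (\<lambda>(i, j). submatrix M I J $$ (\<sigma> i, \<tau> j))"
    unfolding contains_configuration_def eq_up_to_perm_def by blast
  let ?k = "card {i. i < dim_row M \<and> i \<in> I}" and ?l = "card {j. j < dim_col M \<and> j \<in> J}"
  have d: "dim_row N = ?k" "dim_col N = ?l" unfolding N by (simp_all add: dim_submatrix)
  have s: "\<sigma> permutes {..<?k}" "\<tau> permutes {..<?l}" using p by (simp_all add: dim_submatrix)
  have sl: "\<sigma> i < ?k" if "i < ?k" for i using permutes_in_image[OF s(1), of i] that by simp
  have tl: "\<tau> i < ?l" if "i < ?l" for i using permutes_in_image[OF s(2), of i] that by simp
  have m1: "inj_on (\<lambda>i. pick I (\<sigma> i)) {..<?k}"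
  proof (rule inj_onI)
    fix i j assume h: "i \<in> {..<?k}" "j \<in> {..<?k}" "pick I (\<sigma> i) = pick I (\<sigma> j)"
    then have "\<sigma> i = \<sigma> j" using pick_inj[OF sl sl] by blast
    then show "i = j" using permutes_inj[OF s(1)] by (auto dest: injD)
  qed
  have m2: "inj_on (\<lambda>i. pick J (\<tau> i)) {..<?l}"
  proof (rule inj_onI)
    fix i j assume h: "i \<in> {..<?l}" "j \<in> {..<?l}" "pick J (\<tau> i) = pick J (\<tau> j)"
    then have "\<tau> i = \<tau> j" using pick_inj[OF tl tl] by blast
    then show "i = j" using permutes_inj[OF s(2)] by (auto dest: injD)
  qed
  have m3: "(\<lambda>i. pick I (\<sigma> i)) ` {..<?k} \<subseteq> {..<dim_row M}" and m4: "(\<lambda>i. pick J (\<tau> i)) ` {..<?l} \<subseteq> {..<dim_col M}"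
    using pick_less(2)[OF sl] pick_less(2)[OF tl] by auto
  have m5: "N $$ (i, j) = M $$ (pick I (\<sigma> i), pick J (\<tau> j))" if "i < ?k" "j < ?l" for i j
    unfolding N using that sl tl by (simp add: dim_submatrix submatrix_index)
  show "embeds_mat N M" unfolding d by (rule embeds_funI[where \<rho> = "\<lambda>i. pick I (\<sigma> i)"
    and \<gamma> = "\<lambda>j. pick J (\<tau> j)"], rule m1, rule m3, rule m2, rule m4, rule m5)
next
  assume "embeds_mat N M"
  then obtain \<rho> \<gamma> where r: "inj_on \<rho> {..<dim_row N}" "\<rho> ` {..<dim_row N} \<subseteq> {..<dim_row M}"
    and g: "inj_on \<gamma> {..<dim_col N}" "\<gamma> ` {..<dim_col N} \<subseteq> {..<dim_col M}"
    and N: "\<And>i j. i < dim_row N \<Longrightarrow> j < dim_col N \<Longrightarrow> N $$ (i, j) = M $$ (\<rho> i, \<gamma> j)"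
    unfolding embeds_fun_def by auto
  let ?I = "\<rho> ` {..<dim_row N}" and ?J = "\<gamma> ` {..<dim_col N}"
  from conjunct2[OF exists_permutation_pick[OF r]] obtain \<sigma> where
    s': "\<sigma> permutes {..<dim_row N} \<and> (\<forall>i<dim_row N. pick ?I (\<sigma> i) = \<rho> i)" by (rule exE)
  from conjunct2[OF exists_permutation_pick[OF g]] obtain \<tau> where
    t': "\<tau> permutes {..<dim_col N} \<and> (\<forall>i<dim_col N. pick ?J (\<tau> i) = \<gamma> i)" by (rule exE)
  note s = conjunct1[OF exists_permutation_pick[OF r]] conjunct1[OF s'] conjunct2[OF s']
  note t = conjunct1[OF exists_permutation_pick[OF g]] conjunct1[OF t'] conjunct2[OF t']
  have sl: "\<sigma> i < dim_row N" if "i < dim_row N" for i using permutes_in_image[OF s(2), of i] that by simp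
  have tl: "\<tau> i < dim_col N" if "i < dim_col N" for i using permutes_in_image[OF t(2), of i] that by simp
  have d: "dim_row (submatrix M ?I ?J) = dim_row N" "dim_col (submatrix M ?I ?J) = dim_col N"
    unfolding dim_submatrix s(1) t(1) by simp_all
  have "N = mat (dim_row N) (dim_col N) (\<lambda>(i, j). submatrix M ?I ?J $$ (\<sigma> i, \<tau> j))"
  proof (rule eq_matI)
    fix i j assume "i < dim_row (mat (dim_row N) (dim_col N) (\<lambda>(i, j). submatrix M ?I ?J $$ (\<sigma> i, \<tau> j)))"
      "j < dim_col (mat (dim_row N) (dim_col N) (\<lambda>(i, j). submatrix M ?I ?J $$ (\<sigma> i, \<tau> j)))"
    then have ij: "i < dim_row N" "j < dim_col N" by auto
    have "submatrix M ?I ?J $$ (\<sigma> i, \<tau> j) = M $$ (pick ?I (\<sigma> i), pick ?J (\<tau> j))"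
      by (rule submatrix_index) (use s(1) t(1) sl tl ij in auto)
    then show "N $$ (i, j) = mat (dim_row N) (dim_col N) (\<lambda>(i, j). submatrix M ?I ?J $$ (\<sigma> i, \<tau> j)) $$ (i, j)"
      using N[OF ij] s(3) t(3) ij by simp
  qed simp_all
  then have "eq_up_to_perm (submatrix M ?I ?J) N" unfolding eq_up_to_perm_def d using s(2) t(2) by blast
  then show "contains_configuration M N" unfolding contains_configuration_def by blast
qed

lemma rotated_interval:
  fixes s l n p :: nat
  assumes n: "s < n" "l \<le> n" and p: "p < n"
  shows "p \<in> (\<lambda>t. (s + t) mod n) ` {..<l} \<longleftrightarrow> (if s + l \<le> n then s \<le> p \<and> p < s + l else s \<le> p \<or> p < s + l - n)"
proof
  assume "p \<in> (\<lambda>t. (s + t) mod n) ` {..<l}"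
  then obtain t where t: "t < l" "p = (s + t) mod n" by auto
  show "if s + l \<le> n then s \<le> p \<and> p < s + l else s \<le> p \<or> p < s + l - n"
  proof (cases "s + t < n")
    case True
    then have "(s + t) mod n = s + t" by (rule mod_less)
    then have "p = s + t" using t(2) by (rule trans[rotated])
    then show ?thesis using t(1) True by auto
  next
    case False
    then have "(s + t) mod n = s + t - n" using t n by (simp add: mod_if)
    then show ?thesis using t n False by auto
  qed
next
  assume h: "if s + l \<le> n then s \<le> p \<and> p < s + l else s \<le> p \<or> p < s + l - n"
  show "p \<in> (\<lambda>t. (s + t) mod n) ` {..<l}"
  proof (cases "s \<le> p")
    case True
    then show ?thesis using h p n by (intro image_eqI[of _ _ "p - s"]) (auto split: if_splits)
  next
    case False
    then show ?thesis using h p n by (intro image_eqI[of _ _ "n - s + p"]) (auto split: if_splits)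
  qed
qed

text \<open>Position 0 decides the shape: if it is outside \<open>S\<close>, then \<open>S\<close>
  is an interval, and otherwise the complement is one. A gap would give an alternation that starts
  at 0.\<close>

lemma circularly_consecutive_iff:
  assumes "S \<subseteq> {..<n}"
  shows "circularly_consecutive n S \<longleftrightarrow> alt_free int {..<n} (\<lambda>p. p \<in> S)"
proof
  assume "circularly_consecutive n S"
  then obtain s l where l: "l \<le> n" and S: "S = (\<lambda>t. (s + t) mod n) ` {..<l}" unfolding circularly_consecutive_def by blast
  show "alt_free int {..<n} (\<lambda>p. p \<in> S)"
  proof (cases "n = 0")
    case True then show ?thesis by (simp add: alt_free_def)
  next
    case False
    then have s: "s mod n < n" by simp
    have "S = (\<lambda>t. (s mod n + t) mod n) ` {..<l}" unfolding S by (simp add: mod_add_left_eq)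
    then have mem: "p \<in> S \<longleftrightarrow> (if s mod n + l \<le> n then s mod n \<le> p \<and> p < s mod n + l else s mod n \<le> p \<or> p < s mod n + l - n)"
      if "p < n" for p using rotated_interval[OF s l that] by simp
    show ?thesis
    proof (cases "s mod n + l \<le> n")
      case True
      show ?thesis by (rule alt_free_interval[of _ _ "int (s mod n)" _ "int (s mod n + l) - 1"]) (use mem True in auto)
    next
      case False
      have "alt_free int {..<n} (\<lambda>p. \<not> p \<in> S)"
        by (rule alt_free_interval[of _ _ "int (s mod n + l - n)" _ "int (s mod n) - 1"]) (use mem False in auto)
      then show ?thesis unfolding alt_free_Not .
    qed
  qed
next
  assume alt: "alt_free int {..<n} (\<lambda>p. p \<in> S)"
  have alt': False if "x < y" "y < z" "z < w" "w < n" "x \<in> S \<longleftrightarrow> z \<in> S" "y \<in> S \<longleftrightarrow> w \<in> S" "x \<in> S \<longleftrightarrow> y \<notin> S" for x y z w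
    using alt[unfolded alt_free_def, rule_format, of x y z w] that by auto
  have fin: "finite S" using assms finite_subset by blast
  show "circularly_consecutive n S"
  proof (cases "0 \<in> S")
    case no: False
    show ?thesis
    proof (cases "S = {}")
      case True then show ?thesis unfolding circularly_consecutive_def by (intro exI[of _ 0] exI[of _ 0]) simp
    next
      case False
      define s where "s = Min S"
      define e where "e = Max S"
      have se: "s \<in> S" "e \<in> S" "s \<le> e" "\<And>p. p \<in> S \<Longrightarrow> s \<le> p \<and> p \<le> e" using fin False unfolding s_def e_def by auto
      have "0 < s" using no se(1) by (cases s) auto
      have en: "e < n" using se assms by auto
      have S: "S = {s..e}"
      proof
        show "S \<subseteq> {s..e}" using se by auto
        show "{s..e} \<subseteq> S"
        proof (rule subsetI, rule ccontr)
          fix p assume p: "p \<in> {s..e}" "p \<notin> S"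
          then have "s < p" "p < e" using se by (auto simp: le_less)
          then show False using alt'[of 0 s p e] \<open>0 < s\<close> en no se p by blast
        qed
      qed
      have "p \<in> S \<longleftrightarrow> p \<in> (\<lambda>t. (s + t) mod n) ` {..<e + 1 - s}" for p
      proof (cases "p < n")
        case True
        have "p \<in> S \<longleftrightarrow> s \<le> p \<and> p \<le> e" unfolding S by simp
        then show ?thesis using rotated_interval[of s n "e + 1 - s" p] True se(3) en by auto
      next
        case False then show ?thesis using en unfolding S by auto
      qed
      then have "S = (\<lambda>t. (s + t) mod n) ` {..<e + 1 - s}" by blast
      moreover have "e + 1 - s \<le> n" using en by simp
      ultimately show ?thesis unfolding circularly_consecutive_def by blast
    qed
  next
    case yes: True
    show ?thesis
    proof (cases "{..<n} - S = {}")
      case True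
      then have "S = {..<n}" using assms by blast
      also have "\<dots> = (\<lambda>t. (0 + t) mod n) ` {..<n}" by auto
      finally show ?thesis unfolding circularly_consecutive_def by blast
    next
      case False
      define s where "s = Min ({..<n} - S)"
      define e where "e = Max ({..<n} - S)"
      have se: "s \<in> {..<n} - S" "e \<in> {..<n} - S" "s \<le> e" "\<And>p. p \<in> {..<n} - S \<Longrightarrow> s \<le> p \<and> p \<le> e"
      proof -
        have f: "finite ({..<n} - S)" by simp
        show "s \<in> {..<n} - S" "e \<in> {..<n} - S" unfolding s_def e_def using Min_in[OF f False] Max_in[OF f False] .
        then show "s \<le> e" unfolding e_def using Max_ge[OF f] by blast
        show "s \<le> p \<and> p \<le> e" if "p \<in> {..<n} - S" for p
          unfolding s_def e_def using Min_le[OF f that] Max_ge[OF f that] ..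
      qed
      have "0 < s" using yes se(1) by (cases s) auto
      have en: "e < n" "s < n" using se by auto
      have S: "p \<in> S \<longleftrightarrow> p < s \<or> e < p" if "p < n" for p
      proof
        show "p < s \<or> e < p" if "p \<in> S"
        proof (rule ccontr)
          assume "\<not> ?thesis"
          then have "s < p" "p < e" using se(1,2) that by (auto simp: not_less le_less)
          then show False using alt'[of 0 s p e] \<open>0 < s\<close> en yes se that by blast
        qed
        show "p \<in> S" if "p < s \<or> e < p" using se(4)[of p] that \<open>p < n\<close> by (cases "p \<in> S") auto
      qed
      have "p \<in> S \<longleftrightarrow> p \<in> (\<lambda>t. ((e + 1) mod n + t) mod n) ` {..<n - (e + 1 - s)}" for p
      proof (cases "p < n")
        case True
        show ?thesis
        proof (cases "e + 1 = n")
          case e: True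
          have "(e + 1) mod n = 0" "n - (e + 1 - s) = s" using e en by simp_all
          then show ?thesis using rotated_interval[of 0 n s p] True en S[OF True] e by auto
        next
          case False
          have "(e + 1) mod n = e + 1" using False en by simp
          moreover have "e + 1 + (n - (e + 1 - s)) = n + s" using se(3) en by linarith
          ultimately show ?thesis
            using rotated_interval[of "e + 1" n "n - (e + 1 - s)" p] True False en S[OF True] \<open>0 < s\<close> by auto
        qed
      next
        case False then show ?thesis using assms en by auto
      qed
      then have "S = (\<lambda>t. ((e + 1) mod n + t) mod n) ` {..<n - (e + 1 - s)}" by blast
      moreover have "n - (e + 1 - s) \<le> n" by simp
      ultimately show ?thesis unfolding circularly_consecutive_def by blast
    qed
  qed
qed

lemma circ_by_order:
  assumes inj: "inj_on f X" and alt: "\<And>i. i \<in> R \<Longrightarrow> alt_free f X (A i)"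
  shows "circ R X A"
  using assms unfolding circ_def by blast

lemma exists_sorting_permutation:
  fixes f :: "nat \<Rightarrow> int"
  assumes inj: "inj_on f {..<n}"
  shows "\<exists>\<tau>. \<tau> permutes {..<n} \<and> (\<forall>p<n. \<forall>q<n. p < q \<longrightarrow> f (\<tau> p) < f (\<tau> q))"
proof -
  define ys where "ys = sort_key f [0..<n]"
  have ys: "length ys = n" "set ys = {..<n}" "distinct ys" "sorted (map f ys)" unfolding ys_def by auto
  define \<tau> where "\<tau> p = (if p < n then ys ! p else p)" for p
  have "bij_betw ((!) ys) {..<n} {..<n}" by (rule bij_betw_nth[OF ys(3)]) (simp_all only: ys(1,2))
  then have "bij_betw \<tau> {..<n} {..<n}" by (subst bij_betw_cong[of _ _ "(!) ys"]) (simp_all add: \<tau>_def)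
  then have perm: "\<tau> permutes {..<n}" by (rule bij_imp_permutes) (simp add: \<tau>_def)
  have "f (\<tau> p) < f (\<tau> q)" if "p < n" "q < n" "p < q" for p q
  proof -
    have "f (\<tau> p) \<le> f (\<tau> q)" using sorted_nth_mono[OF ys(4), of p q] that ys(1) unfolding \<tau>_def by simp
    moreover have "\<tau> p \<noteq> \<tau> q" using permutes_inj[OF perm] that by (auto dest: injD)
    moreover have "\<tau> p < n" "\<tau> q < n" using permutes_in_image[OF perm] that by auto
    ultimately show ?thesis using inj_onD[OF inj, of "\<tau> p" "\<tau> q"] by fastforce
  qed
  then show ?thesis using perm by blast
qed

text \<open>The inverse of \<open>\<tau>\<close> gives the position of a column; conversely, sorting
  the columns by \<open>f\<close> gives \<open>\<tau>\<close>.\<close>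

lemma circular_ones_rows_iff: "circular_ones_rows M \<longleftrightarrow> circ {..<dim_row M} {..<dim_col M} (\<lambda>i j. M $$ (i, j))"
proof -
  let ?n = "dim_col M"
  have cc: "circularly_consecutive ?n {p. p < ?n \<and> M $$ (i, \<tau> p)} \<longleftrightarrow> alt_free int {..<?n} (\<lambda>p. M $$ (i, \<tau> p))"
    for i and \<tau> :: "nat \<Rightarrow> nat"
    by (subst circularly_consecutive_iff) (auto intro!: alt_free_cong)
  show ?thesis
  proof
    assume "circular_ones_rows M"
    then obtain \<tau> where t: "\<tau> permutes {..<?n}" "\<And>i. i < dim_row M \<Longrightarrow> alt_free int {..<?n} (\<lambda>p. M $$ (i, \<tau> p))"
      unfolding circular_ones_rows_def cc by blast
    show "circ {..<dim_row M} {..<?n} (\<lambda>i j. M $$ (i, j))"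
    proof (rule circ_by_order[of "\<lambda>j. int (Hilbert_Choice.inv \<tau> j)"])
      have "inj (Hilbert_Choice.inv \<tau>)" using permutes_inj[OF permutes_inv[OF t(1)]] .
      then show "inj_on (\<lambda>j. int (Hilbert_Choice.inv \<tau> j)) {..<?n}" by (auto simp: inj_on_def)
      fix i assume i: "i \<in> {..<dim_row M}"
      show "alt_free (\<lambda>j. int (Hilbert_Choice.inv \<tau> j)) {..<?n} (\<lambda>j. M $$ (i, j))"
        unfolding alt_free_def
      proof (intro ballI impI)
        fix x y z w assume m: "x \<in> {..<?n}" "y \<in> {..<?n}" "z \<in> {..<?n}" "w \<in> {..<?n}"
          and l: "int (Hilbert_Choice.inv \<tau> x) < int (Hilbert_Choice.inv \<tau> y)"
            "int (Hilbert_Choice.inv \<tau> y) < int (Hilbert_Choice.inv \<tau> z)"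
            "int (Hilbert_Choice.inv \<tau> z) < int (Hilbert_Choice.inv \<tau> w)"
            "M $$ (i, x) = M $$ (i, z)" "M $$ (i, y) = M $$ (i, w)"
        have inv: "\<tau> (Hilbert_Choice.inv \<tau> u) = u" for u using permutes_inverses(1)[OF t(1)] by simp
        have im: "Hilbert_Choice.inv \<tau> u \<in> {..<?n}" if "u \<in> {..<?n}" for u
          using permutes_in_image[OF permutes_inv[OF t(1)]] that by blast
        show "M $$ (i, x) = M $$ (i, y)"
          using t(2)[of i, unfolded alt_free_def, rule_format, of "Hilbert_Choice.inv \<tau> x" "Hilbert_Choice.inv \<tau> y"
            "Hilbert_Choice.inv \<tau> z" "Hilbert_Choice.inv \<tau> w"]
            im[OF m(1)] im[OF m(2)] im[OF m(3)] im[OF m(4)] l i by (simp add: inv)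
      qed
    qed
  next
    assume "circ {..<dim_row M} {..<?n} (\<lambda>i j. M $$ (i, j))"
    then obtain f where f: "inj_on f {..<?n}" "\<And>i. i < dim_row M \<Longrightarrow> alt_free f {..<?n} (\<lambda>j. M $$ (i, j))"
      unfolding circ_def by blast
    obtain \<tau> where t: "\<tau> permutes {..<?n}" "\<And>p q. p < ?n \<Longrightarrow> q < ?n \<Longrightarrow> p < q \<Longrightarrow> f (\<tau> p) < f (\<tau> q)"
      using exists_sorting_permutation[OF f(1)] by blast
    have "alt_free int {..<?n} (\<lambda>p. M $$ (i, \<tau> p))" if i: "i < dim_row M" for i
      unfolding alt_free_def
    proof (intro ballI impI)
      fix x y z w assume m: "x \<in> {..<?n}" "y \<in> {..<?n}" "z \<in> {..<?n}" "w \<in> {..<?n}"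
        and l: "int x < int y" "int y < int z" "int z < int w" "M $$ (i, \<tau> x) = M $$ (i, \<tau> z)"
          "M $$ (i, \<tau> y) = M $$ (i, \<tau> w)"
      have im: "\<tau> u \<in> {..<?n}" if "u \<in> {..<?n}" for u using permutes_in_image[OF t(1)] that by blast
      show "M $$ (i, \<tau> x) = M $$ (i, \<tau> y)"
        using f(2)[OF i, unfolded alt_free_def, rule_format, OF im[OF m(1)] im[OF m(2)] im[OF m(3)] im[OF m(4)]]
          t(2)[of x y] t(2)[of y z] t(2)[of z w] m l by simp
    qed
    then show "circular_ones_rows M" unfolding circular_ones_rows_def cc using t(1) by blast
  qed
qed

lemma circ_transfer:
  assumes "circ R X A" "\<rho> ` R' \<subseteq> R" "inj_on \<gamma> X'" "\<gamma> ` X' \<subseteq> X"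
    and "\<And>i j. i \<in> R' \<Longrightarrow> j \<in> X' \<Longrightarrow> B i j = A (\<rho> i) (\<gamma> j)"
  shows "circ R' X' B"
proof -
  obtain f where f: "inj_on f X" "\<And>i. i \<in> R \<Longrightarrow> alt_free f X (A i)" using assms(1) unfolding circ_def by blast
  show ?thesis
  proof (rule circ_by_order[of "\<lambda>j. f (\<gamma> j)"])
    show "inj_on (\<lambda>j. f (\<gamma> j)) X'" using f(1) assms(3,4) by (auto simp: inj_on_def subset_iff)
    fix i assume i: "i \<in> R'"
    have fi: "alt_free f X (A (\<rho> i))" using f(2) i assms(2) by blast
    show "alt_free (\<lambda>j. f (\<gamma> j)) X' (B i)"
      unfolding alt_free_def
    proof (intro ballI impI)
      fix x y z w assume m: "x \<in> X'" "y \<in> X'" "z \<in> X'" "w \<in> X'"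
        and l: "f (\<gamma> x) < f (\<gamma> y)" "f (\<gamma> y) < f (\<gamma> z)" "f (\<gamma> z) < f (\<gamma> w)" "B i x = B i z" "B i y = B i w"
      have im: "\<gamma> u \<in> X" if "u \<in> X'" for u using assms(4) that by blast
      show "B i x = B i y"
        using fi[unfolded alt_free_def, rule_format, OF im[OF m(1)] im[OF m(2)] im[OF m(3)] im[OF m(4)] l(1-3)] l(4,5)
        unfolding assms(5)[OF i m(1)] assms(5)[OF i m(2)] assms(5)[OF i m(3)] assms(5)[OF i m(4)] by simp
    qed
  qed
qed

abbreviation circ_mat :: "bool mat \<Rightarrow> bool" where
  "circ_mat M \<equiv> circ {..<dim_row M} {..<dim_col M} (\<lambda>i j. M $$ (i, j)) \<and>
    circ {..<dim_col M} {..<dim_row M} (\<lambda>j i. M $$ (i, j))"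

lemma circular_ones_rows_cols_iff: "circular_ones_rows_cols M \<longleftrightarrow> circ_mat M"
proof -
  have "circular_ones_cols M \<longleftrightarrow> circ {..<dim_col M} {..<dim_row M} (\<lambda>j i. M $$ (i, j))"
    unfolding circular_ones_cols_def circular_ones_rows_iff
  proof -
    have "circ {..<dim_row (transpose_mat M)} {..<dim_col (transpose_mat M)} (\<lambda>i j. (transpose_mat M) $$ (i, j)) \<longleftrightarrow>
        circ {..<dim_col M} {..<dim_row M} (\<lambda>i j. (transpose_mat M) $$ (i, j))" by simp
    also have "\<dots> \<longleftrightarrow> circ {..<dim_col M} {..<dim_row M} (\<lambda>j i. M $$ (i, j))"
    proof
      show "circ {..<dim_col M} {..<dim_row M} (\<lambda>i j. (transpose_mat M) $$ (i, j))"
        if "circ {..<dim_col M} {..<dim_row M} (\<lambda>j i. M $$ (i, j))"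
        by (rule circ_transfer[OF that, of id _ id]) auto
      show "circ {..<dim_col M} {..<dim_row M} (\<lambda>j i. M $$ (i, j))"
        if "circ {..<dim_col M} {..<dim_row M} (\<lambda>i j. (transpose_mat M) $$ (i, j))"
        by (rule circ_transfer[OF that, of id _ id]) auto
    qed
    finally show "circ {..<dim_row (transpose_mat M)} {..<dim_col (transpose_mat M)} (\<lambda>i j. (transpose_mat M) $$ (i, j)) \<longleftrightarrow>
      circ {..<dim_col M} {..<dim_row M} (\<lambda>j i. M $$ (i, j))" .
  qed
  then show ?thesis unfolding circular_ones_rows_cols_def circular_ones_rows_iff by simp
qed

lemma circ_mat_embeds:
  assumes M: "circ_mat M" and e: "embeds_mat N M"
  shows "circ_mat N"
proof -
  obtain \<rho> \<gamma> where r: "inj_on \<rho> {..<dim_row N}" "\<rho> ` {..<dim_row N} \<subseteq> {..<dim_row M}"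
    and g: "inj_on \<gamma> {..<dim_col N}" "\<gamma> ` {..<dim_col N} \<subseteq> {..<dim_col M}"
    and N: "\<And>i j. i < dim_row N \<Longrightarrow> j < dim_col N \<Longrightarrow> N $$ (i, j) = M $$ (\<rho> i, \<gamma> j)"
    using e unfolding embeds_fun_def by auto
  have "circ {..<dim_row N} {..<dim_col N} (\<lambda>i j. N $$ (i, j))"
    by (rule circ_transfer[OF conjunct1[OF M] r(2) g]) (simp add: N)
  moreover have "circ {..<dim_col N} {..<dim_row N} (\<lambda>j i. N $$ (i, j))"
    by (rule circ_transfer[OF conjunct2[OF M] g(2) r]) (simp add: N)
  ultimately show ?thesis ..
qed

lemma embeds_mat_transpose: "embeds_mat N M \<longleftrightarrow> embeds_mat (transpose_mat N) ((transpose_mat M))"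
proof -
  have "embeds_mat (transpose_mat N) ((transpose_mat M))" if e: "embeds_mat N M" for N M :: "bool mat"
  proof -
    obtain \<rho> \<gamma> where r: "inj_on \<rho> {..<dim_row N}" "\<rho> ` {..<dim_row N} \<subseteq> {..<dim_row M}"
      and g: "inj_on \<gamma> {..<dim_col N}" "\<gamma> ` {..<dim_col N} \<subseteq> {..<dim_col M}"
      and N: "\<And>i j. i < dim_row N \<Longrightarrow> j < dim_col N \<Longrightarrow> N $$ (i, j) = M $$ (\<rho> i, \<gamma> j)"
      using e unfolding embeds_fun_def by auto
    have "\<rho> i < dim_row M" if "i < dim_row N" for i using r(2) that by auto
    moreover have "\<gamma> i < dim_col M" if "i < dim_col N" for i using g(2) that by auto
    ultimately show ?thesis by (intro embeds_funI[where \<rho> = \<gamma> and \<gamma> = \<rho>]) (use r g N in auto)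
  qed
  from this[of N M] this[of "transpose_mat N" "(transpose_mat M)"] show ?thesis by auto
qed

section \<open>The forbidden matrices\<close>

definition cyc_mat :: "nat \<Rightarrow> (nat \<Rightarrow> bool) \<Rightarrow> bool mat" where
  "cyc_mat n a = mat n (Suc n) (\<lambda>(i, j). cyc_entry n a i j)"

definition list_mat :: "nat list list \<Rightarrow> bool mat" where
  "list_mat N = mat (length N) (length (hd N)) (\<lambda>(i, j). N ! i ! j = 1)"

definition M_V_list :: "nat list list" where
  "M_V_list = [[1,1,0,0,0,0],[1,1,1,1,0,0],[0,0,1,1,0,0],[1,0,0,1,1,0]]"

definition M_V_comp_list :: "nat list list" where
  "M_V_comp_list = [[0,0,1,1,1,1],[0,0,0,0,1,1],[1,1,0,0,1,1],[0,1,1,0,0,1]]"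

text \<open>Taken modulo \<open>k\<close>, the exceptional last row obeys the same rule as the
  others.\<close>

lemma M_I_entry:
  assumes "i < k" "j < k" "3 \<le> k"
  shows "M_I k $$ (i, j) \<longleftrightarrow> j = i \<or> j = Suc i mod k"
proof (cases "i < k - 1")
  case True
  then show ?thesis using assms by (simp add: M_I_def)
next
  case False
  then have "Suc i = k" using assms by simp
  then show ?thesis using assms by (auto simp: M_I_def)
qed

lemma dim_M_I [simp]: "dim_row (M_I k) = k" "dim_col (M_I k) = k"
  by (simp_all add: M_I_def)

lemma star_entry:
  assumes "i < k" "j < Suc k" "3 \<le> k"
  shows "star_mat (M_I k) $$ (i, j) = cyc_entry k (\<lambda>_. False) i j"
  using assms M_I_entry[of i k j] by (auto simp: star_mat_def cyc_entry_def)

lemma star_M_I: "3 \<le> k \<Longrightarrow> star_mat (M_I k) = cyc_mat k (\<lambda>_. False)"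
  by (rule eq_matI) (simp_all add: cyc_mat_def star_entry, simp_all add: star_mat_def)

lemma complement_star_M_I: "3 \<le> k \<Longrightarrow> complement_mat (star_mat (M_I k)) = cyc_mat k (\<lambda>_. True)"
  unfolding star_M_I by (rule eq_matI) (simp_all add: cyc_mat_def complement_mat_def cyc_entry_def)

lemma complement_rows_star_M_I: "3 \<le> length w \<Longrightarrow> w \<odot> star_mat (M_I (length w)) = cyc_mat (length w) (word_of w)"
  unfolding star_M_I by (rule eq_matI) (auto simp: cyc_mat_def complement_rows_def cyc_entry_def word_of_def)

lemma star_M_V: "star_mat M_V = list_mat M_V_list"
proof (rule eq_matI)
  fix i j assume "i < dim_row (list_mat M_V_list)" "j < dim_col (list_mat M_V_list)"
  then have ij: "i < 4" "j < 6" by (simp_all add: list_mat_def M_V_list_def)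
  have "\<forall>i<4. \<forall>j<6. star_mat M_V $$ (i, j) = (M_V_list ! i ! j = 1)"
    unfolding all_less_4 all_less_6
    by (simp add: star_mat_def M_V_def M_V_list_def mat_of_rows_list_def)
  then show "star_mat M_V $$ (i, j) = list_mat M_V_list $$ (i, j)"
    using ij by (simp add: list_mat_def M_V_list_def)
qed (simp_all add: star_mat_def M_V_def M_V_list_def mat_of_rows_list_def list_mat_def)

lemma complement_star_M_V: "complement_mat (star_mat M_V) = list_mat M_V_comp_list"
proof (rule eq_matI)
  fix i j assume "i < dim_row (list_mat M_V_comp_list)" "j < dim_col (list_mat M_V_comp_list)"
  then have ij: "i < 4" "j < 6" by (simp_all add: list_mat_def M_V_comp_list_def)
  have "\<forall>i<4. \<forall>j<6. (M_V_list ! i ! j \<noteq> 1) = (M_V_comp_list ! i ! j = 1)"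
    unfolding all_less_4 all_less_6 M_V_list_def M_V_comp_list_def by simp
  then have "(M_V_list ! i ! j \<noteq> 1) = (M_V_comp_list ! i ! j = 1)" using ij by blast
  moreover have "complement_mat (star_mat M_V) $$ (i, j) = (M_V_list ! i ! j \<noteq> 1)"
    unfolding star_M_V complement_mat_def using ij by (simp add: list_mat_def M_V_list_def)
  moreover have "list_mat M_V_comp_list $$ (i, j) = (M_V_comp_list ! i ! j = 1)"
    using ij by (simp add: list_mat_def M_V_comp_list_def)
  ultimately show "complement_mat (star_mat M_V) $$ (i, j) = list_mat M_V_comp_list $$ (i, j)" by simp
qed (simp_all add: complement_mat_def star_M_V M_V_list_def M_V_comp_list_def list_mat_def)

lemma A_RowCol_length: "w \<in> A_RowCol \<Longrightarrow> 4 \<le> length w \<and> length w \<le> 6"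
  unfolding A_RowCol_def by auto

text \<open>The starred cycles and their complements belong to the constant words, so that all
  members except the two from \<open>M_V\<close> have one form.\<close>

lemma F_RowCol_eq: "F_RowCol = {cyc_mat k (\<lambda>_. c) | k c. 3 \<le> k} \<union> {cyc_mat (length w) (word_of w) | w. w \<in> A_RowCol} \<union>
  {list_mat M_V_list, list_mat M_V_comp_list}"
proof -
  have "(\<Union>k\<in>{3..}. {star_mat (M_I k), complement_mat (star_mat (M_I k))}) = {cyc_mat k (\<lambda>_. c) | k c. 3 \<le> k}" (is "?l = ?r")
  proof
    show "?l \<subseteq> ?r" using star_M_I complement_star_M_I by auto
    show "?r \<subseteq> ?l"
    proof
      fix N assume "N \<in> ?r"
      then obtain k c where "N = cyc_mat k (\<lambda>_. c)" "3 \<le> k" by blast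
      then have "3 \<le> k" "N \<in> {star_mat (M_I k), complement_mat (star_mat (M_I k))}"
        using star_M_I[of k] complement_star_M_I[of k] by (cases c; simp)+
      then show "N \<in> ?l" by blast
    qed
  qed
  moreover have "{a \<odot> star_mat (M_I (length a)) | a. a \<in> A_RowCol} = {cyc_mat (length w) (word_of w) | w. w \<in> A_RowCol}"
  proof -
    have "w \<odot> star_mat (M_I (length w)) = cyc_mat (length w) (word_of w)" if "w \<in> A_RowCol" for w
      using complement_rows_star_M_I A_RowCol_length[OF that] by simp
    then show ?thesis by (metis (no_types, lifting))
  qed
  ultimately show ?thesis unfolding F_RowCol_def complement_star_M_V unfolding star_M_V by (simp only:)
qed

lemma dim_cyc_mat [simp]: "dim_row (cyc_mat n a) = n" "dim_col (cyc_mat n a) = Suc n"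
  by (simp_all add: cyc_mat_def)

lemma cyc_mat_entry: "i < n \<Longrightarrow> j < Suc n \<Longrightarrow> cyc_mat n a $$ (i, j) = cyc_entry n a i j"
  by (simp add: cyc_mat_def)

lemma dim_list_mat [simp]: "dim_row (list_mat N) = length N" "dim_col (list_mat N) = length (hd N)"
  by (simp_all add: list_mat_def)

lemma list_mat_entry: "i < length N \<Longrightarrow> j < length (hd N) \<Longrightarrow> list_mat N $$ (i, j) = (N ! i ! j = 1)"
  by (simp add: list_mat_def)

definition cyc_list :: "nat list list \<Rightarrow> nat \<Rightarrow> (nat \<Rightarrow> bool) \<Rightarrow> bool" where
  "cyc_list N n a \<longleftrightarrow> length N = n \<and> length (hd N) = Suc n \<and>
     list_all (\<lambda>i. list_all (\<lambda>j. (N ! i ! j = 1) = cyc_entry n a i j) [0..<Suc n]) [0..<n]"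

definition cyc_list_transposed :: "nat list list \<Rightarrow> nat \<Rightarrow> (nat \<Rightarrow> bool) \<Rightarrow> bool" where
  "cyc_list_transposed N n a \<longleftrightarrow> length N = Suc n \<and> length (hd N) = n \<and>
     list_all (\<lambda>i. list_all (\<lambda>j. (N ! i ! j = 1) = cyc_entry n a j i) [0..<n]) [0..<Suc n]"

lemma list_mat_eq_cyc_mat: "cyc_list N n a \<Longrightarrow> list_mat N = cyc_mat n a"
  by (rule eq_matI) (auto simp: cyc_list_def list_mat_entry cyc_mat_entry list_all_iff simp del: upt_Suc)

lemma list_mat_eq_transpose: "cyc_list_transposed N n a \<Longrightarrow> list_mat N = transpose_mat (cyc_mat n a)"
  by (rule eq_matI) (auto simp: cyc_list_transposed_def list_mat_entry cyc_mat_entry list_all_iff simp del: upt_Suc)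

text \<open>Recognises each matrix of the propositional check as a member of the family or a
  transpose; the transposes have four rows and three columns.\<close>

lemma small_checks:
  "list_all (\<lambda>N. cyc_list_transposed N 3 (\<lambda>_. False) \<or> cyc_list_transposed N 3 (\<lambda>_. True) \<or> cyc_list N 4 (\<lambda>_. False) \<or>
     cyc_list N 4 (\<lambda>_. True) \<or> list_ex (\<lambda>w. cyc_list N 4 (word_of w)) [[0,0,0,1],[0,0,1,1],[0,1,1,1]] \<or>
     N = M_V_list \<or> N = M_V_comp_list) small_four"
  "list_all (\<lambda>N. cyc_list N 3 (\<lambda>_. False) \<or> cyc_list N 3 (\<lambda>_. True)) small_three"
  by code_simp+

lemma cyc_mat_const_in_F: "3 \<le> k \<Longrightarrow> cyc_mat k (\<lambda>_. c) \<in> F_RowCol"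
  unfolding F_RowCol_eq by blast

lemma cyc_mat_word_in_F: "w \<in> A_RowCol \<Longrightarrow> cyc_mat (length w) (word_of w) \<in> F_RowCol"
  unfolding F_RowCol_eq by blast

lemma small_in_F:
  assumes "N \<in> set small_four \<union> set small_three"
  shows "list_mat N \<in> F_RowCol \<union> transpose_mat ` F_RowCol"
proof -
  have four: "cyc_mat 4 (word_of w) \<in> F_RowCol" if "w \<in> set [[0,0,0,1],[0,0,1,1],[0,1,1,1]]" for w
  proof -
    have "w \<in> A_RowCol" "length w = 4" using that unfolding A_RowCol_def by auto
    then show ?thesis using cyc_mat_word_in_F[of w] by simp
  qed
  have "cyc_list_transposed N 3 (\<lambda>_. False) \<or> cyc_list_transposed N 3 (\<lambda>_. True) \<or> cyc_list N 4 (\<lambda>_. False) \<or>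
     cyc_list N 4 (\<lambda>_. True) \<or> (\<exists>w\<in>set [[0,0,0,1],[0,0,1,1],[0,1,1,1]]. cyc_list N 4 (word_of w)) \<or>
     N = M_V_list \<or> N = M_V_comp_list \<or> cyc_list N 3 (\<lambda>_. False) \<or> cyc_list N 3 (\<lambda>_. True)"
    using assms bspec[OF small_checks(1)[unfolded list_all_iff list_ex_iff], of N]
      bspec[OF small_checks(2)[unfolded list_all_iff], of N] by blast
  then show ?thesis
  proof (elim disjE bexE)
    assume "cyc_list_transposed N 3 (\<lambda>_. False)"
    then show ?thesis using cyc_mat_const_in_F[of 3 False] by (simp add: list_mat_eq_transpose)
  next
    assume "cyc_list_transposed N 3 (\<lambda>_. True)"
    then show ?thesis using cyc_mat_const_in_F[of 3 True] by (simp add: list_mat_eq_transpose)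
  next
    fix w assume "w \<in> set [[0,0,0,1],[0,0,1,1],[0,1,1,1]]" "cyc_list N 4 (word_of w)"
    then show ?thesis using four[of w] by (simp add: list_mat_eq_cyc_mat)
  qed (use cyc_mat_const_in_F[of 3] cyc_mat_const_in_F[of 4] in \<open>auto simp: list_mat_eq_cyc_mat F_RowCol_eq\<close>)
qed

lemma embeds_fun_cong:
  "(\<And>i j. i < k \<Longrightarrow> j < l \<Longrightarrow> N i j = N' i j) \<Longrightarrow> embeds_fun k l N R X A \<Longrightarrow> embeds_fun k l N' R X A"
  unfolding embeds_fun_def by simp

lemma embeds_cyc_mat: "embeds_fun n (Suc n) (cyc_entry n a) R X A \<Longrightarrow>
    embeds_fun (dim_row (cyc_mat n a)) (dim_col (cyc_mat n a)) (\<lambda>i j. cyc_mat n a $$ (i, j)) R X A"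
  unfolding dim_cyc_mat by (rule embeds_fun_cong) (simp add: cyc_mat_entry)

lemma embeds_list_mat:
  assumes "embeds_list N R X A"
  shows "embeds_fun (dim_row (list_mat N)) (dim_col (list_mat N)) (\<lambda>i j. list_mat N $$ (i, j)) R X A"
  unfolding dim_list_mat
  by (rule embeds_fun_cong[OF _ assms[unfolded embeds_list_def]]) (simp add: list_mat_entry)

lemma noncirc_embeds:
  assumes nc: "\<not> circ {..<dim_row M} {..<dim_col M} (\<lambda>i j. M $$ (i, j))"
  shows "\<exists>N\<in>F_RowCol \<union> transpose_mat ` F_RowCol. embeds_mat N M"
proof -
  have fin: "finite {..<dim_row M}" "finite {..<dim_col M}" by simp_all
  show ?thesis
  proof (rule noncirc_cases[OF fin nc])
    fix N assume "N \<in> set small_four \<union> set small_three" "embeds_list N {..<dim_row M} {..<dim_col M} (\<lambda>i j. M $$ (i, j))"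
    then show ?thesis using small_in_F embeds_list_mat by (intro bexI[of _ "list_mat N"])
  next
    fix n v g x0 \<mu>
    assume h: "5 \<le> n" "inj_on v {..<n}" "v ` {..<n} \<subseteq> {..<dim_row M}" "x0 \<in> {..<dim_col M}" "g ` {..<n} \<subseteq> {..<dim_col M}"
      "\<And>i. i < n \<Longrightarrow> M $$ (v i, x0) \<noteq> \<mu> i"
      "\<And>i j. i < n \<Longrightarrow> j < n \<Longrightarrow> M $$ (v i, g j) = \<mu> i \<longleftrightarrow> j = i \<or> j = Suc i mod n"
    have "M $$ (v i, x0) = (\<not> \<mu> i)" if "i < n" for i using h(6)[OF that] by blast
    moreover have "M $$ (v i, g j) = ((\<not> \<mu> i) \<noteq> (j = i \<or> j = Suc i mod n))" if "i < n" "j < n" for i j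
      using h(7)[OF that] by blast
    ultimately have "cyc_config n v g x0 (\<lambda>i. \<not> \<mu> i) {..<dim_row M} {..<dim_col M} (\<lambda>i j. M $$ (i, j))"
      unfolding cyc_config_def using h(2-5) by simp
    from cyc_config_cases[OF h(1) this] show ?thesis
    proof (elim disjE bexE)
      fix N assume "N \<in> set small_four" "embeds_list N {..<dim_row M} {..<dim_col M} (\<lambda>i j. M $$ (i, j))"
      then show ?thesis using small_in_F[of N] embeds_list_mat by (intro bexI[of _ "list_mat N"]) auto
    next
      assume "embeds_fun n (Suc n) (cyc_entry n (\<lambda>_. False)) {..<dim_row M} {..<dim_col M} (\<lambda>i j. M $$ (i, j))"
      from embeds_cyc_mat[OF this] show ?thesis
        by (rule bexI) (use cyc_mat_const_in_F h(1) in simp)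
    next
      assume "embeds_fun n (Suc n) (cyc_entry n (\<lambda>_. True)) {..<dim_row M} {..<dim_col M} (\<lambda>i j. M $$ (i, j))"
      from embeds_cyc_mat[OF this] show ?thesis
        by (rule bexI) (use cyc_mat_const_in_F h(1) in simp)
    next
      fix w assume w: "w \<in> {[0,0,0,0,1],[0,0,0,1,1],[0,0,1,1,1],[0,1,1,1,1],[0,0,0,1,1,1::nat]}"
        and e: "embeds_fun (length w) (Suc (length w)) (cyc_entry (length w) (word_of w))
          {..<dim_row M} {..<dim_col M} (\<lambda>i j. M $$ (i, j))"
      have "w \<in> A_RowCol" using w unfolding A_RowCol_def by blast
      from cyc_mat_word_in_F[OF this] embeds_cyc_mat[OF e] show ?thesis by (intro bexI) auto
    qed
  qed
qed

section \<open>Minimality of the forbidden matrices\<close>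

text \<open>The complement of an arc is an arc. This reduces questions about an arbitrary word to
  the constant word.\<close>

lemma circ_row_complement:
  assumes "circ R X A" and "\<And>i x. i \<in> R \<Longrightarrow> x \<in> X \<Longrightarrow> B i x = (A i x \<noteq> a i)"
  shows "circ R X B"
proof -
  obtain f where f: "inj_on f X" "\<And>i. i \<in> R \<Longrightarrow> alt_free f X (A i)" using assms(1) unfolding circ_def by blast
  show ?thesis
  proof (rule circ_by_order[OF f(1)])
    fix i assume i: "i \<in> R"
    have "alt_free f X (B i) \<longleftrightarrow> alt_free f X (\<lambda>x. A i x \<noteq> a i)" by (rule alt_free_cong) (rule assms(2)[OF i])
    also have "\<dots>" using f(2)[OF i] by (cases "a i") (simp_all add: alt_free_Not)
    finally show "alt_free f X (B i)" .
  qed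
qed

lemma cyc_entry_False: "cyc_entry n a i j = (cyc_entry n (\<lambda>_. False) i j \<noteq> a i)"
  unfolding cyc_entry_def by blast

text \<open>In a linear arrangement relative to \<open>x0\<close>, cyclically consecutive columns would be neighbours; the two cyclic
  neighbours of the first column cannot both follow it immediately.\<close>
lemma cyc_noncirc:
  assumes n: "3 \<le> n"
  shows "\<not> circ {..<n} {..<Suc n} (cyc_entry n a)"
proof
  assume c: "circ {..<n} {..<Suc n} (cyc_entry n a)"
  have c0: "circ {..<n} {..<Suc n} (cyc_entry n (\<lambda>_. False))"
    by (rule circ_row_complement[OF c, of _ a]) (subst (2) cyc_entry_False, blast)
  let ?S = "differ_set {..<Suc n} (cyc_entry n (\<lambda>_. False)) n"
  obtain f where f: "lin ?S {..<n} {..<Suc n} f" using circ_imp_lin[OF c0, of n] by auto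
  have S: "?S i = {i, Suc i mod n}" if "i < n" for i
  proof -
    have "Suc i mod n < Suc n" using n mod_less_divisor[of n "Suc i"] by linarith
    then show ?thesis using that n unfolding differ_set_def cyc_entry_def by auto
  qed
  have "Min (f ` {..<n}) \<in> f ` {..<n}" by (rule Min_in) (use n in \<open>simp_all add: lessThan_empty_iff\<close>)
  then obtain m where "m \<in> {..<n}" "f m = Min (f ` {..<n})" by auto
  then have m: "m \<in> {..<n}" "\<And>j. j \<in> {..<n} \<Longrightarrow> f m \<le> f j" by auto
  define u where "u = Suc m mod n"
  define p where "p = (if m = 0 then n - 1 else m - 1)"
  have lt: "m < n" "u < n" "p < n" using m n unfolding u_def p_def by auto
  have up: "m = Suc p mod n" using lt n unfolding p_def by auto
  have ne: "u \<noteq> m" "p \<noteq> m" "u \<noteq> p" using lt n unfolding u_def p_def by (cases "Suc m = n"; auto)+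
  have inj: "f x \<noteq> f y" if "x < n" "y < n" "x \<noteq> y" for x y
    using f inj_onD[of f "{..<Suc n}" x y] that unfolding lin_def by auto
  have fu: "f m < f u" and fp: "f m < f p" using m(2)[of u] m(2)[of p] inj[of m u] inj[of m p] lt ne by auto
  have cv: "convex_in f {..<Suc n} (?S i)" if "i < n" for i using f that unfolding lin_def by simp
  have c1: "convex_in f {..<Suc n} {m, u}" using cv[OF lt(1)] unfolding S[OF lt(1)] u_def .
  have c2: "convex_in f {..<Suc n} {p, m}" using cv[OF lt(3)] unfolding S[OF lt(3)] up[symmetric] .
  have "\<not> f p < f u" using convex_inD[OF c1, of m u p] fp ne lt by auto
  moreover have "\<not> f u < f p" using convex_inD[OF c2, of m p u] fu ne lt by auto
  ultimately show False using inj[OF lt(2,3) ne(3)] by linarith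
qed

text \<open>Relative to the zero column 5 the arrangement is linear. Rows 1 and 3 overlap and
  separate the columns 1, 2 from 0, 3. Whichever of 1 and 2 lies farther out, the other one breaks
  row 0 or row 2.\<close>

lemma M_V_noncirc: "\<not> circ {..<4} {..<6} (\<lambda>i j. M_V_list ! i ! j = 1)"
proof
  assume c: "circ {..<4} {..<6} (\<lambda>i j. M_V_list ! i ! j = 1)"
  let ?S = "differ_set {..<6} (\<lambda>i j. M_V_list ! i ! j = 1) 5"
  obtain f where f: "lin ?S {..<4} {..<6} f" using circ_imp_lin[OF c, of 5] by auto
  have six: "{..<6::nat} = {0, 1, 2, 3, 4, 5}" by auto
  have S: "?S 0 = {0, 1}" "?S 1 = {0, 1, 2, 3}" "?S 2 = {2, 3}" "?S 3 = {0, 3, 4}"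
    unfolding differ_set_def six M_V_list_def by auto
  have main: False if f: "lin ?S {..<4} {..<6} f" and l: "f 1 < f 0" for f
  proof -
    have inj: "inj_on f {..<6}" and cv: "\<And>i. i < 4 \<Longrightarrow> convex_in f {..<6} (?S i)" using f unfolding lin_def by auto
    have c0: "convex_in f {..<6} {0, 1}" using cv[of 0] unfolding S by simp
    have c1: "convex_in f {..<6} {0, 1, 2, 3}" using cv[of 1] unfolding S by simp
    have c2: "convex_in f {..<6} {2, 3}" using cv[of 2] unfolding S by simp
    have c3: "convex_in f {..<6} {0, 3, 4}" using cv[of 3] unfolding S by simp
    have ov: "overlap {0, 1, 2, 3} {0, 3, 4::nat}" unfolding overlap_def by auto
    have o: "f p < f q" if "p \<in> {1, 2}" "q \<in> {0, 3}" for p q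
      by (rule overlap_order(2)[OF c1 c3 _ _ inj ov _ _ l]) (use that in auto)
    have "f 1 \<noteq> f 2" using inj_onD[OF inj, of 1 2] by auto
    then consider "f 1 < f 2" | "f 2 < f 1" by linarith
    then show False
    proof cases
      case 1 then show False using convex_inD[OF c0, of 1 0 2] o[of 2 0] by auto
    next
      case 2 then show False using convex_inD[OF c2, of 2 3 1] o[of 1 3] by auto
    qed
  qed
  have "f 1 \<noteq> f 0" using f inj_onD[of f "{..<6}" 1 0] unfolding lin_def by auto
  then show False using main[OF f] main[OF lin_neg[OF f]] by linarith
qed

lemma M_V_comp_entry: "i < 4 \<Longrightarrow> j < 6 \<Longrightarrow> (M_V_comp_list ! i ! j = 1) = ((M_V_list ! i ! j = 1) \<noteq> True)"
proof -
  have "\<forall>i<4. \<forall>j<6. (M_V_comp_list ! i ! j = 1) = ((M_V_list ! i ! j = 1) \<noteq> True)"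
    unfolding all_less_4 all_less_6 M_V_list_def M_V_comp_list_def by simp
  then show "i < 4 \<Longrightarrow> j < 6 \<Longrightarrow> ?thesis" by blast
qed

text \<open>Position of column \<open>j\<close> when the cycle is cut at row \<open>r\<close>; the zero column \<open>n\<close> comes last.\<close>
definition after :: "nat \<Rightarrow> nat \<Rightarrow> nat \<Rightarrow> int" where
  "after n r j = (if j = n then int n else if r < j then int j - int r - 1 else int j + int n - int r - 1)"

lemma after_next: "i < n \<Longrightarrow> r < n \<Longrightarrow> i \<noteq> r \<Longrightarrow> after n r (Suc i mod n) = after n r i + 1"
  unfolding after_def by (cases "Suc i = n") auto

lemma after_inj: "r < n \<Longrightarrow> inj_on (after n r) {..<Suc n}"
  unfolding after_def by (rule inj_onI) (auto split: if_splits)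

lemma after_row:
  assumes "i < n" "r < n" "i \<noteq> r" "X \<subseteq> {..<Suc n}"
  shows "alt_free (after n r) X (cyc_entry n (\<lambda>_. False) i)"
proof (rule alt_free_interval[of _ _ "after n r i" _ "after n r i + 1"])
  fix j assume "j \<in> X"
  then have j: "j < Suc n" using assms(4) by auto
  have nx: "Suc i mod n < n" using assms(1) by simp
  have inj: "after n r j = after n r k \<longleftrightarrow> j = k" if "k < n" for k
    using inj_on_eq_iff[OF after_inj[OF assms(2)], of j k] j that by auto
  have "after n r i \<le> after n r j \<and> after n r j \<le> after n r i + 1 \<longleftrightarrow> after n r j = after n r i \<or>
    after n r j = after n r (Suc i mod n)"
    unfolding after_next[OF assms(1-3)] by linarith
  also have "\<dots> \<longleftrightarrow> j = i \<or> j = Suc i mod n" using inj[OF assms(1)] inj[OF nx] by blast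
  also have "\<dots> \<longleftrightarrow> cyc_entry n (\<lambda>_. False) i j" using assms(1) nx unfolding cyc_entry_def by auto
  finally show "cyc_entry n (\<lambda>_. False) i j \<longleftrightarrow> after n r i \<le> after n r j \<and> after n r j \<le> after n r i + 1" by blast
qed

text \<open>Without row \<open>r\<close> the cycle can be cut between the two columns of that
  row.\<close>

lemma cyc_circ_delete_row:
  assumes "r < n"
  shows "circ ({..<n} - {r}) {..<Suc n} (cyc_entry n a)"
proof (rule circ_row_complement[of _ _ "cyc_entry n (\<lambda>_. False)"])
  show "circ ({..<n} - {r}) {..<Suc n} (cyc_entry n (\<lambda>_. False))"
    by (rule circ_by_order[OF after_inj[OF assms]]) (auto intro!: after_row assms)
qed (rule cyc_entry_False)

lemma cyc_circ_delete_column: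
  assumes n: "3 \<le> n" and c: "c < Suc n"
  shows "circ {..<n} ({..<Suc n} - {c}) (cyc_entry n a)"
proof (rule circ_row_complement[of _ _ "cyc_entry n (\<lambda>_. False)"])
  show "circ {..<n} ({..<Suc n} - {c}) (cyc_entry n (\<lambda>_. False))"
  proof (cases "c = n")
    case True
    have X: "{..<Suc n} - {c} = {..<n}" using True by auto
    show ?thesis unfolding X
    proof (rule circ_by_order[of int])
      fix i assume i: "i \<in> {..<n}"
      show "alt_free int {..<n} (cyc_entry n (\<lambda>_. False) i)"
      proof (cases "Suc i = n")
        case False
        then show ?thesis using i by (intro alt_free_interval[of _ _ "int i" _ "int i + 1"]) (auto simp: cyc_entry_def)
      next
        case True
        \<comment> \<open>The last row has its ones at both ends, so its complement is an
          interval.\<close>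
        have "alt_free int {..<n} (\<lambda>j. \<not> cyc_entry n (\<lambda>_. False) i j)"
          using True n by (intro alt_free_interval[of _ _ 1 _ "int n - 2"]) (auto simp: cyc_entry_def)
        then show ?thesis unfolding alt_free_Not .
      qed
    qed simp
  next
    case False
    then have c': "c < n" using c by simp
    show ?thesis
    proof (rule circ_by_order[of "after n c"])
      show "inj_on (after n c) ({..<Suc n} - {c})" using after_inj[OF c'] by (rule inj_on_subset) auto
      fix i assume i: "i \<in> {..<n}"
      show "alt_free (after n c) ({..<Suc n} - {c}) (cyc_entry n (\<lambda>_. False) i)"
      proof (cases "i = c")
        case True
        \<comment> \<open>Row \<open>c\<close> keeps only the column right after the cut, at
          position 0.\<close>
        show ?thesis
          by (rule alt_free_interval[of _ _ 0 _ 0]) (use True c' n in \<open>auto simp: cyc_entry_def after_def mod_Suc\<close>)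
      next
        case False
        then show ?thesis using i c' by (intro after_row) auto
      qed
    qed
  qed
qed (rule cyc_entry_False)

text \<open>The natural order of the rows works: column \<open>j\<close> meets rows
  \<open>j - 1\<close> and \<open>j\<close>, and column 0 the first and the last row.\<close>

lemma cyc_circ_transposed:
  assumes n: "3 \<le> n"
  shows "circ {..<Suc n} {..<n} (\<lambda>j i. cyc_entry n (\<lambda>_. c) i j)"
proof (rule circ_row_complement[of _ _ "\<lambda>j i. cyc_entry n (\<lambda>_. False) i j"])
  show "circ {..<Suc n} {..<n} (\<lambda>j i. cyc_entry n (\<lambda>_. False) i j)"
  proof (rule circ_by_order[of int])
    fix j assume j: "j \<in> {..<Suc n}"
    consider "j = n" | "j = 0" | "0 < j" "j < n" using j by fastforce
    then show "alt_free int {..<n} (\<lambda>i. cyc_entry n (\<lambda>_. False) i j)"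
    proof cases
      case 1 then show ?thesis by (intro alt_free_interval[of _ _ 1 _ 0]) (auto simp: cyc_entry_def)
    next
      case 2
      have "alt_free int {..<n} (\<lambda>i. \<not> cyc_entry n (\<lambda>_. False) i j)"
        by (rule alt_free_interval[of _ _ 1 _ "int n - 2"]) (use 2 n in \<open>auto simp: cyc_entry_def mod_Suc split: if_splits\<close>)
      then show ?thesis unfolding alt_free_Not .
    next
      case 3
      then show ?thesis
        by (intro alt_free_interval[of _ _ "int j - 1" _ "int j"]) (auto simp: cyc_entry_def mod_Suc split: if_splits)
    qed
  qed simp
qed (rule cyc_entry_False)

lemma circ_by_list:
  assumes d: "distinct xs" and X: "X = set xs" and R: "\<And>i. i \<in> R \<Longrightarrow> length (remdups_adj (map (A i) xs)) \<le> 3"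
  shows "circ R X A"
proof -
  define f where "f x = int (LEAST k. k < length xs \<and> xs ! k = x)" for x
  have f: "\<exists>k<length xs. f x = int k \<and> xs ! k = x" if "x \<in> X" for x
  proof -
    have "\<exists>k. k < length xs \<and> xs ! k = x" using that unfolding X by (simp add: in_set_conv_nth)
    then have "(LEAST k. k < length xs \<and> xs ! k = x) < length xs \<and> xs ! (LEAST k. k < length xs \<and> xs ! k = x) = x"
      by (rule LeastI_ex)
    then show ?thesis unfolding f_def by blast
  qed
  show ?thesis
  proof (rule circ_by_order[of f])
    show "inj_on f X"
    proof (rule inj_onI)
      fix x y assume "x \<in> X" "y \<in> X" "f x = f y"
      then show "x = y" using f[of x] f[of y] by auto
    qed
    fix i assume i: "i \<in> R"
    show "alt_free f X (A i)"
      unfolding alt_free_def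
    proof (intro ballI impI, rule ccontr)
      fix x y z w assume h: "x \<in> X" "y \<in> X" "z \<in> X" "w \<in> X" "f x < f y" "f y < f z" "f z < f w"
        "A i x = A i z" "A i y = A i w" "A i x \<noteq> A i y"
      obtain a where a: "a < length xs" "f x = int a" "xs ! a = x" using f[OF h(1)] by blast
      obtain b where b: "b < length xs" "f y = int b" "xs ! b = y" using f[OF h(2)] by blast
      obtain c where c: "c < length xs" "f z = int c" "xs ! c = z" using f[OF h(3)] by blast
      obtain d where d: "d < length xs" "f w = int d" "xs ! d = w" using f[OF h(4)] by blast
      have "4 \<le> length (remdups_adj (map (A i) xs))"
        by (rule remdups_adj_four[of a b c d]) (use a b c d h(5-10) in auto)
      then show False using R[OF i] by linarith
    qed
  qed
qed

definition arcs_along :: "nat list \<Rightarrow> nat list \<Rightarrow> (nat \<Rightarrow> nat \<Rightarrow> bool) \<Rightarrow> bool" where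
  "arcs_along rs xs A \<longleftrightarrow> distinct xs \<and> list_all (\<lambda>i. length (remdups_adj (map (A i) xs)) \<le> 3) rs"

lemma circ_by_arcs_along: "arcs_along rs xs A \<Longrightarrow> R = set rs \<Longrightarrow> X = set xs \<Longrightarrow> circ R X A"
  unfolding arcs_along_def by (auto intro!: circ_by_list simp: list_all_iff)

lemma A_RowCol_transposed:
  assumes "w \<in> A_RowCol"
  shows "circ {..<Suc (length w)} {..<length w} (\<lambda>j i. cyc_entry (length w) (word_of w) i j)"
proof -
  \<comment> \<open>Each word is paired with an order of the rows in which every column is an
    arc.\<close>
  have c: "list_all (\<lambda>(w, xs). set xs = set [0..<length w] \<and>
    arcs_along [0..<Suc (length w)] xs (\<lambda>j i. cyc_entry (length w) (word_of w) i j))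
    [([0,0,0,1], [0,1,2,3]), ([0,0,1,1], [0,1,3,2]), ([0,1,1,1], [0,1,2,3]),
     ([0,0,0,0,1], [0,1,4,2,3]), ([0,0,0,1,1], [0,1,2,4,3]), ([0,0,1,1,1], [0,1,4,3,2]), ([0,1,1,1,1], [0,2,1,4,3]),
     ([0,0,0,1,1,1], [0,1,2,5,4,3])]"
    by code_simp
  have "\<exists>xs. set xs = set [0..<length w] \<and> arcs_along [0..<Suc (length w)] xs (\<lambda>j i. cyc_entry (length w) (word_of w) i j)"
    using assms c unfolding A_RowCol_def list.pred_inject prod.case by (elim insertE emptyE) blast+
  then obtain xs where xs: "set xs = set [0..<length w]"
    "arcs_along [0..<Suc (length w)] xs (\<lambda>j i. cyc_entry (length w) (word_of w) i j)" by blast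
  show ?thesis by (rule circ_by_arcs_along[OF xs(2)]) (simp_all only: xs(1) set_upt lessThan_atLeast0)
qed

lemma M_V_transposed: "circ {..<6} {..<4} (\<lambda>j i. M_V_list ! i ! j = 1)"
  by (rule circ_by_arcs_along[of "[0..<6]" "[0..<4]"]) (code_simp, simp_all only: set_upt lessThan_atLeast0)

lemma M_V_delete_row:
  assumes "r < 4"
  shows "circ ({..<4} - {r}) {..<6} (\<lambda>i j. M_V_list ! i ! j = 1)"
proof -
  \<comment> \<open>Each deleted row is paired with an order of the columns that serves for the
    remaining rows.\<close>
  have "list_all (\<lambda>(r, xs). set xs = set [0..<6] \<and> arcs_along (filter (\<lambda>i. i \<noteq> r) [0..<4]) xs (\<lambda>i j. M_V_list ! i ! j = 1))
    [(0, [0,3,2,1,5,4]), (1, [0,1,5,2,3,4]), (2, [0,1,2,5,4,3]), (3, [0,1,2,3,4,5])]" by code_simp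
  moreover have "r = 0 \<or> r = 1 \<or> r = 2 \<or> r = 3" using assms by linarith
  ultimately obtain xs where xs: "set xs = set [0..<6]"
    "arcs_along (filter (\<lambda>i. i \<noteq> r) [0..<4]) xs (\<lambda>i j. M_V_list ! i ! j = 1)"
    unfolding list.pred_inject prod.case by blast
  have "{..<4} - {r} = set (filter (\<lambda>i. i \<noteq> r) [0..<4])" "{..<6} = set xs" unfolding xs(1) by auto
  then show ?thesis by (rule circ_by_arcs_along[OF xs(2)])
qed

lemma M_V_delete_column:
  assumes "c < 6"
  shows "circ {..<4} ({..<6} - {c}) (\<lambda>i j. M_V_list ! i ! j = 1)"
proof -
  have "list_all (\<lambda>(c, xs). set xs = set (filter (\<lambda>i. i \<noteq> c) [0..<6]) \<and> arcs_along [0..<4] xs (\<lambda>i j. M_V_list ! i ! j = 1))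
    [(0, [1,2,3,4,5]), (1, [0,3,2,5,4]), (2, [0,1,5,4,3]), (3, [0,1,2,5,4]), (4, [0,1,5,2,3]), (5,
      [0,1,2,3,4])]" by code_simp
  moreover have "c = 0 \<or> c = 1 \<or> c = 2 \<or> c = 3 \<or> c = 4 \<or> c = 5" using assms by linarith
  ultimately obtain xs where xs: "set xs = set (filter (\<lambda>i. i \<noteq> c) [0..<6])"
    "arcs_along [0..<4] xs (\<lambda>i j. M_V_list ! i ! j = 1)"
    unfolding list.pred_inject prod.case by blast
  have "{..<4::nat} = set [0..<4]" "{..<6} - {c} = set xs" unfolding xs(1) by auto
  then show ?thesis by (rule circ_by_arcs_along[OF xs(2)])
qed

section \<open>From single deletions to all submatrices\<close>

lemma pick_full:
  assumes "\<And>a. a < n \<Longrightarrow> a \<in> I" "i < n"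
  shows "pick I i = i"
proof -
  have "{a\<in>I. a < i} = {..<i}" using assms by auto
  then show ?thesis using pick_card_in_set[of i I] assms by simp
qed

text \<open>A submatrix different from \<open>N\<close> lacks a row or a column of \<open>N\<close>,
  and arrangements restrict to submatrices, so single deletions suffice for the row property. The
  column property is inherited from \<open>N\<close> itself.\<close>

lemma minimal_forbidden_if:
  assumes nc: "\<not> circ {..<dim_row N} {..<dim_col N} (\<lambda>i j. N $$ (i, j))"
    and cols: "circ {..<dim_col N} {..<dim_row N} (\<lambda>j i. N $$ (i, j))"
    and row: "\<And>r. r < dim_row N \<Longrightarrow> circ ({..<dim_row N} - {r}) {..<dim_col N} (\<lambda>i j. N $$ (i, j))"
    and col: "\<And>c. c < dim_col N \<Longrightarrow> circ {..<dim_row N} ({..<dim_col N} - {c}) (\<lambda>i j. N $$ (i, j))"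
  shows "minimal_forbidden_submatrix circular_ones_rows_cols N"
  unfolding minimal_forbidden_submatrix_def
proof (intro conjI allI impI)
  show "\<not> circular_ones_rows_cols N" unfolding circular_ones_rows_cols_iff using nc by blast
  fix I J assume ne: "submatrix N I J \<noteq> N"
  let ?S = "submatrix N I J"
  have dr: "dim_row ?S = card {i. i < dim_row N \<and> i \<in> I}" and dc: "dim_col ?S = card {j. j < dim_col N \<and> j \<in> J}"
    by (simp_all add: dim_submatrix)
  have e: "?S $$ (i, j) = N $$ (pick I i, pick J j)" if "i < dim_row ?S" "j < dim_col ?S" for i j
    by (rule submatrix_index) (use that dr dc in auto)
  have pr: "pick I i \<in> I" "pick I i < dim_row N" if "i < dim_row ?S" for i using pick_less[of i "dim_row N" I] that dr
    by auto
  have pc: "pick J i \<in> J" "pick J i < dim_col N" if "i < dim_col ?S" for i using pick_less[of i "dim_col N" J] that dc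
    by auto
  have ir: "inj_on (pick I) {..<dim_row ?S}" by (rule inj_onI) (use pick_inj dr in auto)
  have ic: "inj_on (pick J) {..<dim_col ?S}" by (rule inj_onI) (use pick_inj dc in auto)
  have "circ {..<dim_col ?S} {..<dim_row ?S} (\<lambda>j i. ?S $$ (i, j))"
    by (rule circ_transfer[OF cols _ ir]) (use pr pc e in auto)
  moreover have "circ {..<dim_row ?S} {..<dim_col ?S} (\<lambda>i j. ?S $$ (i, j))"
  proof (cases "(\<exists>r<dim_row N. r \<notin> I) \<or> (\<exists>c<dim_col N. c \<notin> J)")
    case True
    then show ?thesis
    proof (elim disjE exE conjE)
      fix r assume r: "r < dim_row N" "r \<notin> I"
      have sub: "pick I ` {..<dim_row ?S} \<subseteq> {..<dim_row N} - {r}" using pr r by auto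
      show ?thesis by (rule circ_transfer[OF row[OF r(1)] sub ic]) (use pc e in auto)
    next
      fix c assume c: "c < dim_col N" "c \<notin> J"
      have sub: "pick J ` {..<dim_col ?S} \<subseteq> {..<dim_col N} - {c}" using pc c by auto
      show ?thesis by (rule circ_transfer[OF col[OF c(1)] _ ic sub]) (use pr e in auto)
    qed
  next
    case False
    then have full: "{i. i < dim_row N \<and> i \<in> I} = {..<dim_row N}" "{j. j < dim_col N \<and> j \<in> J} = {..<dim_col N}" by auto
    have d: "dim_row ?S = dim_row N" "dim_col ?S = dim_col N" unfolding dr dc full by simp_all
    have "?S = N"
    proof (rule eq_matI)
      fix i j assume "i < dim_row N" "j < dim_col N"
      then show "?S $$ (i, j) = N $$ (i, j)" using e[of i j] d pick_full[of "dim_row N" I i] pick_full[of "dim_col N"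
        J j] False by simp
    qed (use d in auto)
    then show ?thesis using ne by contradiction
  qed
  ultimately show "circular_ones_rows_cols ?S" unfolding circular_ones_rows_cols_iff by blast
qed

lemma circular_ones_rows_cols_transpose: "circular_ones_rows_cols (transpose_mat M) \<longleftrightarrow> circular_ones_rows_cols M"
  unfolding circular_ones_rows_cols_def circular_ones_cols_def by auto

lemma submatrix_transpose: "submatrix (transpose_mat N) I J = transpose_mat (submatrix N J I)"
proof (rule eq_matI)
  fix i j assume "i < dim_row (transpose_mat (submatrix N J I))" "j < dim_col (transpose_mat (submatrix N J I))"
  then have ij: "i < card {i. i < dim_col N \<and> i \<in> I}" "j < card {j. j < dim_row N \<and> j \<in> J}" by (simp_all add: dim_submatrix)
  have "pick I i < dim_col N" "pick J j < dim_row N" using pick_less(2)[OF ij(1)] pick_less(2)[OF ij(2)] .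
  then show "submatrix (transpose_mat N) I J $$ (i, j) = transpose_mat (submatrix N J I) $$ (i, j)"
    using ij by (simp add: submatrix_index dim_submatrix)
qed (simp_all add: dim_submatrix)

lemma minimal_forbidden_transpose:
  assumes "minimal_forbidden_submatrix circular_ones_rows_cols N"
  shows "minimal_forbidden_submatrix circular_ones_rows_cols (transpose_mat N)"
  unfolding minimal_forbidden_submatrix_def
proof (intro conjI allI impI)
  show "\<not> circular_ones_rows_cols (transpose_mat N)"
    using assms unfolding minimal_forbidden_submatrix_def circular_ones_rows_cols_transpose by blast
  fix I J assume "submatrix (transpose_mat N) I J \<noteq> transpose_mat N"
  then have "submatrix N J I \<noteq> N" unfolding submatrix_transpose by auto
  then show "circular_ones_rows_cols (submatrix (transpose_mat N) I J)"
    using assms unfolding minimal_forbidden_submatrix_def submatrix_transpose circular_ones_rows_cols_transpose by blast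
qed

lemma cyc_mat_minimal:
  assumes n: "3 \<le> n" and t: "circ {..<Suc n} {..<n} (\<lambda>j i. cyc_entry n a i j)"
  shows "minimal_forbidden_submatrix circular_ones_rows_cols (cyc_mat n a)"
proof (rule minimal_forbidden_if)
  have tr: "circ R X (\<lambda>i j. cyc_mat n a $$ (i, j)) \<longleftrightarrow> circ R X (cyc_entry n a)" if "R \<subseteq> {..<n}" "X \<subseteq> {..<Suc n}" for R X
  proof
    have e: "cyc_mat n a $$ (i, j) = cyc_entry n a i j" if "i \<in> R" "j \<in> X" for i j
      using that \<open>R \<subseteq> _\<close> \<open>X \<subseteq> _\<close> by (intro cyc_mat_entry) auto
    show "circ R X (cyc_entry n a)" if "circ R X (\<lambda>i j. cyc_mat n a $$ (i, j))"
      by (rule circ_transfer[OF that, of id _ id]) (use e in auto)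
    show "circ R X (\<lambda>i j. cyc_mat n a $$ (i, j))" if "circ R X (cyc_entry n a)"
      by (rule circ_transfer[OF that, of id _ id]) (use e in auto)
  qed
  show "\<not> circ {..<dim_row (cyc_mat n a)} {..<dim_col (cyc_mat n a)} (\<lambda>i j. cyc_mat n a $$ (i, j))"
    unfolding dim_cyc_mat by (subst tr) (use cyc_noncirc[OF n] in auto)
  show "circ ({..<dim_row (cyc_mat n a)} - {r}) {..<dim_col (cyc_mat n a)} (\<lambda>i j. cyc_mat n a $$ (i, j))"
    if "r < dim_row (cyc_mat n a)" for r
    unfolding dim_cyc_mat by (subst tr) (use cyc_circ_delete_row[of r n a] that in auto)
  show "circ {..<dim_row (cyc_mat n a)} ({..<dim_col (cyc_mat n a)} - {c}) (\<lambda>i j. cyc_mat n a $$ (i, j))"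
    if "c < dim_col (cyc_mat n a)" for c
    unfolding dim_cyc_mat by (subst tr) (use cyc_circ_delete_column[OF n, of c a] that in auto)
  show "circ {..<dim_col (cyc_mat n a)} {..<dim_row (cyc_mat n a)} (\<lambda>j i. cyc_mat n a $$ (i, j))"
    unfolding dim_cyc_mat by (rule circ_transfer[OF t, of id _ id]) (auto simp: cyc_mat_entry)
qed

lemma M_V_minimal: "minimal_forbidden_submatrix circular_ones_rows_cols (list_mat M_V_list)"
  "minimal_forbidden_submatrix circular_ones_rows_cols (list_mat M_V_comp_list)"
proof -
  have d: "dim_row (list_mat M_V_list) = 4" "dim_col (list_mat M_V_list) = 6" by (simp_all add: M_V_list_def)
  have d': "dim_row (list_mat M_V_comp_list) = 4" "dim_col (list_mat M_V_comp_list) = 6" by (simp_all add: M_V_comp_list_def)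
  have e: "list_mat M_V_list $$ (i, j) = ((M_V_list ! i ! j = 1) \<noteq> False)" if "i < 4" "j < 6" for i j
    using that d by (simp add: list_mat_def)
  have e': "list_mat M_V_comp_list $$ (i, j) = ((M_V_list ! i ! j = 1) \<noteq> True)" if "i < 4" "j < 6" for i j
    using that d' M_V_comp_entry[OF that] by (simp add: list_mat_def)
  have min: "minimal_forbidden_submatrix circular_ones_rows_cols N"
    if N: "dim_row N = 4" "dim_col N = 6" and E: "\<And>i j. i < 4 \<Longrightarrow> j < 6 \<Longrightarrow> N $$ (i, j) = ((M_V_list ! i ! j = 1) \<noteq> c)" for N c
  proof (rule minimal_forbidden_if; (unfold N)?)
    show "\<not> circ {..<4} {..<6} (\<lambda>i j. N $$ (i, j))"
    proof
      assume n: "circ {..<4} {..<6} (\<lambda>i j. N $$ (i, j))"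
      have "circ {..<4} {..<6} (\<lambda>i j. M_V_list ! i ! j = 1)"
        by (rule circ_row_complement[OF n, of _ "\<lambda>_. c"]) (use E in auto)
      then show False using M_V_noncirc by contradiction
    qed
    show "circ {..<6} {..<4} (\<lambda>j i. N $$ (i, j))"
      by (rule circ_row_complement[OF M_V_transposed, of _ "\<lambda>_. c"]) (use E in auto)
    show "circ ({..<4} - {r}) {..<6} (\<lambda>i j. N $$ (i, j))" if "r < 4" for r
      by (rule circ_row_complement[OF M_V_delete_row[OF that], of _ "\<lambda>_. c"]) (use E in auto)
    show "circ {..<4} ({..<6} - {k}) (\<lambda>i j. N $$ (i, j))" if "k < 6" for k
      by (rule circ_row_complement[OF M_V_delete_column[OF that], of _ "\<lambda>_. c"]) (use E in auto)
  qed
  show "minimal_forbidden_submatrix circular_ones_rows_cols (list_mat M_V_list)" by (rule min[OF d e])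
  show "minimal_forbidden_submatrix circular_ones_rows_cols (list_mat M_V_comp_list)" by (rule min[OF d' e'])
qed

lemma F_RowCol_minimal:
  assumes "N \<in> F_RowCol \<union> transpose_mat ` F_RowCol"
  shows "minimal_forbidden_submatrix circular_ones_rows_cols N"
proof -
  have F: "minimal_forbidden_submatrix circular_ones_rows_cols N" if N: "N \<in> F_RowCol" for N
  proof -
    from N consider k c where "3 \<le> k" "N = cyc_mat k (\<lambda>_. c)" | w where "w \<in> A_RowCol" "N = cyc_mat (length w) (word_of w)"
      | "N = list_mat M_V_list" | "N = list_mat M_V_comp_list" unfolding F_RowCol_eq by blast
    then show ?thesis
    proof cases
      case 1 then show ?thesis using cyc_mat_minimal[OF _ cyc_circ_transposed] by simp
    next
      case 2
      then have "3 \<le> length w" using A_RowCol_length[of w] by simp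
      then show ?thesis using cyc_mat_minimal[OF _ A_RowCol_transposed] 2 by simp
    qed (use M_V_minimal in simp_all)
  qed
  show ?thesis using assms
  proof
    assume "N \<in> transpose_mat ` F_RowCol"
    then obtain K where "K \<in> F_RowCol" "N = transpose_mat K" by blast
    then show ?thesis using minimal_forbidden_transpose[OF F] by simp
  qed (rule F)
qed

section \<open>Inequivalence of the forbidden matrices\<close>

lemma card_permutes:
  assumes "p permutes {..<n::nat}"
  shows "card {i. i < n \<and> P (p i)} = card {i. i < n \<and> P i}"
proof -
  have lt: "p i < n \<longleftrightarrow> i < n" for i using permutes_in_image[OF assms, of i] by simp
  have "p ` {i. i < n \<and> P (p i)} = {i. i < n \<and> P i}"
  proof
    show "p ` {i. i < n \<and> P (p i)} \<subseteq> {i. i < n \<and> P i}" using lt by auto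
    show "{i. i < n \<and> P i} \<subseteq> p ` {i. i < n \<and> P (p i)}"
    proof
      fix i assume i: "i \<in> {i. i < n \<and> P i}"
      have "p (Hilbert_Choice.inv p i) = i" using permutes_inverses(1)[OF assms] .
      then show "i \<in> p ` {i. i < n \<and> P (p i)}" using i lt[of "Hilbert_Choice.inv p i"]
        by (intro image_eqI[of _ _ "Hilbert_Choice.inv p i"]) auto
    qed
  qed
  moreover have "card (p ` {i. i < n \<and> P (p i)}) = card {i. i < n \<and> P (p i)}"
    by (rule card_image[OF inj_on_subset[OF permutes_inj[OF assms] subset_UNIV]])
  ultimately show ?thesis by (simp only:)
qed

text \<open>An invariant under permutations. From four rows on it counts the zeros of the word of a
  cycle matrix, since a complemented row has \<open>n - 1 \<ge> 3\<close> ones.\<close>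

definition rows_with_two :: "bool mat \<Rightarrow> nat" where
  "rows_with_two N = card {i. i < dim_row N \<and> card {j. j < dim_col N \<and> N $$ (i, j)} = 2}"

lemma eq_up_to_permE:
  assumes "eq_up_to_perm M N"
  obtains \<sigma> \<tau> where "\<sigma> permutes {..<dim_row N}" "\<tau> permutes {..<dim_col N}" "dim_row M = dim_row N" "dim_col M = dim_col N"
    "\<And>i j. i < dim_row N \<Longrightarrow> j < dim_col N \<Longrightarrow> N $$ (i, j) = M $$ (\<sigma> i, \<tau> j)"
  using assms unfolding eq_up_to_perm_def by auto

lemma rows_with_two_eq:
  assumes "eq_up_to_perm M N"
  shows "rows_with_two M = rows_with_two N"
proof -
  obtain \<sigma> \<tau> where p: "\<sigma> permutes {..<dim_row N}" "\<tau> permutes {..<dim_col N}" and d: "dim_row M = dim_row N"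
    "dim_col M = dim_col N"
    and N: "\<And>i j. i < dim_row N \<Longrightarrow> j < dim_col N \<Longrightarrow> N $$ (i, j) = M $$ (\<sigma> i, \<tau> j)"
    using eq_up_to_permE[OF assms] by metis
  have "card {j. j < dim_col N \<and> N $$ (i, j)} = card {j. j < dim_col N \<and> M $$ (\<sigma> i, j)}" if "i < dim_row N" for i
  proof -
    have "{j. j < dim_col N \<and> N $$ (i, j)} = {j. j < dim_col N \<and> M $$ (\<sigma> i, \<tau> j)}" using N that by auto
    then show ?thesis using card_permutes[OF p(2), of "\<lambda>j. M $$ (\<sigma> i, j)"] by simp
  qed
  then have "{i. i < dim_row N \<and> card {j. j < dim_col N \<and> N $$ (i, j)} = 2} =
      {i. i < dim_row N \<and> card {j. j < dim_col N \<and> M $$ (\<sigma> i, j)} = 2}" by auto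
  then have "rows_with_two N = card {i. i < dim_row N \<and> card {j. j < dim_col N \<and> M $$ (\<sigma> i, j)} = 2}"
    unfolding rows_with_two_def by (rule arg_cong)
  also have "\<dots> = card {i. i < dim_row N \<and> card {j. j < dim_col N \<and> M $$ (i, j)} = 2}"
    by (rule card_permutes[OF p(1)])
  also have "\<dots> = rows_with_two M" unfolding rows_with_two_def d ..
  finally show ?thesis ..
qed

lemma zero_column_eq:
  assumes "eq_up_to_perm M N"
  shows "(\<exists>j<dim_col M. \<forall>i<dim_row M. \<not> M $$ (i, j)) \<longleftrightarrow> (\<exists>j<dim_col N. \<forall>i<dim_row N. \<not> N $$ (i, j))"
proof -
  obtain \<sigma> \<tau> where p: "\<sigma> permutes {..<dim_row N}" "\<tau> permutes {..<dim_col N}" and d: "dim_row M = dim_row N"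
    "dim_col M = dim_col N"
    and N: "\<And>i j. i < dim_row N \<Longrightarrow> j < dim_col N \<Longrightarrow> N $$ (i, j) = M $$ (\<sigma> i, \<tau> j)"
    using eq_up_to_permE[OF assms] by metis
  have s: "\<sigma> i < dim_row N \<longleftrightarrow> i < dim_row N" and t: "\<tau> i < dim_col N \<longleftrightarrow> i < dim_col N" for i
    using permutes_in_image[OF p(1), of i] permutes_in_image[OF p(2), of i] by auto
  show ?thesis unfolding d
  proof
    assume "\<exists>j<dim_col N. \<forall>i<dim_row N. \<not> M $$ (i, j)"
    then obtain j where j: "j < dim_col N" "\<And>i. i < dim_row N \<Longrightarrow> \<not> M $$ (i, j)" by blast
    have tj: "\<tau> (Hilbert_Choice.inv \<tau> j) = j" using permutes_inverses(1)[OF p(2)] .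
    then have lt: "Hilbert_Choice.inv \<tau> j < dim_col N" using t j(1) by metis
    have "\<not> N $$ (i, Hilbert_Choice.inv \<tau> j)" if "i < dim_row N" for i
      using N[OF that lt] tj j(2)[of "\<sigma> i"] s that by simp
    then show "\<exists>j<dim_col N. \<forall>i<dim_row N. \<not> N $$ (i, j)" using lt by blast
  next
    assume "\<exists>j<dim_col N. \<forall>i<dim_row N. \<not> N $$ (i, j)"
    then obtain j where j: "j < dim_col N" "\<And>i. i < dim_row N \<Longrightarrow> \<not> N $$ (i, j)" by blast
    have "\<not> M $$ (i, \<tau> j)" if i: "i < dim_row N" for i
    proof -
      have si: "\<sigma> (Hilbert_Choice.inv \<sigma> i) = i" using permutes_inverses(1)[OF p(1)] .
      then have lt: "Hilbert_Choice.inv \<sigma> i < dim_row N" using s i by metis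
      show ?thesis using N[OF lt j(1)] si j(2)[OF lt] by simp
    qed
    then show "\<exists>j<dim_col N. \<forall>i<dim_row N. \<not> M $$ (i, j)" using t j(1) by blast
  qed
qed

lemma card_filter_upt: "card {i. i < n \<and> P i} = length (filter P [0..<n])"
proof -
  have "{i. i < n \<and> P i} = set (filter P [0..<n])" by auto
  then show ?thesis using distinct_card[of "filter P [0..<n]"] by simp
qed

lemma rows_with_two_cyc:
  assumes "4 \<le> n"
  shows "rows_with_two (cyc_mat n a) = length (filter (\<lambda>i. \<not> a i) [0..<n])"
proof -
  have "card {j. j < Suc n \<and> cyc_mat n a $$ (i, j)} = 2 \<longleftrightarrow> \<not> a i" if i: "i < n" for i
  proof -
    have nx: "Suc i mod n < n" "i \<noteq> Suc i mod n" using i assms by (auto simp: mod_Suc)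
    have e: "cyc_mat n a $$ (i, j) \<longleftrightarrow> a i \<noteq> (j \<in> {i, Suc i mod n})" if "j < Suc n" for j
      using cyc_mat_entry[OF i that, of a] nx i unfolding cyc_entry_def by auto
    show ?thesis
    proof (cases "a i")
      case False
      define k where "k = Suc i mod n"
      have "{j. j < Suc n \<and> cyc_mat n a $$ (i, j)} = {i, k}" using e False i nx unfolding k_def[symmetric] by auto
      then show ?thesis using nx(2) False k_def by simp
    next
      case True
      have "{j. j < Suc n \<and> cyc_mat n a $$ (i, j)} = {..<Suc n} - {i, Suc i mod n}" using e True by auto
      moreover have "card ({..<Suc n} - {i, Suc i mod n}) = Suc n - 2"
        using card_Diff_subset[of "{i, Suc i mod n}" "{..<Suc n}"] i nx(2) less_SucI[OF nx(1)] by simp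
      ultimately show ?thesis using True assms by simp
    qed
  qed
  then have "{i. i < n \<and> card {j. j < Suc n \<and> cyc_mat n a $$ (i, j)} = 2} = {i. i < n \<and> \<not> a i}" by auto
  then show ?thesis unfolding rows_with_two_def dim_cyc_mat using card_filter_upt[of n "\<lambda>i. \<not> a i"] by simp
qed

lemma rows_with_two_list: "rows_with_two (list_mat N) =
    length (filter (\<lambda>i. length (filter (\<lambda>j. N ! i ! j = 1) [0..<length (hd N)]) = 2) [0..<length N])"
proof -
  have "{i. i < length N \<and> card {j. j < length (hd N) \<and> list_mat N $$ (i, j)} = 2} =
      {i. i < length N \<and> length (filter (\<lambda>j. N ! i ! j = 1) [0..<length (hd N)]) = 2}"
  proof -
    have "card {j. j < length (hd N) \<and> list_mat N $$ (i, j)} = length (filter (\<lambda>j. N ! i ! j = 1) [0..<length (hd N)])"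
      if "i < length N" for i
    proof -
      have "{j. j < length (hd N) \<and> list_mat N $$ (i, j)} = {j. j < length (hd N) \<and> N ! i ! j = 1}"
        using that list_mat_entry by auto
      then show ?thesis by (simp only: card_filter_upt)
    qed
    then show ?thesis by auto
  qed
  then show ?thesis unfolding rows_with_two_def dim_list_mat by (simp only: card_filter_upt)
qed

lemma rows_with_two_M_V: "rows_with_two (list_mat M_V_list) = 2" "rows_with_two (list_mat M_V_comp_list) = 1"
  unfolding rows_with_two_list by code_simp+

text \<open>With three rows the complemented rows also have two ones, so a zero column has to tell
  the two constant words apart.\<close>

lemma zero_column_three: "(\<exists>j<4. \<forall>i<3. \<not> cyc_mat 3 (\<lambda>_. c) $$ (i, j)) \<longleftrightarrow> \<not> c"
proof -
  have e: "cyc_mat 3 (\<lambda>_. c) $$ (i, j) = cyc_entry 3 (\<lambda>_. c) i j" if "i < 3" "j < 4" for i j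
    using cyc_mat_entry[of i 3 j "\<lambda>_. c"] that by simp
  have "(\<exists>j<4. \<forall>i<3. \<not> cyc_mat 3 (\<lambda>_. c) $$ (i, j)) \<longleftrightarrow> (\<exists>j<4. \<forall>i<3. \<not> cyc_entry 3 (\<lambda>_. c) i j)"
    using e by (simp cong: conj_cong)
  also have "\<dots> \<longleftrightarrow> list_ex (\<lambda>j. list_all (\<lambda>i. \<not> cyc_entry 3 (\<lambda>_. c) i j) [0..<3]) [0..<4]"
    unfolding list_ex_iff list_all_iff Bex_def Ball_def by (simp only: set_upt atLeastLessThan_iff le0 simp_thms)
  also have "\<dots> \<longleftrightarrow> \<not> c"
  proof (cases c)
    case True
    then have c: "c = True" by simp
    show ?thesis unfolding c by code_simp
  next
    case False
    then have c: "c = False" by simp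
    show ?thesis unfolding c by code_simp
  qed
  finally show ?thesis .
qed

text \<open>This makes the number of zeros a complete invariant: it separates the words of one
  length from each other and from the constant words.\<close>

lemma A_RowCol_zeros:
  assumes "w \<in> A_RowCol"
  shows "0 < length (filter (\<lambda>i. \<not> word_of w i) [0..<length w])"
    "length (filter (\<lambda>i. \<not> word_of w i) [0..<length w]) < length w"
    and "w' \<in> A_RowCol \<Longrightarrow> length w = length w' \<Longrightarrow> length (filter (\<lambda>i. \<not> word_of w i) [0..<length w]) =
      length (filter (\<lambda>i. \<not> word_of w' i) [0..<length w']) \<Longrightarrow> w = w'"
proof -
  let ?A = "[[0,0,0,1], [0,0,1,1], [0,1,1,1], [0,0,0,0,1], [0,0,0,1,1], [0,0,1,1,1], [0,1,1,1,1],
    [0,0,0,1,1,1]] :: nat list list"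
  let ?z = "\<lambda>w. length (filter (\<lambda>i. \<not> word_of w i) [0..<length w])"
  have A: "A_RowCol = set ?A" unfolding A_RowCol_def by simp
  have "list_all (\<lambda>w. 0 < ?z w \<and> ?z w < length w) ?A" by code_simp
  then show "0 < ?z w" "?z w < length w" using assms unfolding A list_all_iff by blast+
  have "list_all (\<lambda>w. list_all (\<lambda>w'. length w = length w' \<and> ?z w = ?z w' \<longrightarrow> w = w') ?A) ?A" by code_simp
  then show "w' \<in> A_RowCol \<Longrightarrow> length w = length w' \<Longrightarrow> ?z w = ?z w' \<Longrightarrow> w = w'"
    using assms unfolding A list_all_iff by blast
qed

lemma F_RowCol_cases:
  assumes "N \<in> F_RowCol"
  obtains (const) k c where "3 \<le> k" "N = cyc_mat k (\<lambda>_. c)"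
    | (word) w where "w \<in> A_RowCol" "N = cyc_mat (length w) (word_of w)"
    | (M_V) "N = list_mat M_V_list" | (M_V_comp) "N = list_mat M_V_comp_list"
  using assms unfolding F_RowCol_eq by blast

lemma F_RowCol_inequivalent:
  assumes N: "N \<in> F_RowCol" and N': "N' \<in> F_RowCol" and e: "eq_up_to_perm N N'"
  shows "N = N'"
proof -
  have d: "dim_row N = dim_row N'" "dim_col N = dim_col N'" using eq_up_to_permE[OF e] by metis+
  have r: "rows_with_two N = rows_with_two N'" using rows_with_two_eq[OF e] .
  have V: "dim_row (list_mat M_V_list) = 4" "dim_col (list_mat M_V_list) = 6" "dim_row (list_mat M_V_comp_list) = 4"
    "dim_col (list_mat M_V_comp_list) = 6" by (simp_all add: M_V_list_def M_V_comp_list_def)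
  have const: "rows_with_two (cyc_mat k (\<lambda>_. c)) = (if c then 0 else k)" if "4 \<le> k" for k c
    using rows_with_two_cyc[OF that, of "\<lambda>_. c"] by simp
  have word: "rows_with_two (cyc_mat (length w) (word_of w)) = length (filter (\<lambda>i. \<not> word_of w i) [0..<length w])"
    if "w \<in> A_RowCol" for w using rows_with_two_cyc[of "length w" "word_of w"] A_RowCol_length[OF that] by simp
  show ?thesis
  proof (rule F_RowCol_cases[OF N]; rule F_RowCol_cases[OF N'])
    fix k c k' c' assume h: "3 \<le> k" "N = cyc_mat k (\<lambda>_. c)" "3 \<le> k'" "N' = cyc_mat k' (\<lambda>_. c')"
    have k: "k = k'" using d(1) h by simp
    have "c = c'"
    proof (cases "k = 3")
      case True
      then show ?thesis using zero_column_eq[OF e] zero_column_three[of c] zero_column_three[of c'] h k by simp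
    next
      case False
      then have "4 \<le> k" using h(1) by simp
      then show ?thesis using r const[of k c] const[of k c'] h k by (auto split: if_splits)
    qed
    then show ?thesis using h k by simp
  next
    fix k c w assume h: "3 \<le> k" "N = cyc_mat k (\<lambda>_. c)" "w \<in> A_RowCol" "N' = cyc_mat (length w) (word_of w)"
    have k: "k = length w" using d(1) h by simp
    then show ?thesis using const[of k c] r h(2,4) word[OF h(3)] A_RowCol_zeros(1,2)[OF h(3)] A_RowCol_length[OF h(3)]
      by (auto split: if_splits)
  next
    fix k c w assume h: "3 \<le> k" "N' = cyc_mat k (\<lambda>_. c)" "w \<in> A_RowCol" "N = cyc_mat (length w) (word_of w)"
    have k: "k = length w" using d(1) h by simp
    then show ?thesis using const[of k c] r h(2,4) word[OF h(3)] A_RowCol_zeros(1,2)[OF h(3)] A_RowCol_length[OF h(3)]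
      by (auto split: if_splits)
  next
    fix w w' assume h: "w \<in> A_RowCol" "N = cyc_mat (length w) (word_of w)" "w' \<in> A_RowCol"
      "N' = cyc_mat (length w') (word_of w')"
    have l: "length w = length w'" using d(1) unfolding h(2,4) by simp
    have "w = w'" by (rule A_RowCol_zeros(3)[OF h(1,3) l]) (use r word[OF h(1)] word[OF h(3)] in \<open>unfold h(2,4), simp\<close>)
    then show ?thesis unfolding h(2,4) by simp
  qed (use d V r rows_with_two_M_V in auto)
qed

text \<open>The shape keeps the family apart from its transposes.\<close>

lemma F_RowCol_dims: "N \<in> F_RowCol \<Longrightarrow> dim_row N < dim_col N"
  by (erule F_RowCol_cases) (auto simp: M_V_list_def M_V_comp_list_def)

lemma eq_up_to_perm_transpose: "eq_up_to_perm M N \<Longrightarrow> eq_up_to_perm (transpose_mat M) (transpose_mat N)"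
proof -
  assume e: "eq_up_to_perm M N"
  obtain \<sigma> \<tau> where p: "\<sigma> permutes {..<dim_row N}" "\<tau> permutes {..<dim_col N}" and d: "dim_row M = dim_row N"
    "dim_col M = dim_col N"
    and N: "\<And>i j. i < dim_row N \<Longrightarrow> j < dim_col N \<Longrightarrow> N $$ (i, j) = M $$ (\<sigma> i, \<tau> j)"
    using eq_up_to_permE[OF e] by metis
  have s: "\<sigma> i < dim_row N \<longleftrightarrow> i < dim_row N" and t: "\<tau> i < dim_col N \<longleftrightarrow> i < dim_col N" for i
    using permutes_in_image[OF p(1), of i] permutes_in_image[OF p(2), of i] by auto
  have "transpose_mat N = mat (dim_row (transpose_mat M)) (dim_col (transpose_mat M)) (\<lambda>(i,
    j). transpose_mat M $$ (\<tau> i, \<sigma> j))"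
    by (rule eq_matI) (auto simp: d N s t)
  then show ?thesis unfolding eq_up_to_perm_def using p d by - (rule exI[of _ \<tau>], rule exI[of _ \<sigma>], auto)
qed

lemma F_RowCol_Un_transpose_inequivalent:
  assumes "N \<in> F_RowCol \<union> transpose_mat ` F_RowCol" "N' \<in> F_RowCol \<union> transpose_mat ` F_RowCol" and e: "eq_up_to_perm N N'"
  shows "N = N'"
proof -
  have d: "dim_row N = dim_row N'" "dim_col N = dim_col N'" using eq_up_to_permE[OF e] by metis+
  have dT: "dim_col N < dim_row N" if "N \<in> transpose_mat ` F_RowCol" for N :: "bool mat" using that F_RowCol_dims by auto
  from assms(1,2) consider "N \<in> F_RowCol" "N' \<in> F_RowCol" | "N \<in> transpose_mat ` F_RowCol" "N' \<in> transpose_mat ` F_RowCol"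
    using F_RowCol_dims[of N] F_RowCol_dims[of N'] dT[of N] dT[of N'] d by force
  then show ?thesis
  proof cases
    case 1 then show ?thesis using F_RowCol_inequivalent e by blast
  next
    case 2
    then obtain K K' where K: "K \<in> F_RowCol" "N = transpose_mat K" "K' \<in> F_RowCol" "N' = transpose_mat K'" by blast
    have "eq_up_to_perm K K'" using eq_up_to_perm_transpose[OF e] unfolding K(2,4) by simp
    then show ?thesis using F_RowCol_inequivalent[OF K(1,3)] K by simp
  qed
qed

text \<open>If only the column property fails, the row analysis is applied to the transpose, and
  transposing the matrix found stays in the family.\<close>

lemma not_circular_contains:
  assumes "\<not> circular_ones_rows_cols M"
  shows "\<exists>N\<in>F_RowCol \<union> transpose_mat ` F_RowCol. contains_configuration M N"
proof (cases "circ {..<dim_row M} {..<dim_col M} (\<lambda>i j. M $$ (i, j))")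
  case False
  then show ?thesis using noncirc_embeds unfolding contains_configuration_iff by blast
next
  case True
  then have n: "\<not> circ {..<dim_col M} {..<dim_row M} (\<lambda>j i. M $$ (i, j))"
    using assms unfolding circular_ones_rows_cols_iff by blast
  have "\<not> circ {..<dim_row (transpose_mat M)} {..<dim_col (transpose_mat M)} (\<lambda>i j. transpose_mat M $$ (i, j))"
  proof
    assume c: "circ {..<dim_row (transpose_mat M)} {..<dim_col (transpose_mat M)} (\<lambda>i j. transpose_mat M $$ (i, j))"
    have "circ {..<dim_col M} {..<dim_row M} (\<lambda>j i. M $$ (i, j))"
      by (rule circ_transfer[OF c, of id _ id]) auto
    then show False using n by contradiction
  qed
  from noncirc_embeds[OF this] obtain N where N: "N \<in> F_RowCol \<union> transpose_mat ` F_RowCol"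
    "embeds_mat N (transpose_mat M)" by blast
  have "embeds_mat (transpose_mat N) M" using N(2) embeds_mat_transpose[of N "transpose_mat M"] by simp
  moreover have "transpose_mat N \<in> F_RowCol \<union> transpose_mat ` F_RowCol" using N(1) by auto
  ultimately show ?thesis unfolding contains_configuration_iff by blast
qed

theorem theorem16:
  shows "(\<forall>M. circular_ones_rows_cols M \<longleftrightarrow>
            \<not> (\<exists>N \<in> F_RowCol \<union> transpose_mat ` F_RowCol. contains_configuration M N)) \<and>
         (\<forall>\<G>. \<G> \<subset> F_RowCol \<union> transpose_mat ` F_RowCol \<longrightarrow>
            \<not> characterized_by_forbidden circular_ones_rows_cols \<G>) \<and>
         (\<forall>N \<in> F_RowCol \<union> transpose_mat ` F_RowCol.
            minimal_forbidden_submatrix circular_ones_rows_cols N)"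
proof (intro conjI allI ballI impI notI)
  have bad: "\<not> circular_ones_rows_cols N" if "N \<in> F_RowCol \<union> transpose_mat ` F_RowCol" for N
    using F_RowCol_minimal[OF that] unfolding minimal_forbidden_submatrix_def by blast
  have hereditary: "circular_ones_rows_cols N" if "circular_ones_rows_cols M" "contains_configuration M N" for M N
    using that circ_mat_embeds unfolding circular_ones_rows_cols_iff contains_configuration_iff by blast
  show "circular_ones_rows_cols M \<longleftrightarrow> \<not> (\<exists>N\<in>F_RowCol \<union> transpose_mat ` F_RowCol. contains_configuration M N)" for M
    using not_circular_contains[of M] hereditary[of M] bad by blast
  show "minimal_forbidden_submatrix circular_ones_rows_cols N" if "N \<in> F_RowCol \<union> transpose_mat ` F_RowCol" for N
    using F_RowCol_minimal[OF that] .
  fix \<G> assume G: "\<G> \<subset> F_RowCol \<union> transpose_mat ` F_RowCol" "characterized_by_forbidden circular_ones_rows_cols \<G>"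
  \<comment> \<open>The omitted \<open>N\<close> is not circular, so it contains some
    \<open>N'\<close> of \<open>\<G>\<close>. As \<open>N\<close> is minimal, the submatrix found is
    all of \<open>N\<close>, and inequivalence of the members gives \<open>N = N'\<close>.\<close>
  obtain N where N: "N \<in> F_RowCol \<union> transpose_mat ` F_RowCol" "N \<notin> \<G>" using G(1) by blast
  obtain N' where N': "N' \<in> \<G>" "contains_configuration N N'"
    using bad[OF N(1)] G(2) unfolding characterized_by_forbidden_def by blast
  have N'F: "N' \<in> F_RowCol \<union> transpose_mat ` F_RowCol" using N'(1) G(1) by blast
  obtain I J where IJ: "eq_up_to_perm (submatrix N I J) N'" using N'(2) unfolding contains_configuration_def by blast
  have full: "\<And>M :: bool mat. submatrix M UNIV UNIV = M"
    by (rule eq_matI) (simp_all add: dim_submatrix submatrix_index pick_full)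
  have "contains_configuration (submatrix N I J) N'"
    unfolding contains_configuration_def using IJ full by metis
  then have "\<not> circular_ones_rows_cols (submatrix N I J)" using hereditary bad[OF N'F] by blast
  then have "submatrix N I J = N" using F_RowCol_minimal[OF N(1)] unfolding minimal_forbidden_submatrix_def by blast
  then have "N = N'" using F_RowCol_Un_transpose_inequivalent[OF N(1) N'F] IJ by simp
  then show False using N(2) N'(1) by simp
qed

end
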